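(* Let $n\ge1$, $N=2^n$. Let $\rho^{\mathrm{inj}}_0$ and $\rho^{\mathrm{inj}}_1$ be the average final states on the algorithm system of any $T$-query forward-erasing strategy (querying $E_{f_{h,r}}$) under $h\sim\mathcal H_0$ and $h\sim\mathcal H_1$, respectively, with one uniformly random tag table $r\in X^X$, independent of $h$, sampled at the beginning and reused on every query. If $T\le\sqrt N$, then $$\|\rho^{\mathrm{inj}}_0-\rho^{\mathrm{inj}}_1\|_1\le\frac{T(T-1)}{N-1}+\frac{6T}{\sqrt N}.$$ Every bounded-error forward-erasing algorithm for $\mathrm{GarbageSimon}_n$ therefore uses more than $\sqrt N/16$ queries. Consequently, for every $n\ge1$, $$Q_{\mathrm{XOR}}(\mathrm{GarbageSimon}_n)\le n+2,\qquad Q_{\mathrm{erase}}(\mathrm{GarbageSimon}_n)=\Theta(2^{n/2}).$$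
   Context: Let $X=\mathbb F_2^n$, $N=|X|=2^n$, $\oplus$ bitwise XOR; $\|A\|_1=\operatorname{Tr}\sqrt{A^\dagger A}$ (unhalved trace norm). A Simon function with nonzero shift $s\in X$ is $h:X\to X$ with $h(x)=h(y)\iff y\in\{x,x\oplus s\}$. For $h,r:X\to X$ let $f_{h,r}:X\to X^3$, $f_{h,r}(x)=(h(x),x,r_x)$; this is injective. $\mathrm{GarbageSimon}_n$: given oracle access to $f_{h,r}$ with $r$ arbitrary, decide whether $h$ is a permutation of $X$ (NO) or a Simon function with some nonzero shift (YES), promised that one holds. Distributions: under $\mathcal H_0$, $h$ is a uniformly random permutation of $X$. Under $\mathcal H_1$, choose $s$ uniformly from $X\setminus\{0\}$, let $\mathcal P_s=\{\{x,x\oplus s\}\mid x\in X\}$, choose a uniformly random injection $\lambda:\mathcal P_s\hookrightarrow X$ and set $h(x)=\lambda(\{x,x\oplus s\})$. Oracles: the standard XOR oracle of $f:\{0,1\}^k\to\{0,1\}^\ell$ is the unitary $O_f|x,z\rangle=|x,z\oplus f(x)\rangle$. The forward-erasing oracle of an injection $f$ is the isometry $E_f|x\rangle=|f(x)\rangle$ (here from $\mathbb C^X$ to $\mathbb C^{X^3}$); neither $E_f^\dagger$ nor a unitary extension is available. A $T$-query strategy starts in a fixed pure state on a finite-dimensional system, applies the oracle map $T$ times to a query register (tensored with the identity on a workspace), with arbitrary oracle-independent isometries before, between and after the queries (general channels and measurements being purified, with all purifying registers included in the algorithm system). An algorithm additionally ends with a two-outcome measurement; it is bounded-error if it is correct with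 probability at least $2/3$ on every promised input. $Q_{\mathrm{XOR}}$, $Q_{\mathrm{erase}}$ are the minimum numbers of queries of bounded-error algorithms using the standard XOR, respectively forward-erasing, oracle. Constants in $\Theta$ are absolute. *)

theory Defs
  imports
    "HOL-Probability.Probability_Mass_Function"
    "HOL-Library.Extended_Nat"
    "HOL-Library.Extended_Real"
    "Jordan_Normal_Form.Schur_Decomposition"
begin

unbundle bit_operations_syntax

section \<open>Matrices\<close>

text \<open>The computational basis vectors of an \<open>N\<close>-dimensional space are
  indexed by \<open>0, ..., N - 1\<close>; a tensor product orders its basis lexicographically, so that
  the basis vector \<open>|i, j>\<close> of \<open>C^a \<otimes> C^b\<close> has index \<open>i * b + j\<close>.\<close>

definition kron :: "complex mat \<Rightarrow> complex mat \<Rightarrow> complex mat" where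
  "kron A B = mat (dim_row A * dim_row B) (dim_col A * dim_col B)
     (\<lambda>(i, j). A $$ (i div dim_row B, j div dim_col B) * B $$ (i mod dim_row B, j mod dim_col B))"

definition mat_trace :: "complex mat \<Rightarrow> complex" where
  "mat_trace A = (\<Sum>i<dim_row A. A $$ (i, i))"

definition isometry_mat :: "complex mat \<Rightarrow> bool" where
  "isometry_mat V \<longleftrightarrow> mat_adjoint V * V = 1\<^sub>m (dim_col V)"

text \<open>The order on \<open>complex\<close> is that of Complex\_Order: \<open>0 \<le> z\<close> says that \<open>z\<close> is real and
  nonnegative. Over the complex numbers this already makes \<open>A\<close> Hermitian.\<close>

definition psd :: "nat \<Rightarrow> complex mat \<Rightarrow> bool" where
  "psd d A \<longleftrightarrow> A \<in> carrier_mat d d \<and>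
     (\<forall>v \<in> carrier_vec d. 0 \<le> cscalar_prod (A *\<^sub>v v) v)"

definition psd_sqrt :: "complex mat \<Rightarrow> complex mat" where
  "psd_sqrt A = (THE B. psd (dim_row A) B \<and> B * B = A)"

definition trace_norm :: "complex mat \<Rightarrow> real" where
  "trace_norm A = Re (mat_trace (psd_sqrt (mat_adjoint A * A)))"

definition pure_density :: "complex vec \<Rightarrow> complex mat" where
  "pure_density v = mat (dim_vec v) (dim_vec v)
     (\<lambda>(i, j). vec_index v i * conjugate (vec_index v j))"


section \<open>Functions on bit strings and the oracles\<close>

text \<open>A bit string of length \<open>n\<close> is identified with the natural number it denotes in binary, so
  that bitwise exclusive or is \<open>XOR\<close> on \<open>nat\<close>, and a concatenation of bit strings
  is an index into the tensor product of their spaces.\<close>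

definition bits :: "nat \<Rightarrow> nat set" where
  "bits n = {..<2 ^ n}"

definition concat3 :: "nat \<Rightarrow> nat \<times> nat \<times> nat \<Rightarrow> nat" where
  "concat3 n = (\<lambda>(a, b, c). (a * 2 ^ n + b) * 2 ^ n + c)"

definition garbage_fun :: "(nat \<Rightarrow> nat) \<Rightarrow> (nat \<Rightarrow> nat) \<Rightarrow> nat \<Rightarrow> nat \<times> nat \<times> nat" where
  "garbage_fun h r x = (h x, x, r x)"

text \<open>The standard oracle \<open>|x, z> \<mapsto> |x, z XOR f x>\<close> of \<open>f : {0,1}^k \<rightarrow> {0,1}^l\<close>.\<close>

definition xor_oracle :: "nat \<Rightarrow> nat \<Rightarrow> (nat \<Rightarrow> nat) \<Rightarrow> complex mat" where
  "xor_oracle k l f = mat (2 ^ k * 2 ^ l) (2 ^ k * 2 ^ l)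
     (\<lambda>(i, j). let x = j div 2 ^ l; z = j mod 2 ^ l
               in if i = x * 2 ^ l + (z XOR f x) then 1 else 0)"

text \<open>The forward-erasing oracle \<open>|x> \<mapsto> |f x>\<close> of an injection \<open>f : {0,1}^k \<rightarrow> {0,1}^l\<close>.\<close>

definition erasing_oracle :: "nat \<Rightarrow> nat \<Rightarrow> (nat \<Rightarrow> nat) \<Rightarrow> complex mat" where
  "erasing_oracle k l f = mat (2 ^ l) (2 ^ k) (\<lambda>(i, x). if i = f x then 1 else 0)"

definition garbage_xor_oracle ::
    "nat \<Rightarrow> (nat \<Rightarrow> nat) \<Rightarrow> (nat \<Rightarrow> nat) \<Rightarrow> complex mat" where
  "garbage_xor_oracle n h r = xor_oracle n (3 * n) (concat3 n \<circ> garbage_fun h r)"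

definition garbage_erasing_oracle ::
    "nat \<Rightarrow> (nat \<Rightarrow> nat) \<Rightarrow> (nat \<Rightarrow> nat) \<Rightarrow> complex mat" where
  "garbage_erasing_oracle n h r = erasing_oracle n (3 * n) (concat3 n \<circ> garbage_fun h r)"

lemma xor_lt_two_power:
  assumes "a < 2 ^ l" "b < 2 ^ l"
  shows "(a XOR b :: nat) < 2 ^ l"
  using assms by (metis take_bit_nat_eq_self take_bit_nat_less_exp take_bit_xor)

lemma xor_oracle_basis:
  assumes "x < 2 ^ k" "z < 2 ^ l" "f x < 2 ^ l"
  shows "xor_oracle k l f *\<^sub>v unit_vec (2 ^ k * 2 ^ l) (x * 2 ^ l + z)
       = unit_vec (2 ^ k * 2 ^ l) (x * 2 ^ l + (z XOR f x))"
proof -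
  have lt: "x * 2 ^ l + y < 2 ^ k * 2 ^ l" if "y < 2 ^ l" for y :: nat
  proof -
    have "x * 2 ^ l + y < (x + 1) * 2 ^ l"
      using that by simp
    also have "\<dots> \<le> 2 ^ k * 2 ^ l"
      using assms(1) by (intro mult_right_mono) simp_all
    finally show ?thesis .
  qed
  have "xor_oracle k l f *\<^sub>v unit_vec (2 ^ k * 2 ^ l) (x * 2 ^ l + z)
      = col (xor_oracle k l f) (x * 2 ^ l + z)"
    using lt[OF assms(2)] by (intro eq_vecI) (auto simp: xor_oracle_def)
  also have "\<dots> = unit_vec (2 ^ k * 2 ^ l) (x * 2 ^ l + (z XOR f x))"
    using lt[OF assms(2)] lt[OF xor_lt_two_power[OF assms(2,3)]] assms(2)
    by (intro eq_vecI) (auto simp: xor_oracle_def Let_def)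
  finally show ?thesis .
qed

lemma erasing_oracle_basis:
  assumes "x < 2 ^ k" "f x < 2 ^ l"
  shows "erasing_oracle k l f *\<^sub>v unit_vec (2 ^ k) x = unit_vec (2 ^ l) (f x)"
proof -
  have "erasing_oracle k l f *\<^sub>v unit_vec (2 ^ k) x = col (erasing_oracle k l f) x"
    using assms by (intro eq_vecI) (auto simp: erasing_oracle_def)
  also have "\<dots> = unit_vec (2 ^ l) (f x)"
    using assms by (intro eq_vecI) (auto simp: erasing_oracle_def)
  finally show ?thesis .
qed


section \<open>The promise and the two distributions\<close>

definition simon_function :: "nat \<Rightarrow> nat \<Rightarrow> (nat \<Rightarrow> nat) \<Rightarrow> bool" where
  "simon_function n s h \<longleftrightarrow> h \<in> bits n \<rightarrow> bits n \<and>
     (\<forall>x \<in> bits n. \<forall>y \<in> bits n. h x = h y \<longleftrightarrow> y \<in> {x, x XOR s})"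

definition perm_dist :: "nat \<Rightarrow> (nat \<Rightarrow> nat) pmf" where
  "perm_dist n = pmf_of_set {h \<in> bits n \<rightarrow>\<^sub>E bits n. bij_betw h (bits n) (bits n)}"

definition shift_pairs :: "nat \<Rightarrow> nat \<Rightarrow> nat set set" where
  "shift_pairs n s = {{x, x XOR s} |x. x \<in> bits n}"

definition simon_dist :: "nat \<Rightarrow> (nat \<Rightarrow> nat) pmf" where
  "simon_dist n =
     bind_pmf (pmf_of_set (bits n - {0})) (\<lambda>s.
     bind_pmf (pmf_of_set {l \<in> shift_pairs n s \<rightarrow>\<^sub>E bits n. inj_on l (shift_pairs n s)}) (\<lambda>l.
     return_pmf (restrict (\<lambda>x. l {x, x XOR s}) (bits n))))"

definition tag_dist :: "nat \<Rightarrow> (nat \<Rightarrow> nat) pmf" where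
  "tag_dist n = pmf_of_set (bits n \<rightarrow>\<^sub>E bits n)"


section \<open>Query strategies\<close>

text \<open>A strategy for oracles from a query register of dimension \<open>a\<close> to one of dimension \<open>b\<close>.
  The isometry \<open>iso t\<close> is applied before query number \<open>t\<close> (counted from 0), and
  \<open>iso (queries S)\<close> after the last query. At query \<open>t\<close> the system is the query register
  tensored with a workspace of dimension \<open>work S t\<close>; workspace dimensions may vary, so
  registers can be attached at will.\<close>

record strategy =
  queries :: nat
  init_state :: "complex vec"
  work :: "nat \<Rightarrow> nat"
  iso :: "nat \<Rightarrow> complex mat"
  final_dim :: nat

definition source_dim :: "nat \<Rightarrow> strategy \<Rightarrow> nat \<Rightarrow> nat" where
  "source_dim b S t = (case t of 0 \<Rightarrow> dim_vec (init_state S) | Suc t' \<Rightarrow> b * work S t')"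

definition target_dim :: "nat \<Rightarrow> strategy \<Rightarrow> nat \<Rightarrow> nat" where
  "target_dim a S t = (if t < queries S then a * work S t else final_dim S)"

definition valid_strategy :: "nat \<Rightarrow> nat \<Rightarrow> strategy \<Rightarrow> bool" where
  "valid_strategy a b S \<longleftrightarrow>
     cscalar_prod (init_state S) (init_state S) = 1 \<and>
     (\<forall>t \<le> queries S.
        iso S t \<in> carrier_mat (target_dim a S t) (source_dim b S t) \<and> isometry_mat (iso S t))"

fun state_after :: "complex mat \<Rightarrow> strategy \<Rightarrow> nat \<Rightarrow> complex vec" where
  "state_after Q S 0 = iso S 0 *\<^sub>v init_state S"
| "state_after Q S (Suc t) =
     iso S (Suc t) *\<^sub>v (kron Q (1\<^sub>m (work S t)) *\<^sub>v state_after Q S t)"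

definition final_state :: "complex mat \<Rightarrow> strategy \<Rightarrow> complex mat" where
  "final_state Q S = pure_density (state_after Q S (queries S))"

definition average_state ::
    "nat \<Rightarrow> (nat \<Rightarrow> nat) pmf \<Rightarrow> ((nat \<Rightarrow> nat) \<Rightarrow> (nat \<Rightarrow> nat) \<Rightarrow> complex mat) \<Rightarrow> strategy
     \<Rightarrow> complex mat" where
  "average_state n D Q S = mat (final_dim S) (final_dim S) (\<lambda>ij.
     measure_pmf.expectation (pair_pmf D (tag_dist n)) (\<lambda>(h, r). final_state (Q h r) S $$ ij))"


section \<open>Algorithms and query complexity\<close>

text \<open>Outcome \<open>True\<close> is the answer YES. The measurement is a general two-outcome POVM.\<close>

record algorithm = strategy +
  effect :: "bool \<Rightarrow> complex mat"

definition valid_algorithm :: "nat \<Rightarrow> nat \<Rightarrow> algorithm \<Rightarrow> bool" where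
  "valid_algorithm a b A \<longleftrightarrow> valid_strategy a b (strategy.truncate A) \<and>
     (\<forall>c. psd (final_dim A) (effect A c)) \<and>
     effect A True + effect A False = 1\<^sub>m (final_dim A)"

definition outcome_prob :: "complex mat \<Rightarrow> algorithm \<Rightarrow> bool \<Rightarrow> real" where
  "outcome_prob Q A c = Re (mat_trace (effect A c * final_state Q (strategy.truncate A)))"

definition bounded_error ::
    "nat \<Rightarrow> ((nat \<Rightarrow> nat) \<Rightarrow> (nat \<Rightarrow> nat) \<Rightarrow> complex mat) \<Rightarrow> algorithm \<Rightarrow> bool" where
  "bounded_error n Q A \<longleftrightarrow> (\<forall>h \<in> bits n \<rightarrow> bits n. \<forall>r \<in> bits n \<rightarrow> bits n.
     (bij_betw h (bits n) (bits n) \<longrightarrow> outcome_prob (Q h r) A False \<ge> 2 / 3) \<and>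
     ((\<exists>s \<in> bits n - {0}. simon_function n s h) \<longrightarrow> outcome_prob (Q h r) A True \<ge> 2 / 3))"

definition xor_algorithm :: "nat \<Rightarrow> algorithm \<Rightarrow> bool" where
  "xor_algorithm n A \<longleftrightarrow> valid_algorithm (2 ^ n * 2 ^ (3 * n)) (2 ^ n * 2 ^ (3 * n)) A \<and>
     bounded_error n (garbage_xor_oracle n) A"

definition erasing_algorithm :: "nat \<Rightarrow> algorithm \<Rightarrow> bool" where
  "erasing_algorithm n A \<longleftrightarrow> valid_algorithm (2 ^ n) (2 ^ (3 * n)) A \<and>
     bounded_error n (garbage_erasing_oracle n) A"

text \<open>The minimum is taken in \<open>enat\<close>, so that it would be infinite if there were no algorithm.\<close>

definition Q_xor :: "nat \<Rightarrow> enat" where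
  "Q_xor n = Inf {enat (queries A) |A. xor_algorithm n A}"

definition Q_erase :: "nat \<Rightarrow> enat" where
  "Q_erase n = Inf {enat (queries A) |A. erasing_algorithm n A}"

end

theory Submission
  imports Defs "Jordan_Normal_Form.Spectral_Radius"
begin

unbundle no vec_syntax

declare index_mult_mat(1) [simp del] index_mult_mat_vec [simp del]

text \<open>Lower bound. Expand the amplitudes of a run as functions of the random tag table into
  components indexed by the set \<open>A\<close> of points whose tags fluctuate. A query at \<open>x\<close> writes \<open>r x\<close>
  into the answer; subtracting the average over \<open>r x\<close> from the resulting amplitude removes exactly the
  fraction \<open>1 / N\<close> of the weight, whatever the state was, and afterwards \<open>x\<close> belongs to \<open>A\<close>. So up to an
  error \<open>T / sqrt N\<close> in norm, every point queried along a branch is recorded in \<open>A\<close>. Different \<open>A\<close> are orthogonal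
  in the tag table, hence incoherent after averaging, and the component at \<open>A\<close> depends only on the restriction of
  \<open>h\<close> to \<open>A\<close>. Unless the shift is a difference of two points of \<open>A\<close>, this restriction is a
  uniformly random injection under both distributions. Since the total weight of the kept components
  does not depend on \<open>h\<close>, the weight on the exceptional pairs of \<open>A\<close> and shift is the same
  under both distributions, and at most \<open>T (T - 1) / (2 (N - 1))\<close> for each of them.

  Upper bounds. With the XOR oracle, uniform superpositions in the registers of the last two
  components make them unaffected by the query, which leaves Simon's algorithm. With the forward-erasing
  oracle, each shift is the difference of a string supported on the low half of the positions
  and one supported on the high half, so querying all such strings finds a collision with certainty.\<close>

section \<open>Matrices\<close>

text \<open>The obstacle is that one tag table serves all queries. A point may be queried again when
  its tag already correlates with the state, so a later answer is not fresh randomness and a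
  lazy-sampling argument does not apply as it stands. What survives is an identity: for a fixed
  answer tag \<open>z\<close> the part that does not fluctuate may be large or small, but summed
  over all \<open>z\<close> its weight is a fixed fraction of the input weight. An inequality would
  bound the loss equally well, but the equality serves a second purpose. The set of recorded points
  is chosen by the algorithm in response to \<open>h\<close>, so under the Simon distribution it may
  favour sets that contain a colliding pair, and counting shifts for a fixed set says nothing about
  its weight there. Since the total kept weight is \<open>(1 - 1 / N) ^ T\<close> for every single
  \<open>h\<close>, whatever weight the exceptional pairs carry under one distribution they carry
  under the other as well, and for permutations the set is independent of the shift, so that
  counting works.\<close>

lemma mat_adjoint_dim [simp]:
  "dim_row (mat_adjoint A) = dim_col A" "dim_col (mat_adjoint A) = dim_row A"
  by (auto simp: mat_adjoint_def)

lemma mat_adjoint_index [simp]: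
  fixes A :: "complex mat"
  assumes "i < dim_col A" "j < dim_row A"
  shows "mat_adjoint A $$ (i, j) = cnj (A $$ (j, i))"
  using assms by (auto simp: mat_adjoint_def mat_of_rows_index)

lemma mat_adjoint_carrier [simp]:
  "A \<in> carrier_mat m n \<Longrightarrow> mat_adjoint A \<in> carrier_mat n m"
  by auto

lemma mat_adjoint_adjoint [simp]: "mat_adjoint (mat_adjoint A) = (A :: complex mat)"
  by (intro eq_matI) auto

lemma mat_mult_index:
  fixes A B :: "complex mat"
  assumes "i < dim_row A" "j < dim_col B" "dim_row B = dim_col A"
  shows "(A * B) $$ (i, j) = (\<Sum>k<dim_col A. A $$ (i, k) * B $$ (k, j))"
  using assms by (auto simp: index_mult_mat(1) scalar_prod_def atLeast0LessThan intro!: sum.cong)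

lemma mat_vec_index:
  fixes A :: "complex mat"
  assumes "i < dim_row A" "dim_vec v = dim_col A"
  shows "(A *\<^sub>v v) $ i = (\<Sum>k<dim_col A. A $$ (i, k) * v $ k)"
  using assms by (auto simp: index_mult_mat_vec scalar_prod_def atLeast0LessThan intro!: sum.cong)

lemma cscalar_prod_sum:
  fixes u v :: "complex vec"
  assumes "dim_vec u = dim_vec v"
  shows "u \<bullet>c v = (\<Sum>i<dim_vec v. u $ i * cnj (v $ i))"
  using assms by (auto simp: scalar_prod_def atLeast0LessThan intro!: sum.cong)

lemma mat_adjoint_mult:
  fixes A B :: "complex mat"
  assumes "dim_row B = dim_col A"
  shows "mat_adjoint (A * B) = mat_adjoint B * mat_adjoint A"
proof (rule eq_matI)
  fix i j assume "i < dim_row (mat_adjoint B * mat_adjoint A)" "j < dim_col (mat_adjoint B * mat_adjoint A)"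
  then have ij: "i < dim_col B" "j < dim_row A" by auto
  then show "mat_adjoint (A * B) $$ (i, j) = (mat_adjoint B * mat_adjoint A) $$ (i, j)"
    using assms
    by (simp add: mat_mult_index) (auto intro!: sum.cong)
qed auto

lemma mat_adjoint_one [simp]: "mat_adjoint (1\<^sub>m n :: complex mat) = 1\<^sub>m n"
  by (intro eq_matI) auto

lemma adjoint_swap:
  fixes A :: "complex mat"
  assumes A: "A \<in> carrier_mat m n" and v: "v \<in> carrier_vec n" and w: "w \<in> carrier_vec m"
  shows "(A *\<^sub>v v) \<bullet>c w = v \<bullet>c (mat_adjoint A *\<^sub>v w)"
proof -
  have "(A *\<^sub>v v) \<bullet>c w = (\<Sum>i<m. \<Sum>k<n. A $$ (i, k) * v $ k * cnj (w $ i))"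
    using A v w by (auto simp: cscalar_prod_sum mat_vec_index sum_distrib_right intro!: sum.cong)
  also have "\<dots> = (\<Sum>k<n. \<Sum>i<m. A $$ (i, k) * v $ k * cnj (w $ i))"
    by (rule sum.swap)
  also have "\<dots> = v \<bullet>c (mat_adjoint A *\<^sub>v w)"
    using A v w by (auto simp: cscalar_prod_sum mat_vec_index sum_distrib_left intro!: sum.cong)
  finally show ?thesis .
qed

lemma isometry_cscalar_prod:
  assumes "isometry_mat V" and V: "V \<in> carrier_mat m n"
    and v: "v \<in> carrier_vec n" and w: "w \<in> carrier_vec n"
  shows "(V *\<^sub>v v) \<bullet>c (V *\<^sub>v w) = v \<bullet>c w"
proof -
  have "mat_adjoint V *\<^sub>v (V *\<^sub>v w) = (mat_adjoint V * V) *\<^sub>v w"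
    using V w by (auto simp: assoc_mult_mat_vec[of _ n m _ n])
  with assms show ?thesis
    by (auto simp: isometry_mat_def adjoint_swap[of V m n v])
qed

text \<open>For a square matrix a left inverse is also a right inverse.\<close>

lemma isometry_unitary:
  assumes "isometry_mat U" "U \<in> carrier_mat n n"
  shows "mat_adjoint U * U = 1\<^sub>m n" "U * mat_adjoint U = 1\<^sub>m n"
proof -
  show "mat_adjoint U * U = 1\<^sub>m n" using assms by (auto simp: isometry_mat_def)
  then show "U * mat_adjoint U = 1\<^sub>m n"
    using mat_mult_left_right_inverse assms(2) mat_adjoint_carrier by blast
qed

section \<open>Hermitian matrices and real diagonal matrices\<close>

definition hermitian_mat :: "complex mat \<Rightarrow> bool" where
  "hermitian_mat A \<longleftrightarrow> mat_adjoint A = A"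

definition real_diag :: "nat \<Rightarrow> (nat \<Rightarrow> real) \<Rightarrow> complex mat" where
  "real_diag n l = mat n n (\<lambda>(i, j). if i = j then complex_of_real (l i) else 0)"

lemma real_diag_carrier [simp]: "real_diag n l \<in> carrier_mat n n"
  by (simp add: real_diag_def)

lemma real_diag_dim [simp]: "dim_row (real_diag n l) = n" "dim_col (real_diag n l) = n"
  by (simp_all add: real_diag_def)

lemma real_diag_index [simp]:
  "i < n \<Longrightarrow> j < n \<Longrightarrow> real_diag n l $$ (i, j) = (if i = j then complex_of_real (l i) else 0)"
  by (simp add: real_diag_def)

lemma real_diag_mult: "real_diag n l * real_diag n l' = real_diag n (\<lambda>i. l i * l' i)"
  by (intro eq_matI) (auto simp: mat_mult_index if_distrib[of "\<lambda>x. x * _"] sum.delta cong: if_cong)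

lemma real_diag_adjoint [simp]: "mat_adjoint (real_diag n l) = real_diag n l"
  by (intro eq_matI) auto

lemma real_diag_one: "real_diag n (\<lambda>i. 1) = 1\<^sub>m n"
  by (intro eq_matI) auto

lemma cscalar_prod_self: "v \<bullet>c v = complex_of_real (\<Sum>i<dim_vec v. (cmod (v $ i))\<^sup>2)"
  for v :: "complex vec"
  by (simp add: cscalar_prod_sum complex_norm_square del: of_real_power)

lemma hermitian_eigenvalue_real:
  assumes "hermitian_mat A" and A: "A \<in> carrier_mat n n" and v: "v \<in> carrier_vec n" "v \<noteq> 0\<^sub>v n"
    and e: "A *\<^sub>v v = e \<cdot>\<^sub>v v"
  shows "cnj e = e"
proof -
  have "e * (v \<bullet>c v) = (A *\<^sub>v v) \<bullet>c v" using v by (simp add: e)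
  also have "\<dots> = v \<bullet>c (A *\<^sub>v v)"
    using assms by (subst adjoint_swap[OF A]) (auto simp: hermitian_mat_def)
  also have "\<dots> = cnj e * (v \<bullet>c v)" using v by (simp add: e conjugate_smult_vec)
  finally show ?thesis using v conjugate_square_eq_0_vec by auto
qed

section \<open>The spectral theorem for Hermitian matrices\<close>

text \<open>The block diagonal matrix with blocks \<open>c\<close> and \<open>A\<close>, the shape
  reached in the induction step of the spectral theorem.\<close>

definition border :: "complex \<Rightarrow> complex mat \<Rightarrow> complex mat" where
  "border c A = mat (Suc (dim_row A)) (Suc (dim_col A))
     (\<lambda>(i, j). case (i, j) of (0, 0) \<Rightarrow> c | (Suc i, Suc j) \<Rightarrow> A $$ (i, j) | _ \<Rightarrow> 0)"

lemma border_dim [simp]: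
  "dim_row (border c A) = Suc (dim_row A)" "dim_col (border c A) = Suc (dim_col A)"
  by (simp_all add: border_def)

lemma border_index [simp]:
  "border c A $$ (0, 0) = c"
  "j < dim_col A \<Longrightarrow> border c A $$ (0, Suc j) = 0"
  "i < dim_row A \<Longrightarrow> border c A $$ (Suc i, 0) = 0"
  "i < dim_row A \<Longrightarrow> j < dim_col A \<Longrightarrow> border c A $$ (Suc i, Suc j) = A $$ (i, j)"
  by (auto simp: border_def)

lemma border_mult:
  assumes "dim_row B = dim_col A"
  shows "border c A * border d B = border (c * d) (A * B)"
proof (rule eq_matI)
  fix i j
  assume "i < dim_row (border (c * d) (A * B))" "j < dim_col (border (c * d) (A * B))"
  then show "(border c A * border d B) $$ (i, j) = border (c * d) (A * B) $$ (i, j)"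
    using assms
    by (cases i; cases j)
       (auto simp: mat_mult_index sum.lessThan_Suc_shift simp del: sum.lessThan_Suc)
qed (use assms in auto)

lemma border_adjoint: "mat_adjoint (border c A) = border (cnj c) (mat_adjoint A)"
proof (rule eq_matI)
  fix i j
  assume "i < dim_row (border (cnj c) (mat_adjoint A))" "j < dim_col (border (cnj c) (mat_adjoint A))"
  then show "mat_adjoint (border c A) $$ (i, j) = border (cnj c) (mat_adjoint A) $$ (i, j)"
    by (cases i; cases j) auto
qed auto

lemma border_one: "border 1 (1\<^sub>m n) = 1\<^sub>m (Suc n)"
proof (rule eq_matI)
  fix i j
  assume "i < dim_row (1\<^sub>m (Suc n) :: complex mat)" "j < dim_col (1\<^sub>m (Suc n) :: complex mat)"
  then show "border 1 (1\<^sub>m n) $$ (i, j) = 1\<^sub>m (Suc n) $$ (i, j)"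
    by (cases i; cases j) auto
qed auto

lemma border_real_diag:
  "border (complex_of_real c) (real_diag n l) = real_diag (Suc n) (case_nat c l)"
proof (rule eq_matI)
  fix i j
  assume "i < dim_row (real_diag (Suc n) (case_nat c l))" "j < dim_col (real_diag (Suc n) (case_nat c l))"
  then show "border (complex_of_real c) (real_diag n l) $$ (i, j) = real_diag (Suc n) (case_nat c l) $$ (i, j)"
    by (cases i; cases j) auto
qed auto

text \<open>Complete \<open>v\<close> to a basis and orthogonalize, which keeps \<open>v\<close> in
  front; dividing every vector by its norm then gives orthonormal columns, the first one a multiple
  of \<open>v\<close>.\<close>

lemma unitary_with_first_column:
  fixes v :: "complex vec"
  assumes v: "v \<in> carrier_vec n" "v \<noteq> 0\<^sub>v n"
  obtains W c where "W \<in> carrier_mat n n" "isometry_mat W" "col W 0 = c \<cdot>\<^sub>v v" "c \<noteq> 0"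
proof -
  interpret cof_vec_space n "TYPE(complex)" .
  define b where "b = basis_completion v"
  define ws where "ws = gram_schmidt n b"
  from basis_completion[OF v, folded b_def]
  have dist_b: "distinct b" and indep: "\<not> lin_dep (set b)" and b: "set b \<subseteq> carrier_vec n"
    and hdb: "hd b = v" and len_b: "length b = n" by auto
  have n: "0 < n" using v by (cases n) auto
  with hdb len_b obtain vs where bv: "b = v # vs" by (cases b, auto)
  from gram_schmidt_result[OF b dist_b indep refl, folded ws_def]
  have ws: "set ws \<subseteq> carrier_vec n" "corthogonal ws" "length ws = n"
    by (auto simp: len_b)
  from gram_schmidt_hd[OF v(1), of vs, folded bv] have hdws: "ws ! 0 = v"
    unfolding ws_def[symmetric] using ws(3) n by (cases ws) auto
  define nr where "nr w = sqrt (\<Sum>i<n. (cmod (w $ i))\<^sup>2)" for w :: "complex vec"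
  have ws_i: "ws ! i \<in> carrier_vec n" if "i < n" for i using ws that by auto
  have nr: "ws ! i \<bullet>c ws ! i = complex_of_real ((nr (ws ! i))\<^sup>2)" if "i < n" for i
    using ws_i[OF that] by (simp add: cscalar_prod_self nr_def sum_nonneg del: of_real_power)
  have nr0: "nr (ws ! i) \<noteq> 0" if "i < n" for i
    using corthogonalD[OF ws(2), of i i] nr[OF that] that ws(3) by auto
  define W where "W = mat n n (\<lambda>(i, j). ws ! j $ i / complex_of_real (nr (ws ! j)))"
  have W: "W \<in> carrier_mat n n" by (simp add: W_def)
  have "mat_adjoint W * W = 1\<^sub>m n"
  proof (rule eq_matI)
    fix i j assume "i < dim_row (1\<^sub>m n :: complex mat)" "j < dim_col (1\<^sub>m n :: complex mat)"
    then have ij: "i < n" "j < n" by auto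
    have "(mat_adjoint W * W) $$ (i, j)
        = (\<Sum>k<n. ws ! j $ k * cnj (ws ! i $ k)) / complex_of_real (nr (ws ! j) * nr (ws ! i))"
      using W ij
      by (auto simp: mat_mult_index W_def sum_divide_distrib mult.commute intro!: sum.cong)
    also have "(\<Sum>k<n. ws ! j $ k * cnj (ws ! i $ k)) = ws ! j \<bullet>c ws ! i"
      using carrier_vecD[OF ws_i[OF ij(1)]] carrier_vecD[OF ws_i[OF ij(2)]] by (simp add: cscalar_prod_sum)
    also have "\<dots> / complex_of_real (nr (ws ! j) * nr (ws ! i)) = (if i = j then 1 else 0)"
      using corthogonalD[OF ws(2), of j i] nr[of i] nr0[of i] ij ws(3)
      by (auto simp: power2_eq_square)
    finally show "(mat_adjoint W * W) $$ (i, j) = 1\<^sub>m n $$ (i, j)" using ij by auto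
  qed (use W in auto)
  then have "isometry_mat W" using W by (auto simp: isometry_mat_def)
  moreover have "col W 0 = (1 / complex_of_real (nr v)) \<cdot>\<^sub>v v"
    using n v hdws by (intro eq_vecI) (auto simp: W_def)
  moreover have "1 / complex_of_real (nr v) \<noteq> 0" using nr0[OF n] hdws by simp
  ultimately show ?thesis using W that by blast
qed

lemma mult_mat_assoc_dim:
  fixes A B C :: "complex mat"
  assumes "dim_col A = dim_row B" "dim_col B = dim_row C"
  shows "A * B * C = A * (B * C)"
  using assms by (intro assoc_mult_mat[of _ "dim_row A" "dim_col A" _ "dim_col B" _ "dim_col C"]) auto

lemma isometry_mult:
  assumes "isometry_mat A" "isometry_mat B" "dim_row B = dim_col A"
  shows "isometry_mat (A * B)"
proof -
  have "mat_adjoint A * (A * B) = (mat_adjoint A * A) * B"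
    using assms(3) by (subst mult_mat_assoc_dim) auto
  also have "\<dots> = 1\<^sub>m (dim_row B) * B" using assms by (simp only: isometry_mat_def)
  also have "\<dots> = B" by (rule left_mult_one_mat) auto
  finally have "mat_adjoint (A * B) * (A * B) = mat_adjoint B * B"
    using assms(3) by (simp add: mat_adjoint_mult mult_mat_assoc_dim)
  with assms show ?thesis by (simp add: isometry_mat_def)
qed

lemmas square_mat_simps = assoc_mult_mat[of _ n n _ n _ n] mult_carrier_mat[of _ n n _ n] for n

text \<open>Deflation: in an orthonormal basis that starts with an eigenvector, the first column is
  \<open>e\<close> times a unit vector, hermiticity clears the first row as well, and the remaining
  block is a smaller Hermitian matrix.\<close>

theorem hermitian_spectral_decomposition:
  assumes "hermitian_mat A" "A \<in> carrier_mat n n"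
  obtains U l where "U \<in> carrier_mat n n" "isometry_mat U" "A = U * real_diag n l * mat_adjoint U"
proof -
  have "\<exists>U l. U \<in> carrier_mat n n \<and> isometry_mat U \<and> A = U * real_diag n l * mat_adjoint U"
    using assms
  proof (induction n arbitrary: A)
    case 0
    then show ?case by (intro exI[of _ A]) (auto simp: isometry_mat_def intro!: eq_matI)
  next
    case (Suc n)
    let ?m = "Suc n"
    from spectrum_non_empty[OF Suc.prems(2)] obtain e where "eigenvalue A e"
      by (auto simp: spectrum_def)
    then obtain v where v: "v \<in> carrier_vec ?m" "v \<noteq> 0\<^sub>v ?m" and ev: "A *\<^sub>v v = e \<cdot>\<^sub>v v"
      using Suc.prems by (auto simp: eigenvalue_def eigenvector_def)
    have A: "A \<in> carrier_mat ?m ?m" by fact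
    from hermitian_eigenvalue_real[OF Suc.prems v ev]
    have Im_e: "Im e = 0" by (simp add: complex_eq_iff)
    have e: "complex_of_real (Re e) = e" using Im_e by (simp add: complex_eq_iff)
    obtain W c where W: "W \<in> carrier_mat ?m ?m" "isometry_mat W" and Wc: "col W 0 = c \<cdot>\<^sub>v v" "c \<noteq> 0"
      using unitary_with_first_column[OF v] .
    let ?W = "mat_adjoint W"
    have W': "?W \<in> carrier_mat ?m ?m" using W by simp
    note unit = isometry_unitary[OF W(2,1)]
    define B where "B = ?W * A * W"
    have B: "B \<in> carrier_mat ?m ?m" using W W' A by (auto simp: B_def)
    have Bherm: "mat_adjoint B = B"
      using Suc.prems W W' A by (simp add: B_def mat_adjoint_mult hermitian_mat_def square_mat_simps[where n = ?m])
    have "col B 0 = ?W *\<^sub>v (A *\<^sub>v col W 0)"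
      using W W' A by (simp add: B_def col_mult2[of _ ?m ?m _ ?m] del: col_mult add: assoc_mult_mat_vec[of _ ?m ?m _ ?m] square_mat_simps[where n = ?m])
    also have "A *\<^sub>v col W 0 = e \<cdot>\<^sub>v col W 0"
      using v A by (simp add: Wc mult_mat_vec[of _ ?m ?m] ev smult_smult_assoc mult.commute)
    also have "?W *\<^sub>v (e \<cdot>\<^sub>v col W 0) = e \<cdot>\<^sub>v col (?W * W) 0"
      using W W' mult_mat_vec[OF W' carrier_vecI[of "col W 0" ?m], of e] by (simp add: col_mult2[of _ ?m ?m _ ?m])
    finally have col: "col B 0 = e \<cdot>\<^sub>v unit_vec ?m 0" by (simp add: unit)
    have B0: "B $$ (i, 0) = (if i = 0 then e else 0)" if "i < ?m" for i
      using arg_cong[OF col, of "\<lambda>v. v $ i"] that B by auto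
    have B0': "B $$ (0, i) = (if i = 0 then e else 0)" if "i < ?m" for i
      using arg_cong[OF Bherm, of "\<lambda>M. M $$ (0, i)"] B0[OF that] that B Im_e
      by (auto split: if_splits simp: complex_eq_iff)
    define B' where "B' = mat n n (\<lambda>(i, j). B $$ (Suc i, Suc j))"
    have BB': "B = border e B'"
    proof (rule eq_matI)
      fix i j assume "i < dim_row (border e B')" "j < dim_col (border e B')"
      then show "B $$ (i, j) = border e B' $$ (i, j)"
        using B0[of i] B0'[of j] by (cases i; cases j) (auto simp: B'_def)
    qed (use B in \<open>auto simp: B'_def\<close>)
    have "hermitian_mat B'"
      unfolding hermitian_mat_def
    proof (rule eq_matI)
      fix i j assume "i < dim_row B'" "j < dim_col B'"
      then show "mat_adjoint B' $$ (i, j) = B' $$ (i, j)"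
        using arg_cong[OF Bherm, of "\<lambda>M. M $$ (Suc i, Suc j)"] B by (auto simp: B'_def)
    qed (auto simp: B'_def)
    moreover have "B' \<in> carrier_mat n n" by (simp add: B'_def)
    ultimately obtain V l where V: "V \<in> carrier_mat n n" "isometry_mat V"
      and B'V: "B' = V * real_diag n l * mat_adjoint V"
      using Suc.IH by blast
    let ?V = "border 1 V"
    have V1: "?V \<in> carrier_mat ?m ?m" "mat_adjoint ?V \<in> carrier_mat ?m ?m"
      using V by auto
    have isoV: "isometry_mat ?V"
      using V by (auto simp: isometry_mat_def border_adjoint border_mult border_one)
    have BV: "B = ?V * real_diag ?m (case_nat (Re e) l) * mat_adjoint ?V"
      using V by (simp add: BB' B'V border_real_diag[symmetric] border_adjoint border_mult e)
    have "A = (W * ?W) * A * (W * ?W)"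
      using A by (simp add: unit)
    also have "\<dots> = W * B * ?W"
      using A W W' by (simp add: B_def square_mat_simps[where n = ?m])
    also have "\<dots> = (W * ?V) * real_diag ?m (case_nat (Re e) l) * mat_adjoint (W * ?V)"
      using A W W' V V1 by (simp add: BV mat_adjoint_mult square_mat_simps[where n = ?m])
    finally show ?case
      using W V V1 isoV isometry_mult[OF W(2) isoV]
      by (intro exI[of _ "W * ?V"] exI[of _ "case_nat (Re e) l"]) auto
  qed
  with that show ?thesis by blast
qed

section \<open>Trace norm\<close>

lemma mat_trace_comm:
  assumes "A \<in> carrier_mat m n" "B \<in> carrier_mat n m"
  shows "mat_trace (A * B) = mat_trace (B * A)"
proof -
  have "mat_trace (A * B) = (\<Sum>i<m. \<Sum>k<n. A $$ (i, k) * B $$ (k, i))"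
    using assms by (auto simp: mat_trace_def mat_mult_index intro!: sum.cong)
  also have "\<dots> = (\<Sum>k<n. \<Sum>i<m. A $$ (i, k) * B $$ (k, i))" by (rule sum.swap)
  also have "\<dots> = mat_trace (B * A)"
    using assms by (auto simp: mat_trace_def mat_mult_index mult.commute intro!: sum.cong)
  finally show ?thesis .
qed

lemma hermitian_matI:
  assumes "A \<in> carrier_mat n n" "\<And>i j. i < n \<Longrightarrow> j < n \<Longrightarrow> cnj (A $$ (j, i)) = A $$ (i, j)"
  shows "hermitian_mat A"
  using assms unfolding hermitian_mat_def by (intro eq_matI) auto

lemma hermitian_mat_entry:
  assumes "hermitian_mat A" "A \<in> carrier_mat n n" "i < n" "j < n"
  shows "cnj (A $$ (j, i)) = A $$ (i, j)"
  using assms mat_adjoint_index[of i A j] by (auto simp: hermitian_mat_def)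

text \<open>Polarization: the form is real on the sum of the unit vector \<open>i\<close> and
  \<open>c\<close> times the unit vector \<open>j\<close>. The value 0 for \<open>c\<close> makes
  the diagonal real; the values 1 and the imaginary unit give the two parts of the symmetry
  condition.\<close>

lemma psd_imp_hermitian:
  assumes "psd n A"
  shows "hermitian_mat A"
proof (rule hermitian_matI)
  show A: "A \<in> carrier_mat n n" using assms by (simp add: psd_def)
  have q: "Im (A $$ (i, i) + c * cnj c * A $$ (j, j) + c * A $$ (i, j) + cnj c * A $$ (j, i)) = 0"
    if ij: "i < n" "j < n" "i \<noteq> j" for i j c
  proof -
    define v where "v = unit_vec n i + c \<cdot>\<^sub>v unit_vec n j"
    have v: "v \<in> carrier_vec n" by (simp add: v_def)
    have vk: "v $ k = (if k = i then 1 else 0) + (if k = j then c else 0)" if "k < n" for k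
      using that ij by (auto simp: v_def)
    have Av: "(A *\<^sub>v v) $ k = A $$ (k, i) + c * A $$ (k, j)" if "k < n" for k
    proof -
      have "(A *\<^sub>v v) $ k = (\<Sum>l<n. A $$ (k, l) * ((if l = i then 1 else 0) + (if l = j then c else 0)))"
        using that A v by (simp add: mat_vec_index vk)
      also have "\<dots> = A $$ (k, i) + c * A $$ (k, j)"
        using ij by (simp add: distrib_left sum.distrib if_distrib[of "\<lambda>x. _ * x"] sum.delta cong: if_cong)
      finally show ?thesis .
    qed
    have "(A *\<^sub>v v) \<bullet>c v = (\<Sum>k<n. (A $$ (k, i) + c * A $$ (k, j)) * cnj ((if k = i then 1 else 0) + (if k = j then c else 0)))"
      using A v by (simp add: cscalar_prod_sum vk Av)
    also have "\<dots> = A $$ (i, i) + c * A $$ (i, j) + cnj c * (A $$ (j, i) + c * A $$ (j, j))"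
      using ij by (simp add: distrib_left sum.distrib if_distrib[of "\<lambda>x. _ * x"] if_distrib[of "\<lambda>x. x * _"] if_distrib[of cnj] sum.delta mult.commute cong: if_cong)
    finally have "A $$ (i, i) + c * A $$ (i, j) + cnj c * (A $$ (j, i) + c * A $$ (j, j)) \<ge> 0"
      using assms v by (metis psd_def)
    then show ?thesis by (simp add: less_eq_complex_def algebra_simps)
  qed
  fix i j assume ij: "i < n" "j < n"
  show "cnj (A $$ (j, i)) = A $$ (i, j)"
  proof (cases "i = j")
    case True
    have "(A *\<^sub>v unit_vec n i) \<bullet>c unit_vec n i = A $$ (i, i)"
      using A ij by (simp add: cscalar_prod_sum mat_vec_index if_distrib[of cnj] if_distrib[of "\<lambda>x. _ * x"] sum.delta unit_vec_def cong: if_cong)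
    then have "0 \<le> A $$ (i, i)" using assms by (metis psd_def unit_vec_carrier)
    then show ?thesis using True by (simp add: less_eq_complex_def complex_eq_iff)
  next
    case False
    then show ?thesis
      using q[OF ij, of 0] q[OF ij(2,1), of 0] q[OF ij, of 1] q[OF ij, of \<i>] by (simp add: complex_eq_iff)
  qed
qed

lemma hermitian_swap:
  assumes "hermitian_mat A" "A \<in> carrier_mat n n" "v \<in> carrier_vec n" "w \<in> carrier_vec n"
  shows "(A *\<^sub>v v) \<bullet>c w = v \<bullet>c (A *\<^sub>v w)"
  using adjoint_swap[of A n n v w] assms by (simp add: hermitian_mat_def)

lemma isometry_col_norm:
  assumes "isometry_mat U" "U \<in> carrier_mat m n" "k < n"
  shows "col U k \<bullet>c col U k = 1"
proof -
  have "(mat_adjoint U * U) $$ (k, k) = 1" using assms by (simp add: isometry_mat_def)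
  then show ?thesis
    using assms by (simp add: mat_mult_index cscalar_prod_sum mult.commute)
qed

lemma mat_vec_unit_col:
  fixes A :: "complex mat"
  assumes "A \<in> carrier_mat m n" "k < n"
  shows "A *\<^sub>v unit_vec n k = col A k"
  using assms by (intro eq_vecI) (auto simp: index_mult_mat_vec)

lemma spectral_eigenvector:
  assumes "U \<in> carrier_mat n n" "isometry_mat U" "k < n"
  shows "(U * real_diag n l * mat_adjoint U) *\<^sub>v col U k = complex_of_real (l k) \<cdot>\<^sub>v col U k"
proof -
  have c: "mat_adjoint U \<in> carrier_mat n n" "col U k \<in> carrier_vec n"
    using assms by (auto intro: carrier_vecI)
  have "mat_adjoint U *\<^sub>v col U k = col (mat_adjoint U * U) k"
    using assms c by (metis col_mult2)
  also have "\<dots> = unit_vec n k" using isometry_unitary[OF assms(2,1)] assms by simp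
  finally have "(U * real_diag n l * mat_adjoint U) *\<^sub>v col U k = U *\<^sub>v (real_diag n l *\<^sub>v unit_vec n k)"
    using assms c by (simp add: assoc_mult_mat_vec[of _ n n _ n] square_mat_simps[where n = n])
  also have "real_diag n l *\<^sub>v unit_vec n k = complex_of_real (l k) \<cdot>\<^sub>v unit_vec n k"
    using assms by (intro eq_vecI) (auto simp: mat_vec_index if_distrib[of "\<lambda>x. _ * x"] sum.delta unit_vec_def cong: if_cong)
  also have "U *\<^sub>v (complex_of_real (l k) \<cdot>\<^sub>v unit_vec n k) = complex_of_real (l k) \<cdot>\<^sub>v col U k"
    using assms by (subst mult_mat_vec[of _ n n]) (auto simp: mat_vec_unit_col)
  finally show ?thesis .
qed

text \<open>Let \<open>u\<close> be an eigenvector of \<open>B - C\<close> with eigenvalue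
  \<open>l\<close>. Equal squares give \<open>B u\<close> and \<open>C u\<close> the same norm, and
  expanding \<open>B u = C u + l u\<close> yields \<open>l * (c + b) = 0\<close> for the nonnegative
  values \<open>b\<close>, \<open>c\<close> of the two forms at \<open>u\<close>. A nonzero
  \<open>l\<close> would force both to vanish, against \<open>b = c + l\<close>.\<close>

lemma psd_sqrt_unique:
  assumes B: "psd n B" and C: "psd n C" and BC: "B * B = C * C"
  shows "B = C"
proof -
  note hB = psd_imp_hermitian[OF B] and hC = psd_imp_hermitian[OF C]
  have cB: "B \<in> carrier_mat n n" and cC: "C \<in> carrier_mat n n"
    using B C by (auto simp: psd_def)
  have "hermitian_mat (B - C)"
    by (rule hermitian_matI[of _ n]) (use cB cC hermitian_mat_entry[OF hB cB] hermitian_mat_entry[OF hC cC] in auto)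
  then obtain U l where U: "U \<in> carrier_mat n n" "isometry_mat U"
    and D: "B - C = U * real_diag n l * mat_adjoint U"
    using hermitian_spectral_decomposition[OF _ minus_carrier_mat[OF cC]] by blast
  have l0: "l k = 0" if k: "k < n" for k
  proof (rule ccontr)
    assume l: "l k \<noteq> 0"
    let ?u = "col U k"
    have u: "?u \<in> carrier_vec n" using U by (auto intro: carrier_vecI)
    have Bu: "B *\<^sub>v ?u \<in> carrier_vec n" "C *\<^sub>v ?u \<in> carrier_vec n" using cB cC u by auto
    have "(B - C) *\<^sub>v ?u = complex_of_real (l k) \<cdot>\<^sub>v ?u"
      unfolding D by (rule spectral_eigenvector[OF U k])
    then have eq: "B *\<^sub>v ?u = C *\<^sub>v ?u + complex_of_real (l k) \<cdot>\<^sub>v ?u"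
      using cB cC u Bu by (subst (asm) minus_mult_distrib_mat_vec[of _ n n]) (auto simp: vec_eq_iff algebra_simps)
    define b where "b = (B *\<^sub>v ?u) \<bullet>c ?u"
    define c where "c = (C *\<^sub>v ?u) \<bullet>c ?u"
    have bc: "b \<ge> 0" "c \<ge> 0" using B C u by (auto simp: b_def c_def psd_def)
    have b: "b = c + complex_of_real (l k)"
      unfolding b_def eq using u Bu
      by (simp add: add_scalar_prod_distrib[of _ n] c_def isometry_col_norm[OF U(2,1) k])
    have "(B *\<^sub>v ?u) \<bullet>c (B *\<^sub>v ?u) = (C *\<^sub>v ?u) \<bullet>c (C *\<^sub>v ?u)"
      using hermitian_swap[OF hB cB Bu(1) u] hermitian_swap[OF hC cC Bu(2) u]
        cB cC u BC by (metis assoc_mult_mat_vec)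
    moreover have "(B *\<^sub>v ?u) \<bullet>c (B *\<^sub>v ?u) = (C *\<^sub>v ?u) \<bullet>c (C *\<^sub>v ?u) + complex_of_real (l k) * (c + b)"
    proof -
      have "(B *\<^sub>v ?u) \<bullet>c (C *\<^sub>v ?u + complex_of_real (l k) \<cdot>\<^sub>v ?u)
          = (B *\<^sub>v ?u) \<bullet>c (C *\<^sub>v ?u) + complex_of_real (l k) * b"
        using u Bu by (simp add: conjugate_add_vec[of _ n] scalar_prod_add_distrib[of _ n] conjugate_smult_vec b_def)
      also have "(B *\<^sub>v ?u) \<bullet>c (C *\<^sub>v ?u) = (C *\<^sub>v ?u) \<bullet>c (C *\<^sub>v ?u) + complex_of_real (l k) * (?u \<bullet>c (C *\<^sub>v ?u))"
        unfolding eq using u Bu by (simp add: add_scalar_prod_distrib[of _ n])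
      also have "?u \<bullet>c (C *\<^sub>v ?u) = c" unfolding c_def using hermitian_swap[OF hC cC u u] by simp
      finally show ?thesis unfolding eq[symmetric] by (simp add: algebra_simps)
    qed
    ultimately have "c + b = 0" using l by simp
    then have "c = 0" "b = 0" using bc by (auto simp: less_eq_complex_def complex_eq_iff)
    then show False using b l by simp
  qed
  have "real_diag n l = 0\<^sub>m n n" by (rule eq_matI) (use l0 in auto)
  then have "B - C = 0\<^sub>m n n" using U by (simp add: D)
  then show ?thesis using cB cC by (auto simp: mat_eq_iff)
qed

lemma unitary_diag_mult:
  assumes "U \<in> carrier_mat n n" "isometry_mat U"
  shows "(U * real_diag n l * mat_adjoint U) * (U * real_diag n l' * mat_adjoint U)
       = U * real_diag n (\<lambda>i. l i * l' i) * mat_adjoint U"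
proof -
  have c: "mat_adjoint U \<in> carrier_mat n n" using assms by simp
  have "(U * real_diag n l * mat_adjoint U) * (U * real_diag n l' * mat_adjoint U)
      = U * (real_diag n l * ((mat_adjoint U * U) * (real_diag n l' * mat_adjoint U)))"
    using assms c by (simp add: square_mat_simps[where n = n])
  also have "\<dots> = U * ((real_diag n l * real_diag n l') * mat_adjoint U)"
    using assms c isometry_unitary[OF assms(2,1)] by (simp add: square_mat_simps[where n = n])
  finally show ?thesis
    using assms c by (simp add: square_mat_simps[where n = n] real_diag_mult)
qed

lemma unitary_diag_adjoint:
  assumes "U \<in> carrier_mat n n"
  shows "mat_adjoint (U * real_diag n l * mat_adjoint U) = U * real_diag n l * mat_adjoint U"
  using assms by (simp add: mat_adjoint_mult square_mat_simps[where n = n])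

lemma unitary_diag_psd:
  assumes U: "U \<in> carrier_mat n n" and l: "\<And>i. i < n \<Longrightarrow> l i \<ge> 0"
  shows "psd n (U * real_diag n l * mat_adjoint U)"
  unfolding psd_def
proof (intro conjI ballI)
  show "U * real_diag n l * mat_adjoint U \<in> carrier_mat n n" using U by (simp add: mult_carrier_mat[of _ n n _ n])
  fix v :: "complex vec" assume v: "v \<in> carrier_vec n"
  define w where "w = mat_adjoint U *\<^sub>v v"
  have w: "w \<in> carrier_vec n" using U v by (simp add: w_def mult_mat_vec_carrier[of _ n n])
  have "((U * real_diag n l * mat_adjoint U) *\<^sub>v v) = U *\<^sub>v (real_diag n l *\<^sub>v w)"
    unfolding w_def using U v by (simp add: assoc_mult_mat_vec[of _ n n _ n] square_mat_simps[where n = n])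
  then have "((U * real_diag n l * mat_adjoint U) *\<^sub>v v) \<bullet>c v = (real_diag n l *\<^sub>v w) \<bullet>c w"
    using adjoint_swap[OF U, of "real_diag n l *\<^sub>v w" v] w v by (simp add: w_def mult_mat_vec_carrier[of _ n n])
  also have "\<dots> = (\<Sum>i<n. complex_of_real (l i * (cmod (w $ i))\<^sup>2))"
    using w by (auto simp: cscalar_prod_sum mat_vec_index if_distrib[of "\<lambda>x. x * _"] sum.delta complex_norm_square mult.assoc
        simp del: of_real_power cong: if_cong intro!: sum.cong)
  also have "\<dots> \<ge> 0" using l by (auto simp: less_eq_complex_def intro!: sum_nonneg)
  finally show "0 \<le> ((U * real_diag n l * mat_adjoint U) *\<^sub>v v) \<bullet>c v" .
qed

lemma unitary_diag_trace:
  assumes "U \<in> carrier_mat n n" "isometry_mat U"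
  shows "mat_trace (U * real_diag n l * mat_adjoint U) = complex_of_real (\<Sum>i<n. l i)"
proof -
  have "mat_trace (U * real_diag n l * mat_adjoint U) = mat_trace (mat_adjoint U * (U * real_diag n l))"
    using assms by (intro mat_trace_comm[of _ n n]) auto
  also have "mat_adjoint U * (U * real_diag n l) = real_diag n l"
    using assms isometry_unitary[OF assms(2,1)] by (simp add: assoc_mult_mat[of _ n n _ n _ n, symmetric] mult_carrier_mat[of _ n n _ n])
  finally show ?thesis by (simp add: mat_trace_def)
qed

text \<open>Taking absolute values of the eigenvalues in the same basis gives a positive square
  root, and uniqueness identifies it with the definite description in
  \<open>psd_sqrt\<close>.\<close>

lemma trace_norm_spectral:
  assumes U: "U \<in> carrier_mat n n" "isometry_mat U"
  shows "trace_norm (U * real_diag n l * mat_adjoint U) = (\<Sum>i<n. \<bar>l i\<bar>)"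
proof -
  let ?D = "U * real_diag n l * mat_adjoint U" and ?B = "U * real_diag n (\<lambda>i. \<bar>l i\<bar>) * mat_adjoint U"
  have dim: "dim_row (mat_adjoint ?D * ?D) = n" using U by simp
  have B: "psd n ?B" by (rule unitary_diag_psd[OF U(1)]) simp
  have sq: "?B * ?B = mat_adjoint ?D * ?D"
    using U by (simp add: unitary_diag_adjoint unitary_diag_mult)
  have "psd_sqrt (mat_adjoint ?D * ?D) = ?B"
    unfolding psd_sqrt_def dim using B sq by (intro the_equality) (auto intro: psd_sqrt_unique)
  then show ?thesis using U by (simp add: trace_norm_def unitary_diag_trace)
qed

text \<open>One half of the duality with the operator norm. It turns the trace norm into a linear
  functional with a single isometry, a quantity that can be split along the components of a
  run.\<close>

lemma trace_norm_attained:
  assumes "hermitian_mat D" "D \<in> carrier_mat n n"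
  obtains W where "W \<in> carrier_mat n n" "isometry_mat W" "trace_norm D = Re (mat_trace (W * D))"
proof -
  obtain U l where U: "U \<in> carrier_mat n n" "isometry_mat U" and D: "D = U * real_diag n l * mat_adjoint U"
    using hermitian_spectral_decomposition[OF assms] .
  \<comment> \<open>The sign of 0 is taken as 1, since \<open>W\<close> has to be unitary on the
    kernel of \<open>D\<close> too.\<close>
  define s where "s i = (if l i < 0 then -1 else 1 :: real)" for i
  define W where "W = U * real_diag n s * mat_adjoint U"
  have W: "W \<in> carrier_mat n n" using U by (simp add: W_def mult_carrier_mat[of _ n n _ n])
  have "(\<lambda>i. s i * s i) = (\<lambda>i. 1)" "(\<lambda>i. s i * l i) = (\<lambda>i. \<bar>l i\<bar>)" by (auto simp: s_def)
  then have "mat_adjoint W * W = U * real_diag n (\<lambda>i. 1) * mat_adjoint U"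
    and WD: "W * D = U * real_diag n (\<lambda>i. \<bar>l i\<bar>) * mat_adjoint U"
    using U by (simp_all add: W_def D unitary_diag_adjoint unitary_diag_mult)
  then have "isometry_mat W"
    using U isometry_unitary[OF U(2,1)] W by (simp add: isometry_mat_def real_diag_one)
  moreover have "trace_norm D = Re (mat_trace (W * D))"
    using trace_norm_spectral[OF U, of l] by (simp add: WD unitary_diag_trace[OF U]) (simp add: D)
  ultimately show ?thesis using that W by blast
qed

text \<open>In an eigenbasis of \<open>D\<close> the two effects have nonnegative diagonal entries
  that add up to 1, so every eigenvalue enters with a coefficient between -1 and 1. Comparing the
  difference of both outcomes, and not one probability, matches the unhalved norm.\<close>

lemma effect_difference_le_trace_norm:
  assumes D: "hermitian_mat D" "D \<in> carrier_mat n n"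
    and E: "psd n E" and F: "psd n F" and EF: "E + F = 1\<^sub>m n"
  shows "\<bar>Re (mat_trace (E * D)) - Re (mat_trace (F * D))\<bar> \<le> trace_norm D"
proof -
  obtain U l where U: "U \<in> carrier_mat n n" "isometry_mat U" and D: "D = U * real_diag n l * mat_adjoint U"
    using hermitian_spectral_decomposition[OF D] .
  have tr: "mat_trace (X * D) = (\<Sum>k<n. complex_of_real (l k) * ((X *\<^sub>v col U k) \<bullet>c col U k))"
    if X: "X \<in> carrier_mat n n" for X
  proof -
    have "X * D = (X * U * real_diag n l) * mat_adjoint U"
      using X U by (simp add: D square_mat_simps[where n = n])
    then have "mat_trace (X * D) = mat_trace (mat_adjoint U * (X * U * real_diag n l))"
      using X U mat_trace_comm[of "X * U * real_diag n l" n n "mat_adjoint U"] by (simp add: mult_carrier_mat[of _ n n _ n])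
    also have "mat_adjoint U * (X * U * real_diag n l) = (mat_adjoint U * (X * U)) * real_diag n l"
      using X U by (simp add: square_mat_simps[where n = n])
    also have "mat_trace \<dots> = (\<Sum>k<n. (mat_adjoint U * (X * U)) $$ (k, k) * complex_of_real (l k))"
      using X U by (auto simp: mat_trace_def mat_mult_index[of _ "mat_adjoint U * (X * U)" _ "real_diag n l"]
          if_distrib[of "\<lambda>x. _ * x"] sum.delta cong: if_cong intro!: sum.cong)
    also have "\<dots> = (\<Sum>k<n. complex_of_real (l k) * ((X *\<^sub>v col U k) \<bullet>c col U k))"
    proof (rule sum.cong[OF refl])
      fix k assume k: "k \<in> {..<n}"
      have "(mat_adjoint U * (X * U)) $$ (k, k) = (\<Sum>i<n. cnj (U $$ (i, k)) * (X * U) $$ (i, k))"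
        using X U k by (simp add: mat_mult_index[of _ "mat_adjoint U"])
      also have "\<dots> = (\<Sum>i<n. (X *\<^sub>v col U k) $ i * cnj (col U k $ i))"
        using X U k by (intro sum.cong) (auto simp: index_mult_mat(1) index_mult_mat_vec)
      also have "\<dots> = (X *\<^sub>v col U k) \<bullet>c col U k"
        using X U by (subst cscalar_prod_sum) auto
      finally show "(mat_adjoint U * (X * U)) $$ (k, k) * complex_of_real (l k)
          = complex_of_real (l k) * ((X *\<^sub>v col U k) \<bullet>c col U k)" by simp
    qed
    finally show ?thesis .
  qed
  have cE: "E \<in> carrier_mat n n" and cF: "F \<in> carrier_mat n n"
    using E F by (auto simp: psd_def)
  define e f where "e k = Re ((E *\<^sub>v col U k) \<bullet>c col U k)" and "f k = Re ((F *\<^sub>v col U k) \<bullet>c col U k)" for k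
  have ef: "e k \<ge> 0" "f k \<ge> 0" "e k + f k = 1" if k: "k < n" for k
  proof -
    have u: "col U k \<in> carrier_vec n" using U by (auto intro: carrier_vecI)
    show "e k \<ge> 0" "f k \<ge> 0" using E F u by (auto simp: e_def f_def psd_def less_eq_complex_def)
    have "(E *\<^sub>v col U k) \<bullet>c col U k + (F *\<^sub>v col U k) \<bullet>c col U k = ((E + F) *\<^sub>v col U k) \<bullet>c col U k"
      using cE cF u by (simp add: add_mult_distrib_mat_vec[of _ n n] add_scalar_prod_distrib[of _ n])
    then have "(E *\<^sub>v col U k) \<bullet>c col U k + (F *\<^sub>v col U k) \<bullet>c col U k = 1"
      using u by (simp add: EF isometry_col_norm[OF U(2,1) k])
    from arg_cong[OF this, of Re] show "e k + f k = 1" by (simp add: e_def f_def)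
  qed
  have "Re (mat_trace (E * D)) - Re (mat_trace (F * D)) = (\<Sum>k<n. l k * (e k - f k))"
    by (simp add: tr[OF cE] tr[OF cF] e_def f_def sum_subtractf right_diff_distrib)
  also have "\<bar>\<dots>\<bar> \<le> (\<Sum>k<n. \<bar>l k * (e k - f k)\<bar>)" by (rule sum_abs)
  also have "\<dots> \<le> (\<Sum>k<n. \<bar>l k\<bar>)"
  proof (rule sum_mono)
    fix k assume "k \<in> {..<n}"
    then have "\<bar>e k - f k\<bar> \<le> 1" using ef[of k] by auto
    then show "\<bar>l k * (e k - f k)\<bar> \<le> \<bar>l k\<bar>" by (simp add: abs_mult mult_left_le)
  qed
  also have "\<dots> = trace_norm D" by (simp add: D trace_norm_spectral[OF U])
  finally show ?thesis .
qed

section \<open>Functions of the tag table\<close>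

lemma sum_lessThan_mult:
  fixes f :: "nat \<Rightarrow> 'a :: comm_monoid_add"
  shows "(\<Sum>k<a * b. f k) = (\<Sum>i<a. \<Sum>j<b. f (i * b + j))"
proof -
  have "sum f {m * b..<m * b + b} = (\<Sum>j<b. f (m * b + j))" for m
    using sum.shift_bounds_nat_ivl[of f 0 "m * b" b] by (simp add: atLeast0LessThan add.commute)
  then show ?thesis by (simp flip: sum.nat_group)
qed

lemma less_mult_divmod:
  fixes i :: nat
  assumes "i < a * b" shows "i div b < a" "i mod b < b"
proof -
  have "b > 0" using assms by (cases b) auto
  then show "i div b < a" "i mod b < b" using assms by (auto simp: less_mult_imp_div_less)
qed

lemma less_mult_combine:
  fixes i :: nat
  assumes "i < a" "j < b" shows "i * b + j < a * b"
proof -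
  have "i * b + j < (i + 1) * b" using assms by simp
  also have "\<dots> \<le> a * b" using assms by (intro mult_right_mono) auto
  finally show ?thesis .
qed

lemma combine_divmod [simp]:
  fixes i :: nat
  assumes "j < b" shows "(i * b + j) div b = i" "(i * b + j) mod b = j"
  using assms by auto

locale tag_space =
  fixes N :: nat
  assumes N_pos: "0 < N"
begin

definition tags :: "(nat \<Rightarrow> nat) set" where
  "tags = {..<N} \<rightarrow>\<^sub>E {..<N}"

lemma finite_tags [simp]: "finite tags"
  by (simp add: tags_def finite_PiE)

lemma tags_less: "r \<in> tags \<Longrightarrow> x < N \<Longrightarrow> r x < N"
  by (auto simp: tags_def)

lemma tags_upd: "r \<in> tags \<Longrightarrow> x < N \<Longrightarrow> c < N \<Longrightarrow> r(x := c) \<in> tags"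
  by (auto simp: tags_def PiE_def extensional_def)

lemma card_tags_pos: "0 < card tags"
  using N_pos by (auto simp: tags_def card_PiE)

lemma sum_tags_update:
  fixes G :: "(nat \<Rightarrow> nat) \<Rightarrow> 'a :: comm_semiring_1"
  assumes "x < N"
  shows "(\<Sum>r\<in>tags. \<Sum>c<N. G (r(x := c))) = of_nat N * (\<Sum>r\<in>tags. G r)"
proof -
  \<comment> \<open>An involution exchanging the tag at \<open>x\<close> with its replacement value;
    it turns the updated table into the original one.\<close>
  let ?s = "\<lambda>(r, c). (r(x := c), r x)"
  have "(\<Sum>r\<in>tags. \<Sum>c<N. G (r(x := c))) = (\<Sum>(r, c)\<in>tags \<times> {..<N}. G (r(x := c)))"
    by (simp add: sum.cartesian_product)
  also have "\<dots> = (\<Sum>(r, c)\<in>tags \<times> {..<N}. G r)"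
    by (rule sum.reindex_bij_witness[of _ ?s ?s]) (use assms in \<open>auto simp: tags_upd tags_less\<close>)
  also have "\<dots> = of_nat N * (\<Sum>r\<in>tags. G r)"
    by (simp add: sum.cartesian_product[symmetric] sum_distrib_left)
  finally show ?thesis .
qed

text \<open>The conditional expectation given all tags except the one at \<open>x\<close>;
  \<open>tag_fluct\<close> is the complementary orthogonal projection.\<close>

definition tag_avg :: "nat \<Rightarrow> ((nat \<Rightarrow> nat) \<Rightarrow> complex) \<Rightarrow> (nat \<Rightarrow> nat) \<Rightarrow> complex" where
  "tag_avg x g r = (\<Sum>c<N. g (r(x := c))) / of_nat N"

definition tag_fluct :: "nat \<Rightarrow> ((nat \<Rightarrow> nat) \<Rightarrow> complex) \<Rightarrow> (nat \<Rightarrow> nat) \<Rightarrow> complex" where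
  "tag_fluct x g r = g r - tag_avg x g r"

lemma tag_avg_const: "(\<And>r c. g (r(x := c)) = g r) \<Longrightarrow> tag_avg x g r = g r"
  using N_pos by (simp add: tag_avg_def)

lemma tag_avg_update [simp]: "tag_avg x g (r(x := c)) = tag_avg x g r"
  by (simp add: tag_avg_def)

lemma tag_avg_zero [simp]: "tag_avg x (\<lambda>r. 0) r = 0"
  by (simp add: tag_avg_def)

lemma tag_avg_add: "tag_avg x (\<lambda>r. f r + g r) r = tag_avg x f r + tag_avg x g r"
  by (simp add: tag_avg_def sum.distrib add_divide_distrib)

lemma tag_avg_diff: "tag_avg x (\<lambda>r. f r - g r) r = tag_avg x f r - tag_avg x g r"
  by (simp add: tag_avg_def sum_subtractf diff_divide_distrib)

lemma tag_avg_sum: "tag_avg x (\<lambda>r. \<Sum>a\<in>A. f a r) r = (\<Sum>a\<in>A. tag_avg x (f a) r)"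
  unfolding tag_avg_def by (subst sum.swap) (simp add: sum_divide_distrib)

lemma tag_avg_mult_left: "tag_avg x (\<lambda>r. c * f r) r = c * tag_avg x f r"
  by (simp add: tag_avg_def sum_distrib_left)

lemma tag_fluct_sum: "tag_fluct x (\<lambda>r. \<Sum>a\<in>A. f a r) r = (\<Sum>a\<in>A. tag_fluct x (f a) r)"
  by (simp add: tag_fluct_def tag_avg_sum sum_subtractf)

lemma tag_avg_fluct: "tag_avg x (tag_fluct x g) r = 0"
proof -
  have "tag_avg x (\<lambda>r. g r - tag_avg x g r) r = tag_avg x g r - tag_avg x (tag_avg x g) r"
    by (simp add: tag_avg_diff)
  also have "tag_avg x (tag_avg x g) r = tag_avg x g r" by (rule tag_avg_const) simp
  finally show ?thesis by (simp add: tag_fluct_def[abs_def])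
qed

lemma tag_avg_commute: "x \<noteq> y \<Longrightarrow> tag_avg x (tag_avg y g) r = tag_avg y (tag_avg x g) r"
  unfolding tag_avg_def
  by (subst sum_divide_distrib[symmetric], subst sum.swap) (simp add: fun_upd_twist sum_divide_distrib)

lemma tag_avg_fluct_commute:
  assumes "x \<noteq> y"
  shows "tag_avg x (tag_fluct y g) r = tag_fluct y (tag_avg x g) r"
proof -
  have "tag_avg x (\<lambda>r. g r - tag_avg y g r) r = tag_avg x g r - tag_avg x (tag_avg y g) r"
    by (simp add: tag_avg_diff)
  then show ?thesis using tag_avg_commute[OF assms] by (simp add: tag_fluct_def[abs_def])
qed

lemma sum_tag_avg: "x < N \<Longrightarrow> (\<Sum>r\<in>tags. tag_avg x g r) = (\<Sum>r\<in>tags. g r)"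
  using N_pos by (simp add: tag_avg_def sum_divide_distrib[symmetric] sum_tags_update)

text \<open>Averaging over the tag at \<open>x\<close> first treats \<open>f\<close> as a constant
  and annihilates \<open>g\<close>.\<close>

lemma tag_orthogonal:
  assumes x: "x < N" and f: "\<And>r c. f (r(x := c)) = f r" and g: "\<And>r. tag_avg x g r = 0"
  shows "(\<Sum>r\<in>tags. f r * cnj (g r)) = 0" "(\<Sum>r\<in>tags. g r * cnj (f r)) = 0"
proof -
  have "tag_avg x (\<lambda>r. f r * cnj (g r)) r = f r * cnj (tag_avg x g r)" for r
    by (simp add: tag_avg_def f sum_distrib_left)
  then show *: "(\<Sum>r\<in>tags. f r * cnj (g r)) = 0"
    using sum_tag_avg[OF x, of "\<lambda>r. f r * cnj (g r)"] by (simp add: g)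
  have "(\<Sum>r\<in>tags. g r * cnj (f r)) = cnj (\<Sum>r\<in>tags. f r * cnj (g r))"
    by (simp add: mult.commute)
  then show "(\<Sum>r\<in>tags. g r * cnj (f r)) = 0" by (simp add: *)
qed

lemma tag_pythagoras:
  assumes x: "x < N"
  shows "(\<Sum>r\<in>tags. (cmod (g r))\<^sup>2)
       = (\<Sum>r\<in>tags. (cmod (tag_fluct x g r))\<^sup>2) + (\<Sum>r\<in>tags. (cmod (tag_avg x g r))\<^sup>2)"
proof -
  have "(cmod (g r))\<^sup>2 = (cmod (tag_fluct x g r))\<^sup>2 + (cmod (tag_avg x g r))\<^sup>2
      + 2 * Re (tag_fluct x g r * cnj (tag_avg x g r))" for r
  proof -
    have "(cmod (a + b))\<^sup>2 = (cmod a)\<^sup>2 + (cmod b)\<^sup>2 + 2 * Re (a * cnj b)" for a b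
      by (simp only: cmod_power2) (simp add: power2_eq_square algebra_simps)
    from this[of "tag_fluct x g r" "tag_avg x g r"] show ?thesis by (simp add: tag_fluct_def)
  qed
  moreover have "(\<Sum>r\<in>tags. Re (tag_fluct x g r * cnj (tag_avg x g r))) = 0"
    using tag_orthogonal(2)[OF x, of "tag_avg x g" "tag_fluct x g", OF tag_avg_update tag_avg_fluct]
    by (metis Re_sum zero_complex.simps(1))
  ultimately show ?thesis by (simp only: sum.distrib flip: sum_distrib_left)
qed

text \<open>The amplitude that a query at \<open>x\<close> with input amplitude \<open>g\<close>
  leaves at answer tag \<open>z\<close>.\<close>

definition tag_hit :: "nat \<Rightarrow> nat \<Rightarrow> ((nat \<Rightarrow> nat) \<Rightarrow> complex) \<Rightarrow> (nat \<Rightarrow> nat) \<Rightarrow> complex" where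
  "tag_hit x z g r = (if r x = z then g r else 0)"

lemma tag_avg_hit:
  assumes "z < N"
  shows "tag_avg x (tag_hit x z g) r = g (r(x := z)) / of_nat N"
  using assms by (simp add: tag_avg_def tag_hit_def sum.delta)

lemma sum_norm_hit:
  assumes x: "x < N"
  shows "(\<Sum>z<N. \<Sum>r\<in>tags. (cmod (tag_hit x z g r))\<^sup>2) = (\<Sum>r\<in>tags. (cmod (g r))\<^sup>2)"
proof -
  have "(\<Sum>z<N. \<Sum>r\<in>tags. (cmod (tag_hit x z g r))\<^sup>2) = (\<Sum>r\<in>tags. \<Sum>z<N. if r x = z then (cmod (g r))\<^sup>2 else 0)"
    by (subst sum.swap) (auto simp: tag_hit_def intro!: sum.cong)
  also have "\<dots> = (\<Sum>r\<in>tags. (cmod (g r))\<^sup>2)"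
    using x by (intro sum.cong) (auto simp: tags_less sum.delta)
  finally show ?thesis .
qed

text \<open>The average keeps the single term with \<open>r x = z\<close>, divided by
  \<open>N\<close>. Squares carry the factor \<open>1 / N ^ 2\<close>, and the sum over
  \<open>z\<close> counts every table \<open>N\<close> times by
  \<open>sum_tags_update\<close>.\<close>

lemma sum_norm_avg_hit:
  assumes x: "x < N"
  shows "(\<Sum>z<N. \<Sum>r\<in>tags. (cmod (tag_avg x (tag_hit x z g) r))\<^sup>2) = (\<Sum>r\<in>tags. (cmod (g r))\<^sup>2) / N"
proof -
  have "(cmod (tag_avg x (tag_hit x z g) r))\<^sup>2 = (cmod (g (r(x := z))))\<^sup>2 / (real N)\<^sup>2" if "z < N" for z r
    using that by (simp add: tag_avg_hit norm_divide power_divide)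
  then have "(\<Sum>z<N. \<Sum>r\<in>tags. (cmod (tag_avg x (tag_hit x z g) r))\<^sup>2)
      = (\<Sum>z<N. \<Sum>r\<in>tags. (cmod (g (r(x := z))))\<^sup>2 / (real N)\<^sup>2)" by simp
  also have "\<dots> = (\<Sum>r\<in>tags. \<Sum>z<N. (cmod (g (r(x := z))))\<^sup>2 / (real N)\<^sup>2)" by (rule sum.swap)
  also have "\<dots> = (\<Sum>r\<in>tags. \<Sum>z<N. (cmod (g (r(x := z))))\<^sup>2) / (real N)\<^sup>2"
    by (simp only: sum_divide_distrib)
  also have "\<dots> = (\<Sum>r\<in>tags. (cmod (g r))\<^sup>2) / N"
    using N_pos unfolding sum_tags_update[OF x, of "\<lambda>r. (cmod (g r))\<^sup>2"] power2_eq_square[of "real N"] by simp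
  finally show ?thesis .
qed

lemma sum_norm_fluct_hit:
  assumes x: "x < N"
  shows "(\<Sum>z<N. \<Sum>r\<in>tags. (cmod (tag_fluct x (tag_hit x z g) r))\<^sup>2)
       = (1 - 1 / N) * (\<Sum>r\<in>tags. (cmod (g r))\<^sup>2)"
proof -
  have "(\<Sum>z<N. \<Sum>r\<in>tags. (cmod (tag_fluct x (tag_hit x z g) r))\<^sup>2)
      = (\<Sum>z<N. \<Sum>r\<in>tags. (cmod (tag_hit x z g r))\<^sup>2)
      - (\<Sum>z<N. \<Sum>r\<in>tags. (cmod (tag_avg x (tag_hit x z g) r))\<^sup>2)"
    by (simp only: tag_pythagoras[OF x, of "tag_hit x _ g"] sum.distrib add_diff_cancel_right')
  then show ?thesis
    by (simp add: sum_norm_hit[OF x] sum_norm_avg_hit[OF x] left_diff_distrib)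
qed

end

section \<open>Matrices acting on amplitude functions\<close>

definition mat_apply :: "complex mat \<Rightarrow> (nat \<Rightarrow> complex) \<Rightarrow> nat \<Rightarrow> complex" where
  "mat_apply A f i = (\<Sum>k<dim_col A. A $$ (i, k) * f k)"

lemma mat_apply_cong: "(\<And>k. k < dim_col A \<Longrightarrow> f k = g k) \<Longrightarrow> mat_apply A f i = mat_apply A g i"
  by (simp add: mat_apply_def)

lemma mat_apply_zero [simp]: "mat_apply A (\<lambda>k. 0) i = 0"
  by (simp add: mat_apply_def)

lemma mat_apply_diff: "mat_apply A f i - mat_apply A g i = mat_apply A (\<lambda>k. f k - g k) i"
  by (simp add: mat_apply_def right_diff_distrib sum_subtractf)

lemma mat_apply_add: "mat_apply A f i + mat_apply A g i = mat_apply A (\<lambda>k. f k + g k) i"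
  by (simp add: mat_apply_def distrib_left sum.distrib)

lemma mat_apply_sum: "(\<Sum>a\<in>B. mat_apply A (f a) i) = mat_apply A (\<lambda>k. \<Sum>a\<in>B. f a k) i"
  unfolding mat_apply_def by (subst sum.swap) (simp add: sum_distrib_left)

lemma mat_apply_isometry:
  assumes "isometry_mat A" "A \<in> carrier_mat m n"
  shows "(\<Sum>i<m. (cmod (mat_apply A f i))\<^sup>2) = (\<Sum>k<n. (cmod (f k))\<^sup>2)"
proof -
  let ?v = "vec n f"
  have v: "?v \<in> carrier_vec n" by simp
  have idx: "(A *\<^sub>v ?v) $ i = mat_apply A f i" if "i < m" for i
    using assms that by (simp add: mat_vec_index mat_apply_def)
  have "complex_of_real (\<Sum>i<m. (cmod (mat_apply A f i))\<^sup>2) = (A *\<^sub>v ?v) \<bullet>c (A *\<^sub>v ?v)"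
    using assms by (simp add: cscalar_prod_self idx)
  also have "\<dots> = ?v \<bullet>c ?v" by (rule isometry_cscalar_prod[OF assms v v])
  also have "\<dots> = complex_of_real (\<Sum>k<n. (cmod (f k))\<^sup>2)" by (simp add: cscalar_prod_self)
  finally show ?thesis using of_real_eq_iff by blast
qed

section \<open>Fluctuating components of a run\<close>

locale erasing_walk = tag_space N for N :: nat +
  fixes T :: nat and V :: "nat \<Rightarrow> complex mat" and w :: "nat \<Rightarrow> nat" and d :: "nat \<Rightarrow> nat"
    and v0 :: "nat \<Rightarrow> complex"
  assumes V: "t < T \<Longrightarrow> V (Suc t) \<in> carrier_mat (d (Suc t)) (N * N * N * w t)"
    and V_iso: "t < T \<Longrightarrow> isometry_mat (V (Suc t))"
    and d: "t < T \<Longrightarrow> d t = N * w t"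
    and v0: "(\<Sum>i<d 0. (cmod (v0 i))\<^sup>2) = 1"
begin

text \<open>The digits of a basis index after a query. Since the argument is part of the answer,
  only \<open>in_index t k\<close> can lead to \<open>k\<close>.\<close>

definition out_y :: "nat \<Rightarrow> nat \<Rightarrow> nat" where "out_y t k = k div w t div N div N"
definition out_x :: "nat \<Rightarrow> nat \<Rightarrow> nat" where "out_x t k = k div w t div N mod N"
definition out_z :: "nat \<Rightarrow> nat \<Rightarrow> nat" where "out_z t k = k div w t mod N"
definition in_index :: "nat \<Rightarrow> nat \<Rightarrow> nat" where "in_index t k = out_x t k * w t + k mod w t"

lemma out_x_less [simp]: "out_x t k < N"
  using N_pos by (simp add: out_x_def)

lemma sum_out:
  fixes f :: "nat \<Rightarrow> nat \<Rightarrow> nat \<Rightarrow> nat \<Rightarrow> real"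
  shows "(\<Sum>k<N * N * N * w t. f (out_y t k) (out_x t k) (out_z t k) (in_index t k))
       = (\<Sum>y<N. \<Sum>x<N. \<Sum>z<N. \<Sum>j<w t. f y x z (x * w t + j))"
proof -
  have "j < w t \<Longrightarrow> z < N \<Longrightarrow> x < N \<Longrightarrow>
      f (out_y t (((y * N + x) * N + z) * w t + j)) (out_x t (((y * N + x) * N + z) * w t + j))
        (out_z t (((y * N + x) * N + z) * w t + j)) (in_index t (((y * N + x) * N + z) * w t + j))
      = f y x z (x * w t + j)" for y x z j
    by (simp add: out_y_def out_x_def out_z_def in_index_def)
  then show ?thesis by (simp add: sum_lessThan_mult)
qed

abbreviation select_image :: "(nat \<Rightarrow> nat) \<Rightarrow> nat \<Rightarrow> (nat \<Rightarrow> nat \<Rightarrow> nat \<Rightarrow> 'a :: zero) \<Rightarrow> nat \<Rightarrow> 'a" where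
  "select_image h t f k \<equiv> if out_y t k = h (out_x t k) then f (out_x t k) (out_z t k) (in_index t k) else 0"

text \<open>Every input basis state reappears once for each answer tag: the argument register names
  its origin and the test on \<open>out_y\<close> fixes the image. An identity for one amplitude,
  summed over \<open>z\<close> and over the tables, therefore lifts to the whole state.\<close>

lemma sum_query:
  fixes G :: "nat \<Rightarrow> nat \<Rightarrow> nat \<Rightarrow> (nat \<Rightarrow> nat) \<Rightarrow> real"
  assumes h: "\<And>x. x < N \<Longrightarrow> h x < N"
    and G: "\<And>x i. x < N \<Longrightarrow> (\<Sum>z<N. \<Sum>r\<in>tags. G x z i r) = (\<Sum>r\<in>tags. g i r)"
  shows "(\<Sum>r\<in>tags. \<Sum>k<N * N * N * w t. select_image h t (\<lambda>x z i. G x z i r) k)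
       = (\<Sum>r\<in>tags. \<Sum>i<N * w t. g i r)"
    (is "(\<Sum>r\<in>tags. ?L r) = _")
proof -
  have "?L r
      = (\<Sum>x<N. \<Sum>z<N. \<Sum>j<w t. G x z (x * w t + j) r)" for r
  proof -
    have "?L r
        = (\<Sum>y<N. \<Sum>x<N. \<Sum>z<N. \<Sum>j<w t. if y = h x then G x z (x * w t + j) r else 0)"
      by (rule sum_out[of "\<lambda>y x z i. if y = h x then G x z i r else 0"])
    also have "\<dots> = (\<Sum>x<N. \<Sum>y<N. if y = h x then (\<Sum>z<N. \<Sum>j<w t. G x z (x * w t + j) r) else 0)"
      by (subst sum.swap, intro sum.cong[OF refl]) auto
    also have "\<dots> = (\<Sum>x<N. \<Sum>z<N. \<Sum>j<w t. G x z (x * w t + j) r)"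
      by (rule sum.cong[OF refl]) (use h in auto)
    finally show ?thesis .
  qed
  then have "(\<Sum>r\<in>tags. ?L r)
      = (\<Sum>r\<in>tags. \<Sum>x<N. \<Sum>z<N. \<Sum>j<w t. G x z (x * w t + j) r)" by simp
  also have "\<dots> = (\<Sum>x<N. \<Sum>j<w t. \<Sum>z<N. \<Sum>r\<in>tags. G x z (x * w t + j) r)"
  proof (subst sum.swap, intro sum.cong[OF refl])
    fix x
    let ?g = "\<lambda>z j r. G x z (x * w t + j) r"
    have "(\<Sum>r\<in>tags. \<Sum>z<N. \<Sum>j<w t. ?g z j r) = (\<Sum>z<N. \<Sum>r\<in>tags. \<Sum>j<w t. ?g z j r)"
      by (rule sum.swap)
    also have "\<dots> = (\<Sum>z<N. \<Sum>j<w t. \<Sum>r\<in>tags. ?g z j r)"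
      by (intro sum.cong[OF refl] sum.swap)
    also have "\<dots> = (\<Sum>j<w t. \<Sum>z<N. \<Sum>r\<in>tags. ?g z j r)"
      by (rule sum.swap)
    finally show "(\<Sum>r\<in>tags. \<Sum>z<N. \<Sum>j<w t. ?g z j r) = (\<Sum>j<w t. \<Sum>z<N. \<Sum>r\<in>tags. ?g z j r)" .
  qed
  also have "\<dots> = (\<Sum>x<N. \<Sum>j<w t. \<Sum>r\<in>tags. g (x * w t + j) r)"
    by (simp add: G)
  also have "\<dots> = (\<Sum>i<N * w t. \<Sum>r\<in>tags. g i r)" by (simp add: sum_lessThan_mult)
  also have "\<dots> = (\<Sum>r\<in>tags. \<Sum>i<N * w t. g i r)" by (rule sum.swap)
  finally show ?thesis .
qed

fun run :: "(nat \<Rightarrow> nat) \<Rightarrow> nat \<Rightarrow> (nat \<Rightarrow> nat) \<Rightarrow> nat \<Rightarrow> complex" where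
  "run h 0 r = v0"
| "run h (Suc t) r = mat_apply (V (Suc t))
     (select_image h t (\<lambda>x z i. tag_hit x z (\<lambda>r. run h t r i) r))"

text \<open>The component of the amplitude in which exactly the tags of the points of \<open>A\<close> fluctuate
  (cf. the Efron--Stein decomposition).\<close>

fun comp :: "(nat \<Rightarrow> nat) \<Rightarrow> nat \<Rightarrow> nat set \<Rightarrow> (nat \<Rightarrow> nat) \<Rightarrow> nat \<Rightarrow> complex" where
  "comp h 0 A r = (if A = {} then v0 else (\<lambda>_. 0))"
| "comp h (Suc t) A r = mat_apply (V (Suc t))
     (\<lambda>k. if out_y t k = h (out_x t k) \<and> out_x t k \<in> A
          then tag_fluct (out_x t k) (tag_hit (out_x t k) (out_z t k)
                 (\<lambda>r. comp h t A r (in_index t k) + comp h t (A - {out_x t k}) r (in_index t k))) r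
          else 0)"

definition good :: "(nat \<Rightarrow> nat) \<Rightarrow> nat \<Rightarrow> (nat \<Rightarrow> nat) \<Rightarrow> nat \<Rightarrow> complex" where
  "good h t r i = (\<Sum>A\<in>Pow {..<N}. comp h t A r i)"

text \<open>The image register is compared with \<open>h\<close> only at arguments in
  \<open>A\<close>, and the recursion passes to subsets of \<open>A\<close> only.\<close>

lemma comp_cong:
  assumes "\<And>x. x \<in> A \<Longrightarrow> h x = h' x"
  shows "comp h t A = comp h' t A"
  using assms
proof (induction t arbitrary: A)
  case (Suc t)
  have "comp h t A = comp h' t A" "comp h t (A - {x}) = comp h' t (A - {x})" for x
    by (rule Suc.IH; use Suc.prems in auto)+
  then show ?case using Suc.prems by (auto intro!: ext mat_apply_cong)
qed (auto intro!: ext)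

text \<open>A query enlarges the set by at most the point queried.\<close>

lemma comp_support: "comp h t A r i \<noteq> 0 \<Longrightarrow> finite A \<and> card A \<le> t"
proof (induction t arbitrary: A r i)
  case 0
  then show ?case by (auto split: if_splits)
next
  case (Suc t)
  show ?case
  proof (rule ccontr)
    assume neg: "\<not> (finite A \<and> card A \<le> Suc t)"
    have "comp h t A r i = 0" for r i using neg by (metis Suc.IH le_SucI)
    moreover have "comp h t (A - {x}) r i = 0" for x r i
    proof (rule ccontr)
      assume "comp h t (A - {x}) r i \<noteq> 0"
      then have "finite (A - {x}) \<and> card (A - {x}) \<le> t" by (rule Suc.IH)
      then show False using neg by (auto simp: card_Diff_singleton_if split: if_splits)
    qed
    ultimately have "comp h (Suc t) A r i = mat_apply (V (Suc t)) (\<lambda>k. 0) i"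
      by (simp add: tag_fluct_def tag_hit_def[abs_def] cong: if_cong)
    then show False using Suc.prems by simp
  qed
qed

text \<open>Together with \<open>comp_avg\<close> this describes the component at \<open>A\<close>:
  constant in the tags outside \<open>A\<close>, of mean zero in each tag inside. In the recursion
  the tag at \<open>x\<close> is never tested, as the queried point lies in
  \<open>A\<close>.\<close>

lemma comp_update: "x \<notin> A \<Longrightarrow> comp h t A (r(x := c)) = comp h t A r"
proof (induction t arbitrary: A r c)
  case (Suc t)
  have IH: "comp h t A (r(x := c)) = comp h t A r"
    "comp h t (A - {y}) (r(x := c)) = comp h t (A - {y}) r" for y r c
    by (rule Suc.IH; use Suc.prems in auto)+
  have "tag_fluct y (tag_hit y z (\<lambda>r. comp h t A r i + comp h t (A - {y}) r i)) (r(x := c))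
      = tag_fluct y (tag_hit y z (\<lambda>r. comp h t A r i + comp h t (A - {y}) r i)) r"
    if "y \<in> A" for y z i
  proof -
    from that Suc.prems have "x \<noteq> y" by auto
    then show ?thesis
      by (simp add: tag_fluct_def tag_avg_def tag_hit_def IH fun_upd_twist[of x y])
  qed
  then show ?case
    unfolding comp.simps by (intro ext mat_apply_cong if_cong) auto
qed simp

lemma comp_avg: "x \<in> A \<Longrightarrow> x < N \<Longrightarrow> tag_avg x (\<lambda>r. comp h t A r i) r = 0"
proof (induction t arbitrary: A r i)
  case (Suc t)
  have IH: "tag_avg x (\<lambda>r. comp h t A r i) r = 0" for r i
    using Suc by auto
  have IH': "tag_avg x (\<lambda>r. comp h t (A - {y}) r i) r = 0" if "x \<noteq> y" for r i y
    using Suc that by auto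
  have "tag_avg x (tag_fluct y (tag_hit y z (\<lambda>r. comp h t A r i + comp h t (A - {y}) r i))) r = 0" for y z i r
  proof (cases "x = y")
    case False
    \<comment> \<open>For distinct points the average over the tag at \<open>x\<close> passes
      through the test on the tag at \<open>y\<close> and meets components at \<open>A\<close> and
      \<open>A - {y}\<close>, both of which contain \<open>x\<close>.\<close>
    have "tag_avg x (tag_hit y z g) s = (if s y = z then tag_avg x g s else 0)" for g s
      using False by (auto simp: tag_avg_def tag_hit_def)
    then have "tag_avg x (tag_hit y z (\<lambda>r. comp h t A r i + comp h t (A - {y}) r i)) = (\<lambda>r. 0)"
      using False by (intro ext) (simp add: tag_avg_add IH IH')
    then show ?thesis using False by (simp add: tag_avg_fluct_commute tag_fluct_def)
  qed (simp add: tag_avg_fluct)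
  note * = this
  let ?F = "\<lambda>k r. if out_y t k = h (out_x t k) \<and> out_x t k \<in> A
          then tag_fluct (out_x t k) (tag_hit (out_x t k) (out_z t k)
                 (\<lambda>r. comp h t A r (in_index t k) + comp h t (A - {out_x t k}) r (in_index t k))) r
          else 0"
  have "tag_avg x (\<lambda>r. comp h (Suc t) A r i) r = mat_apply (V (Suc t)) (\<lambda>k. tag_avg x (?F k) r) i"
    by (simp add: mat_apply_def tag_avg_sum tag_avg_mult_left)
  moreover have "tag_avg x (?F k) r = 0" for k
  proof (cases "out_y t k = h (out_x t k) \<and> out_x t k \<in> A")
    case True
    then show ?thesis by (simp add: *)
  next
    case False
    then have "?F k = (\<lambda>r. 0)" by (intro ext) (simp only: if_False)
    then show ?thesis by (simp only: tag_avg_zero)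
  qed
  ultimately show ?case by (simp only: mat_apply_zero)
qed auto

text \<open>At a point in exactly one of the two sets, one factor is constant in the tag and the
  other has mean zero.\<close>

lemma comp_orthogonal:
  assumes "A \<subseteq> {..<N}" "B \<subseteq> {..<N}" "A \<noteq> B"
  shows "(\<Sum>r\<in>tags. comp h t A r i * cnj (comp h t B r j)) = 0"
proof -
  from assms obtain x where x: "x < N" "x \<in> A \<longleftrightarrow> x \<notin> B" by blast
  show ?thesis
  proof (cases "x \<in> A")
    case True
    then show ?thesis using x
      by (intro tag_orthogonal(2)[OF x(1)]) (auto simp: comp_update comp_avg)
  next
    case False
    then show ?thesis using x
      by (intro tag_orthogonal(1)[OF x(1)]) (auto simp: comp_update comp_avg)
  qed
qed

lemma good_inner:
  "(\<Sum>r\<in>tags. good h t r i * cnj (good h t r j))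
     = (\<Sum>A\<in>Pow {..<N}. \<Sum>r\<in>tags. comp h t A r i * cnj (comp h t A r j))"
proof -
  have "(\<Sum>r\<in>tags. good h t r i * cnj (good h t r j))
      = (\<Sum>A\<in>Pow {..<N}. \<Sum>B\<in>Pow {..<N}. \<Sum>r\<in>tags. comp h t A r i * cnj (comp h t B r j))"
    unfolding good_def cnj_sum sum_product
    by (subst sum.swap, intro sum.cong[OF refl], subst sum.swap) (rule refl)
  also have "\<dots> = (\<Sum>A\<in>Pow {..<N}. \<Sum>B\<in>Pow {..<N}. if B = A then \<Sum>r\<in>tags. comp h t A r i * cnj (comp h t A r j) else 0)"
    by (intro sum.cong) (auto simp: comp_orthogonal)
  also have "\<dots> = (\<Sum>A\<in>Pow {..<N}. \<Sum>r\<in>tags. comp h t A r i * cnj (comp h t A r j))"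
    by (simp add: sum.delta)
  finally show ?thesis .
qed

text \<open>Every subset arises exactly once, as a set containing \<open>x\<close> or as such a set
  with \<open>x\<close> removed.\<close>

lemma sum_Pow_with:
  fixes f :: "nat set \<Rightarrow> complex"
  assumes "x < N"
  shows "(\<Sum>A\<in>Pow {..<N}. if x \<in> A then f A + f (A - {x}) else 0) = (\<Sum>A\<in>Pow {..<N}. f A)"
proof -
  let ?P = "{A \<in> Pow {..<N}. x \<in> A}" and ?Q = "{A \<in> Pow {..<N}. x \<notin> A}"
  have "(\<Sum>A\<in>?P. f (A - {x})) = (\<Sum>A\<in>?Q. f A)"
    by (rule sum.reindex_bij_witness[of _ "insert x" "\<lambda>A. A - {x}"]) (use assms in auto)
  moreover have "(\<Sum>A\<in>Pow {..<N}. f A) = (\<Sum>A\<in>?P. f A) + (\<Sum>A\<in>?Q. f A)"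
    by (subst sum.union_disjoint[symmetric]) (auto intro!: sum.cong)
  ultimately show ?thesis
    by (simp add: sum.inter_filter[symmetric] sum.distrib)
qed

text \<open>The recursion of \<open>comp\<close> has two sources because the queried point may have
  been recorded before or only now; summed over all sets they restore the whole of
  \<open>good h t\<close>. On the kept part a query thus acts as the true query followed by
  \<open>tag_fluct\<close>.\<close>

lemma good_Suc:
  "good h (Suc t) r = mat_apply (V (Suc t))
     (select_image h t (\<lambda>x z i. tag_fluct x (tag_hit x z (\<lambda>r. good h t r i)) r))"
proof
  fix i
  let ?c = "\<lambda>x j A r. comp h t A r j + comp h t (A - {x}) r j"
  have "(\<Sum>A\<in>Pow {..<N}. if x \<in> A then tag_fluct x (tag_hit x z (?c x j A)) r else 0)
      = tag_fluct x (tag_hit x z (\<lambda>r. good h t r j)) r" if x: "x < N" for x z j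
  proof -
    have "(\<Sum>A\<in>Pow {..<N}. if x \<in> A then tag_fluct x (tag_hit x z (?c x j A)) r else 0)
        = tag_fluct x (\<lambda>r. \<Sum>A\<in>Pow {..<N}. if x \<in> A then tag_hit x z (?c x j A) r else 0) r"
      by (subst tag_fluct_sum) (auto intro!: sum.cong simp: tag_fluct_def)
    also have "(\<lambda>r. \<Sum>A\<in>Pow {..<N}. if x \<in> A then tag_hit x z (?c x j A) r else 0)
        = tag_hit x z (\<lambda>r. good h t r j)"
    proof
      fix r
      show "(\<Sum>A\<in>Pow {..<N}. if x \<in> A then tag_hit x z (?c x j A) r else 0)
          = tag_hit x z (\<lambda>r. good h t r j) r"
        by (cases "r x = z")
           (simp_all add: tag_hit_def good_def sum_Pow_with[OF x, of "\<lambda>A. comp h t A r j"] cong: if_cong)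
    qed
    finally show ?thesis .
  qed
  then show "good h (Suc t) r i = mat_apply (V (Suc t))
     (select_image h t (\<lambda>x z i. tag_fluct x (tag_hit x z (\<lambda>r. good h t r i)) r)) i"
    unfolding good_def[of h "Suc t"] comp.simps mat_apply_sum
    by (intro mat_apply_cong) (simp flip: if_if_eq_conj)
qed

section \<open>Norms averaged over the tag table, and the loss per query\<close>

definition norm2 :: "nat \<Rightarrow> ((nat \<Rightarrow> nat) \<Rightarrow> nat \<Rightarrow> complex) \<Rightarrow> real" where
  "norm2 t f = (\<Sum>r\<in>tags. \<Sum>i<d t. (cmod (f r i))\<^sup>2) / card tags"

lemma norm2_nonneg: "norm2 t f \<ge> 0"
  by (simp add: norm2_def sum_nonneg)

text \<open>Serves three purposes: the true query with factor \<open>c = 1\<close>, the kept part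
  with \<open>1 - 1 / N\<close> and the discarded part with \<open>1 / N\<close>.\<close>

lemma norm2_step:
  assumes t: "t < T" and h: "\<And>x. x < N \<Longrightarrow> h x < N"
    and G: "\<And>x i. x < N \<Longrightarrow> (\<Sum>z<N. \<Sum>r\<in>tags. (cmod (G x z i r))\<^sup>2) = c * (\<Sum>r\<in>tags. (cmod (f r i))\<^sup>2)"
  shows "norm2 (Suc t) (\<lambda>r. mat_apply (V (Suc t))
     (select_image h t (\<lambda>x z i. G x z i r))) = c * norm2 t f"
    (is "?L = _")
proof -
  have "?L
      = (\<Sum>r\<in>tags. \<Sum>k<N * N * N * w t. if out_y t k = h (out_x t k)
            then (cmod (G (out_x t k) (out_z t k) (in_index t k) r))\<^sup>2 else 0) / card tags"
    by (simp add: norm2_def mat_apply_isometry[OF V_iso[OF t] V[OF t]] if_distrib[of "\<lambda>x. (cmod x)\<^sup>2"] cong: if_cong)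
  also have "\<dots> = (\<Sum>r\<in>tags. \<Sum>i<N * w t. c * (cmod (f r i))\<^sup>2) / card tags"
    using sum_query[where h = h and G = "\<lambda>x z i r. (cmod (G x z i r))\<^sup>2" and g = "\<lambda>i r. c * (cmod (f r i))\<^sup>2", OF h] G
    by (simp add: sum_distrib_left)
  also have "\<dots> = c * norm2 t f"
    by (simp add: norm2_def d[OF t] flip: sum_distrib_left)
  finally show ?thesis .
qed

lemma norm2_0: "norm2 0 (\<lambda>r. v0) = 1"
  using card_tags_pos by (auto simp: norm2_def v0)

lemma good_0: "good h 0 r = v0"
proof -
  have "good h 0 r i = (\<Sum>A\<in>Pow {..<N}. if A = {} then v0 i else 0)" for i
    unfolding good_def by (intro sum.cong) auto
  then show ?thesis by (auto simp: sum.delta)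
qed

lemma norm2_good:
  assumes h: "\<And>x. x < N \<Longrightarrow> h x < N"
  shows "t \<le> T \<Longrightarrow> norm2 t (good h t) = (1 - 1 / N) ^ t"
proof (induction t)
  case 0
  then show ?case using norm2_0 by (simp add: good_0[abs_def])
next
  case (Suc t)
  have "norm2 (Suc t) (good h (Suc t)) = (1 - 1 / N) * norm2 t (good h t)"
    unfolding good_Suc[abs_def]
    by (rule norm2_step) (use Suc h sum_norm_fluct_hit in auto)
  with Suc show ?case by simp
qed

lemma norm2_run:
  assumes h: "\<And>x. x < N \<Longrightarrow> h x < N"
  shows "t \<le> T \<Longrightarrow> norm2 t (run h t) = 1"
proof (induction t)
  case 0
  then show ?case using norm2_0 by (simp add: run.simps[abs_def])
next
  case (Suc t)
  have "norm2 (Suc t) (run h (Suc t)) = 1 * norm2 t (run h t)"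
    unfolding run.simps(2)[abs_def]
    by (rule norm2_step) (use Suc h sum_norm_hit in auto)
  with Suc show ?case by (simp del: run.simps)
qed

definition nrm :: "nat \<Rightarrow> ((nat \<Rightarrow> nat) \<Rightarrow> nat \<Rightarrow> complex) \<Rightarrow> real" where
  "nrm t f = sqrt (norm2 t f)"

lemma nrm_L2: "nrm t f = L2_set (\<lambda>(r, i). cmod (f r i)) (tags \<times> {..<d t}) / sqrt (card tags)"
  by (simp add: nrm_def norm2_def L2_set_def real_sqrt_divide sum.cartesian_product split_def)

lemma nrm_triangle: "nrm t (\<lambda>r i. f r i + g r i) \<le> nrm t f + nrm t g"
proof -
  have "L2_set (\<lambda>(r, i). cmod (f r i + g r i)) (tags \<times> {..<d t})
      \<le> L2_set (\<lambda>p. (\<lambda>(r, i). cmod (f r i)) p + (\<lambda>(r, i). cmod (g r i)) p) (tags \<times> {..<d t})"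
    by (intro L2_set_mono) (auto simp: norm_triangle_ineq)
  also have "\<dots> \<le> L2_set (\<lambda>(r, i). cmod (f r i)) (tags \<times> {..<d t}) + L2_set (\<lambda>(r, i). cmod (g r i)) (tags \<times> {..<d t})"
    by (rule L2_set_triangle_ineq)
  finally show ?thesis
    by (simp add: nrm_L2 add_divide_distrib[symmetric] divide_right_mono)
qed

lemma nrm_run_good:
  assumes h: "\<And>x. x < N \<Longrightarrow> h x < N"
  shows "t \<le> T \<Longrightarrow> nrm t (\<lambda>r i. run h t r i - good h t r i) \<le> t / sqrt N"
proof (induction t)
  case 0
  then show ?case by (simp add: good_0 nrm_def norm2_def)
next
  case (Suc t)
  \<comment> \<open>A hybrid argument: \<open>?D\<close> is the earlier error carried along by the
    true query, which preserves its norm, and \<open>?E\<close> is the part discarded at this query,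
    of squared norm at most \<open>1 / N\<close>.\<close>
  let ?D = "\<lambda>r. mat_apply (V (Suc t)) (select_image h t (\<lambda>x z i. tag_hit x z (\<lambda>r. run h t r i - good h t r i) r))"
  let ?E = "\<lambda>r. mat_apply (V (Suc t)) (select_image h t (\<lambda>x z i. tag_avg x (tag_hit x z (\<lambda>r. good h t r i)) r))"
  have "run h (Suc t) r i - good h (Suc t) r i = ?D r i + ?E r i" for r i
    unfolding run.simps good_Suc mat_apply_diff mat_apply_add
    by (intro mat_apply_cong) (simp add: tag_fluct_def tag_hit_def)
  then have "nrm (Suc t) (\<lambda>r i. run h (Suc t) r i - good h (Suc t) r i) = nrm (Suc t) (\<lambda>r i. ?D r i + ?E r i)"
    by presburger
  also have "\<dots> \<le> nrm (Suc t) ?D + nrm (Suc t) ?E" by (rule nrm_triangle)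
  also have "norm2 (Suc t) ?D = 1 * norm2 t (\<lambda>r i. run h t r i - good h t r i)"
    by (rule norm2_step) (use Suc h sum_norm_hit in auto)
  then have "nrm (Suc t) ?D = nrm t (\<lambda>r i. run h t r i - good h t r i)" by (simp add: nrm_def)
  also have "norm2 (Suc t) ?E = 1 / N * norm2 t (good h t)"
    by (rule norm2_step) (use Suc h sum_norm_avg_hit in auto)
  then have "nrm (Suc t) ?E \<le> 1 / sqrt N"
    using Suc h N_pos by (simp add: nrm_def norm2_good real_sqrt_divide power_le_one divide_right_mono)
  finally show ?case using Suc by (simp add: add_divide_distrib)
qed

end

section \<open>Quadratic forms of the run and of its components\<close>

context erasing_walk
begin

text \<open>For \<open>f = g\<close> this is the trace of \<open>W\<close> against the state
  averaged over the tag table.\<close>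

definition form :: "complex mat \<Rightarrow> ((nat \<Rightarrow> nat) \<Rightarrow> nat \<Rightarrow> complex) \<Rightarrow> ((nat \<Rightarrow> nat) \<Rightarrow> nat \<Rightarrow> complex) \<Rightarrow> complex" where
  "form W f g = (\<Sum>r\<in>tags. \<Sum>i<d T. mat_apply W (f r) i * cnj (g r i)) / of_nat (card tags)"

lemma form_bound:
  assumes W: "isometry_mat W" "W \<in> carrier_mat (d T) (d T)"
  shows "cmod (form W f g) \<le> nrm T f * nrm T g"
proof -
  let ?S = "tags \<times> {..<d T}" and ?c = "real (card tags)"
  let ?F = "\<lambda>(r, i). cmod (mat_apply W (f r) i)" and ?G = "\<lambda>(r, i). cmod (g r i)"
  have "cmod (\<Sum>r\<in>tags. \<Sum>i<d T. mat_apply W (f r) i * cnj (g r i)) \<le> (\<Sum>p\<in>?S. \<bar>?F p\<bar> * \<bar>?G p\<bar>)"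
    unfolding sum.cartesian_product
    by (rule sum_norm_le) (auto simp: norm_mult)
  also have "\<dots> \<le> L2_set ?F ?S * L2_set ?G ?S" by (rule L2_set_mult_ineq)
  finally have "cmod (form W f g) \<le> (L2_set ?F ?S * L2_set ?G ?S) / ?c"
    by (simp add: form_def norm_divide divide_right_mono)
  also have "\<dots> = (L2_set ?F ?S / sqrt ?c) * (L2_set ?G ?S / sqrt ?c)" by simp
  also have "L2_set ?F ?S / sqrt ?c = nrm T (\<lambda>r. mat_apply W (f r))" by (simp add: nrm_L2)
  also have "\<dots> = nrm T f" by (simp add: nrm_def norm2_def mat_apply_isometry[OF W])
  also have "L2_set ?G ?S / sqrt ?c = nrm T g" by (simp add: nrm_L2)
  finally show ?thesis .
qed

lemma form_diff: "form W f f - form W g g = form W (\<lambda>r i. f r i - g r i) f + form W g (\<lambda>r i. f r i - g r i)"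
proof -
  have "mat_apply W (f r) i * cnj (f r i) - mat_apply W (g r) i * cnj (g r i)
      = mat_apply W (\<lambda>i. f r i - g r i) i * cnj (f r i) + mat_apply W (g r) i * cnj (f r i - g r i)" for r i
    by (simp add: algebra_simps flip: mat_apply_diff)
  then show ?thesis
    by (simp only: form_def add_divide_distrib[symmetric] diff_divide_distrib[symmetric] sum.distrib[symmetric] sum_subtractf[symmetric])
qed

text \<open>The error enters once in each argument of the form, which gives the factor 2; the other
  argument has norm at most 1.\<close>

lemma form_run_good:
  assumes W: "isometry_mat W" "W \<in> carrier_mat (d T) (d T)" and h: "\<And>x. x < N \<Longrightarrow> h x < N"
  shows "cmod (form W (run h T) (run h T) - form W (good h T) (good h T)) \<le> 2 * T / sqrt N"
proof -
  let ?D = "\<lambda>r i. run h T r i - good h T r i"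
  have D: "0 \<le> nrm T ?D" "nrm T ?D \<le> T / sqrt N"
    using nrm_run_good[OF h order_refl] by (auto simp: nrm_def norm2_nonneg)
  have n: "nrm T (run h T) = 1" "nrm T (good h T) \<le> 1"
    using norm2_run[OF h order_refl] norm2_good[OF h order_refl] N_pos by (auto simp: nrm_def power_le_one)
  have "cmod (form W (run h T) (run h T) - form W (good h T) (good h T))
      \<le> cmod (form W ?D (run h T)) + cmod (form W (good h T) ?D)"
    unfolding form_diff by (rule norm_triangle_ineq)
  also have "\<dots> \<le> nrm T ?D * nrm T (run h T) + nrm T (good h T) * nrm T ?D"
    by (intro add_mono form_bound[OF W])
  also have "\<dots> \<le> nrm T ?D * 1 + 1 * nrm T ?D"
    using n D by (intro add_mono mult_right_mono) auto
  also have "\<dots> \<le> 2 * T / sqrt N" using D by simp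
  finally show ?thesis .
qed

text \<open>\<open>W\<close> acts on the basis index and not on the table, so expanding it entrywise
  leaves only the table averages of \<open>good_inner\<close>.\<close>

lemma form_good_comp: "form W (good h T) (good h T) = (\<Sum>A\<in>Pow {..<N}. form W (comp h T A) (comp h T A))"
proof -
  have expand: "form W f f = (\<Sum>i<d T. \<Sum>k<dim_col W. W $$ (i, k) * (\<Sum>r\<in>tags. f r k * cnj (f r i))) / of_nat (card tags)" for f
  proof -
    have "(\<Sum>r\<in>tags. \<Sum>i<d T. mat_apply W (f r) i * cnj (f r i))
        = (\<Sum>i<d T. \<Sum>r\<in>tags. \<Sum>k<dim_col W. W $$ (i, k) * (f r k * cnj (f r i)))"
      by (subst sum.swap) (simp add: mat_apply_def sum_distrib_right mult.assoc)
    also have "\<dots> = (\<Sum>i<d T. \<Sum>k<dim_col W. \<Sum>r\<in>tags. W $$ (i, k) * (f r k * cnj (f r i)))"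
      by (intro sum.cong[OF refl] sum.swap)
    finally show ?thesis by (simp add: form_def sum_distrib_left)
  qed
  let ?P = "Pow {..<N}" and ?q = "\<lambda>A k i. \<Sum>r\<in>tags. comp h T A r k * cnj (comp h T A r i)"
  have "(\<Sum>A\<in>?P. form W (comp h T A) (comp h T A))
      = (\<Sum>A\<in>?P. \<Sum>i<d T. \<Sum>k<dim_col W. W $$ (i, k) * ?q A k i) / of_nat (card tags)"
    by (simp only: expand sum_divide_distrib)
  also have "(\<Sum>A\<in>?P. \<Sum>i<d T. \<Sum>k<dim_col W. W $$ (i, k) * ?q A k i)
      = (\<Sum>i<d T. \<Sum>A\<in>?P. \<Sum>k<dim_col W. W $$ (i, k) * ?q A k i)" by (rule sum.swap)
  also have "\<dots> = (\<Sum>i<d T. \<Sum>k<dim_col W. \<Sum>A\<in>?P. W $$ (i, k) * ?q A k i)"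
    by (intro sum.cong[OF refl] sum.swap)
  also have "\<dots> = (\<Sum>i<d T. \<Sum>k<dim_col W. W $$ (i, k) * (\<Sum>A\<in>?P. ?q A k i))"
    by (simp only: sum_distrib_left)
  finally show ?thesis by (simp only: expand good_inner)
qed

lemma form_comp_bound:
  assumes W: "isometry_mat W" "W \<in> carrier_mat (d T) (d T)"
  shows "cmod (form W (comp h T A) (comp h T A)) \<le> norm2 T (comp h T A)"
  using form_bound[OF W, of "comp h T A" "comp h T A"] norm2_nonneg[of T "comp h T A"]
  by (simp add: nrm_def)

text \<open>Parseval's identity: the diagonal case of \<open>good_inner\<close>, summed over the
  basis, followed by the exact weight of the kept part.\<close>

lemma sum_norm2_comp:
  assumes h: "\<And>x. x < N \<Longrightarrow> h x < N"
  shows "(\<Sum>A\<in>Pow {..<N}. norm2 T (comp h T A)) = (1 - 1 / N) ^ T"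
proof -
  have "(\<Sum>A\<in>Pow {..<N}. \<Sum>r\<in>tags. (cmod (comp h T A r i))\<^sup>2) = (\<Sum>r\<in>tags. (cmod (good h T r i))\<^sup>2)" for i
  proof -
    have "complex_of_real (\<Sum>A\<in>Pow {..<N}. \<Sum>r\<in>tags. (cmod (comp h T A r i))\<^sup>2)
        = complex_of_real (\<Sum>r\<in>tags. (cmod (good h T r i))\<^sup>2)"
      using good_inner[of h T i i] by (simp only: of_real_sum complex_norm_square)
    then show ?thesis using of_real_eq_iff by blast
  qed
  then have *: "(\<Sum>i<d T. \<Sum>A\<in>Pow {..<N}. \<Sum>r\<in>tags. (cmod (comp h T A r i))\<^sup>2)
      = (\<Sum>i<d T. \<Sum>r\<in>tags. (cmod (good h T r i))\<^sup>2)" by simp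
  have "(\<Sum>A\<in>Pow {..<N}. norm2 T (comp h T A))
      = (\<Sum>A\<in>Pow {..<N}. \<Sum>i<d T. \<Sum>r\<in>tags. (cmod (comp h T A r i))\<^sup>2) / card tags"
    unfolding norm2_def sum_divide_distrib[symmetric] by (subst sum.swap[of _ tags]) (rule refl)
  also have "\<dots> = (\<Sum>i<d T. \<Sum>r\<in>tags. (cmod (good h T r i))\<^sup>2) / card tags"
    by (subst sum.swap) (simp only: *)
  also have "\<dots> = norm2 T (good h T)"
    unfolding norm2_def by (subst sum.swap) (rule refl)
  finally show ?thesis using norm2_good[OF h order_refl] by simp
qed

lemma norm2_comp_zero: "card A > T \<Longrightarrow> norm2 T (comp h T A) = 0"
proof -
  assume "card A > T"
  then have "comp h T A r i = 0" for r i using comp_support[of h T A r i] by auto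
  then show ?thesis by (simp add: norm2_def)
qed

end

section \<open>Permutations and Simon functions on a small set\<close>

definition avg_over :: "'b set \<Rightarrow> ('b \<Rightarrow> 'a) \<Rightarrow> 'a :: real_normed_field" where
  "avg_over H F = (\<Sum>h\<in>H. F h) / of_nat (card H)"

definition perms :: "nat \<Rightarrow> (nat \<Rightarrow> nat) set" where
  "perms n = {h \<in> bits n \<rightarrow>\<^sub>E bits n. bij_betw h (bits n) (bits n)}"

definition injs :: "nat \<Rightarrow> 'b set \<Rightarrow> ('b \<Rightarrow> nat) set" where
  "injs n P = {l \<in> P \<rightarrow>\<^sub>E bits n. inj_on l P}"

definition simon_fun :: "nat \<Rightarrow> nat \<Rightarrow> (nat set \<Rightarrow> nat) \<Rightarrow> nat \<Rightarrow> nat" where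
  "simon_fun n s l = restrict (\<lambda>x. l {x, x XOR s}) (bits n)"

lemma finite_bits [simp]: "finite (bits n)" by (simp add: bits_def)
lemma card_bits [simp]: "card (bits n) = 2 ^ n" by (simp add: bits_def)

lemma xor_bits: "x \<in> bits n \<Longrightarrow> s \<in> bits n \<Longrightarrow> x XOR s \<in> bits n"
  by (simp add: bits_def xor_lt_two_power)

lemma finite_injs [simp]: "finite P \<Longrightarrow> finite (injs n P)"
  by (rule finite_subset[of _ "P \<rightarrow>\<^sub>E bits n"]) (auto simp: injs_def finite_PiE)

lemma finite_perms [simp]: "finite (perms n)"
  by (rule finite_subset[of _ "bits n \<rightarrow>\<^sub>E bits n"]) (auto simp: perms_def finite_PiE)

lemma perms_nonempty: "perms n \<noteq> {}"
proof -
  have "restrict id (bits n) \<in> perms n"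
    by (auto simp: perms_def bij_betw_restrict_eq)
  then show ?thesis by auto
qed

lemma injs_nonempty:
  assumes "finite P" "card P \<le> 2 ^ n"
  shows "injs n P \<noteq> {}"
proof -
  obtain f where f: "f ` P \<subseteq> bits n" "inj_on f P"
    using card_le_inj[OF assms(1) finite_bits, of n] assms(2) by auto
  then have "restrict f P \<in> injs n P" by (auto simp: injs_def inj_on_def)
  then show ?thesis by auto
qed

text \<open>Composition with a permutation maps a finite set injectively into itself, hence onto
  itself.\<close>

lemma sum_injs_compose:
  assumes P: "finite P" and p: "p \<in> perms n"
  shows "(\<Sum>l\<in>injs n P. G l) = (\<Sum>l\<in>injs n P. G (compose P p l))"
proof -
  have p': "inj_on p (bits n)" "p \<in> bits n \<rightarrow> bits n" using p by (auto simp: perms_def bij_betw_def)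
  have inj: "inj_on (compose P p) (injs n P)"
  proof (rule inj_onI, rule ext)
    fix l l' x assume l: "l \<in> injs n P" "l' \<in> injs n P" and eq: "compose P p l = compose P p l'"
    show "l x = l' x"
    proof (cases "x \<in> P")
      case True
      then have "p (l x) = p (l' x)" using fun_cong[OF eq, of x] by (simp add: compose_def)
      moreover have "l x \<in> bits n" "l' x \<in> bits n" using True l by (auto simp: injs_def)
      ultimately show ?thesis using p'(1) by (meson inj_onD)
    qed (use l in \<open>auto simp: injs_def PiE_def extensional_def\<close>)
  qed
  have "compose P p l \<in> injs n P" if "l \<in> injs n P" for l
  proof -
    have l: "l \<in> P \<rightarrow> bits n" "inj_on l P" using that by (auto simp: injs_def)
    then have "compose P p l \<in> P \<rightarrow>\<^sub>E bits n" using p'(2) by (auto simp: compose_def Pi_iff)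
    moreover have "inj_on (compose P p l) P"
      using l p'(1) by (auto simp: inj_on_def compose_def Pi_iff)
    ultimately show ?thesis by (simp add: injs_def)
  qed
  then have "compose P p ` injs n P = injs n P"
    using endo_inj_surj[OF _ _ inj] P by auto
  then show ?thesis using sum.reindex[OF inj, of G] by simp
qed

lemma sum_perms_compose:
  assumes q: "q \<in> perms n"
  shows "(\<Sum>p\<in>perms n. G p) = (\<Sum>p\<in>perms n. G (compose (bits n) p q))"
proof -
  have q': "q ` bits n = bits n" "bij_betw q (bits n) (bits n)" using q by (auto simp: perms_def bij_betw_def)
  have inj: "inj_on (\<lambda>p. compose (bits n) p q) (perms n)"
  proof (rule inj_onI, rule ext)
    fix p p' x assume p: "p \<in> perms n" "p' \<in> perms n" and eq: "compose (bits n) p q = compose (bits n) p' q"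
    show "p x = p' x"
    proof (cases "x \<in> bits n")
      case True
      then obtain y where "y \<in> bits n" "x = q y" using q' by auto
      then show ?thesis using fun_cong[OF eq, of y] by (simp add: compose_def)
    qed (use p in \<open>auto simp: perms_def PiE_def extensional_def\<close>)
  qed
  have "compose (bits n) p q \<in> perms n" if "p \<in> perms n" for p
  proof -
    have p: "bij_betw p (bits n) (bits n)" using that by (simp add: perms_def)
    have "bij_betw (p \<circ> q) (bits n) (bits n)" by (rule bij_betw_trans[OF q'(2) p])
    then have "bij_betw (compose (bits n) p q) (bits n) (bits n)"
      by (rule bij_betw_cong[THEN iffD2, rotated]) (simp add: compose_def)
    then show ?thesis
      using bij_betwE[of "compose (bits n) p q" "bits n" "bits n"] by (auto simp: perms_def compose_def)
  qed
  then have "(\<lambda>p. compose (bits n) p q) ` perms n = perms n"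
    using endo_inj_surj[OF _ _ inj] by auto
  then show ?thesis using sum.reindex[OF inj, of G] by simp
qed

text \<open>The complements of \<open>A\<close> and of its image have equal size, so a bijection
  between them completes \<open>f\<close>.\<close>

lemma extend_to_perm:
  assumes "A \<subseteq> bits n" "inj_on f A" "f ` A \<subseteq> bits n"
  obtains q where "q \<in> perms n" "\<And>x. x \<in> A \<Longrightarrow> q x = f x"
proof -
  have fin: "finite A" using assms(1) finite_bits finite_subset by blast
  have "card (bits n - A) = card (bits n - f ` A)"
    using assms fin by (simp add: card_Diff_subset card_image)
  then obtain b where b: "bij_betw b (bits n - A) (bits n - f ` A)"
    using finite_same_card_bij[of "bits n - A" "bits n - f ` A"] by auto
  define q where "q = restrict (\<lambda>x. if x \<in> A then f x else b x) (bits n)"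
  have qA: "q x = f x" if "x \<in> A" for x using that assms(1) by (auto simp: q_def)
  have "bij_betw q A (f ` A)"
    using assms(2) qA by (auto simp: bij_betw_def inj_on_def image_def)
  moreover have "bij_betw q (bits n - A) (bits n - f ` A)"
    by (rule bij_betw_cong[THEN iffD1, OF _ b]) (auto simp: q_def)
  ultimately have "bij_betw q (A \<union> (bits n - A)) (f ` A \<union> (bits n - f ` A))"
    by (rule bij_betw_combine) auto
  then have "bij_betw q (bits n) (bits n)"
    using assms by (simp add: Un_absorb1 Un_absorb2)
  then have "q \<in> perms n"
    using bij_betwE[of q "bits n" "bits n"] by (auto simp: perms_def q_def)
  then show ?thesis using qA that by blast
qed

text \<open>Composing \<open>l\<close> with a uniform permutation \<open>p\<close> leaves the
  average unchanged. For fixed \<open>l\<close> the values on \<open>A\<close> are then those of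
  \<open>p \<circ> q\<close>, where \<open>q\<close> is a permutation extending
  \<open>l \<circ> c\<close>, and \<open>p \<circ> q\<close> is uniform again. This avoids counting
  injections with prescribed values.\<close>

lemma avg_injs_eq_avg_perms:
  fixes F :: "(nat \<Rightarrow> nat) \<Rightarrow> 'a :: real_normed_field"
  assumes P: "finite P" "injs n P \<noteq> {}" and A: "A \<subseteq> bits n" and c: "inj_on c A" "c ` A \<subseteq> P"
    and F: "\<And>h h'. (\<And>x. x \<in> A \<Longrightarrow> h x = h' x) \<Longrightarrow> F h = F h'"
  shows "avg_over (injs n P) (\<lambda>l. F (\<lambda>x. l (c x))) = avg_over (perms n) F"
proof -
  have "of_nat (card (perms n)) * (\<Sum>l\<in>injs n P. F (\<lambda>x. l (c x)))
      = (\<Sum>p\<in>perms n. \<Sum>l\<in>injs n P. F (\<lambda>x. compose P p l (c x)))"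
    by (simp flip: sum_injs_compose[OF P(1), of _ n "\<lambda>l. F (\<lambda>x. l (c x))"])
  also have "\<dots> = (\<Sum>l\<in>injs n P. \<Sum>p\<in>perms n. F (\<lambda>x. compose P p l (c x)))" by (rule sum.swap)
  also have "\<dots> = (\<Sum>l\<in>injs n P. \<Sum>p\<in>perms n. F p)"
  proof (rule sum.cong[OF refl])
    fix l assume l: "l \<in> injs n P"
    have l': "inj_on l P" "l ` P \<subseteq> bits n" using l by (auto simp: injs_def)
    have "inj_on (\<lambda>x. l (c x)) A" "(\<lambda>x. l (c x)) ` A \<subseteq> bits n"
      using comp_inj_on[OF c(1) inj_on_subset[OF l'(1) c(2)]] l'(2) c(2) by (auto simp: comp_def)
    then obtain q where q: "q \<in> perms n" and qA: "\<And>x. x \<in> A \<Longrightarrow> q x = l (c x)"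
      using extend_to_perm[OF A] by metis
    have "F (\<lambda>x. compose P p l (c x)) = F (compose (bits n) p q)" for p
      by (rule F) (use c A qA in \<open>auto simp: compose_def\<close>)
    then show "(\<Sum>p\<in>perms n. F (\<lambda>x. compose P p l (c x))) = (\<Sum>p\<in>perms n. F p)"
      using sum_perms_compose[OF q, of F] by simp
  qed
  also have "\<dots> = of_nat (card (injs n P)) * (\<Sum>p\<in>perms n. F p)" by simp
  finally have "of_nat (card (perms n)) * (\<Sum>l\<in>injs n P. F (\<lambda>x. l (c x))) = of_nat (card (injs n P)) * (\<Sum>p\<in>perms n. F p)" .
  moreover have "card (perms n) \<noteq> 0" "card (injs n P) \<noteq> 0"
    using perms_nonempty P by auto
  ultimately show ?thesis by (simp add: avg_over_def field_simps)
qed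

section \<open>Shifts that a set of points can expose\<close>

definition collision_shifts :: "nat \<Rightarrow> nat set \<Rightarrow> nat set" where
  "collision_shifts n A = {s \<in> bits n - {0}. \<exists>x\<in>A. x XOR s \<in> A}"

lemma xor_cancel: "(x XOR s) XOR s = (x :: nat)"
  by (simp only: xor.assoc xor_self_eq xor.right_neutral)

lemma xor_eq_self_iff: "x XOR s = x \<longleftrightarrow> s = (0 :: nat)"
proof
  assume *: "x XOR s = x"
  have "s = (s XOR x) XOR x" by (simp only: xor_cancel)
  also have "s XOR x = x" using * by (simp only: xor.commute[of s x])
  finally show "s = 0" by simp
qed simp

text \<open>A shift is determined by an unordered pair of points of \<open>A\<close> that it links,
  and there are \<open>card A choose 2\<close> such pairs.\<close>

lemma card_collision_shifts:
  assumes "A \<subseteq> bits n"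
  shows "2 * card (collision_shifts n A) \<le> card A * (card A - 1)"
proof -
  have fin: "finite A" using assms finite_bits finite_subset by blast
  let ?Q = "{B. B \<subseteq> A \<and> card B = 2}"
  have finQ: "finite ?Q" by (rule finite_subset[of _ "Pow A"]) (use fin in auto)
  \<comment> \<open>\<open>Min\<close> and \<open>Max\<close> only serve to read the difference off
    the pair as a set; exclusive or is symmetric.\<close>
  have "collision_shifts n A \<subseteq> (\<lambda>B. Min B XOR Max B) ` ?Q"
  proof
    fix s assume "s \<in> collision_shifts n A"
    then obtain x where x: "x \<in> A" "x XOR s \<in> A" "s \<noteq> 0" by (auto simp: collision_shifts_def)
    have ne: "x XOR s \<noteq> x" using x xor_eq_self_iff by simp
    have *: "(x XOR s) XOR x = s" by (simp only: xor.commute[of x s] xor_cancel)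
    have "x XOR (x XOR s) = (x XOR s) XOR x" by (rule xor.commute)
    with * have eq: "s = Min {x, x XOR s} XOR Max {x, x XOR s}" by (simp add: min_def max_def)
    have "card {x, x XOR s} = 2" using ne by (metis card_2_iff)
    then have "{x, x XOR s} \<in> ?Q" using x by simp
    with eq show "s \<in> (\<lambda>B. Min B XOR Max B) ` ?Q" by (rule image_eqI)
  qed
  then have "card (collision_shifts n A) \<le> card ?Q"
    by (rule order_trans[OF card_mono[OF finite_imageI[OF finQ]] card_image_le[OF finQ]])
  also have "card ?Q = card A choose 2" using n_subsets[OF fin] by simp
  finally show ?thesis by (simp add: choose_two)
qed

lemma shift_pairs_finite: "finite (shift_pairs n s)" "card (shift_pairs n s) \<le> 2 ^ n"
proof -
  have *: "shift_pairs n s = (\<lambda>x. {x, x XOR s}) ` bits n" by (auto simp: shift_pairs_def)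
  show "finite (shift_pairs n s)" by (simp add: *)
  show "card (shift_pairs n s) \<le> 2 ^ n" unfolding * using card_image_le[OF finite_bits] by (metis card_bits)
qed

text \<open>If no two points of \<open>A\<close> differ by \<open>s\<close>, they lie in different
  pairs, so on \<open>A\<close> the function is a random labelling composed with an injective
  map.\<close>

lemma avg_simon_eq_avg_perms:
  fixes F :: "(nat \<Rightarrow> nat) \<Rightarrow> 'a :: real_normed_field"
  assumes A: "A \<subseteq> bits n" and s: "s \<in> bits n - {0}" "s \<notin> collision_shifts n A"
    and F: "\<And>h h'. (\<And>x. x \<in> A \<Longrightarrow> h x = h' x) \<Longrightarrow> F h = F h'"
  shows "avg_over (injs n (shift_pairs n s)) (\<lambda>l. F (simon_fun n s l)) = avg_over (perms n) F"
proof -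
  let ?c = "\<lambda>x. {x, x XOR s}"
  have eq: "F (simon_fun n s l) = F (\<lambda>x. l (?c x))" for l
    by (rule F) (use A in \<open>auto simp: simon_fun_def\<close>)
  have inj: "inj_on ?c A"
    using s by (auto simp: inj_on_def doubleton_eq_iff collision_shifts_def)
  have sub: "?c ` A \<subseteq> shift_pairs n s" using A by (auto simp: shift_pairs_def)
  show ?thesis
    unfolding eq
    by (rule avg_injs_eq_avg_perms[OF shift_pairs_finite(1) injs_nonempty[OF shift_pairs_finite] A inj sub F])
qed

definition simon_avg :: "nat \<Rightarrow> ((nat \<Rightarrow> nat) \<Rightarrow> 'a) \<Rightarrow> 'a :: real_normed_field" where
  "simon_avg n F = avg_over (bits n - {0}) (\<lambda>s. avg_over (injs n (shift_pairs n s)) (\<lambda>l. F (simon_fun n s l)))"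

lemma avg_over_sum: "avg_over H (\<lambda>h. \<Sum>a\<in>B. F a h) = (\<Sum>a\<in>B. avg_over H (F a))"
  unfolding avg_over_def by (subst sum.swap) (simp add: sum_divide_distrib)

lemma avg_over_const: "finite H \<Longrightarrow> H \<noteq> {} \<Longrightarrow> avg_over H (\<lambda>h. c) = c"
  by (simp add: avg_over_def)

lemma avg_over_mono:
  fixes F G :: "'b \<Rightarrow> real"
  shows "(\<And>h. h \<in> H \<Longrightarrow> F h \<le> G h) \<Longrightarrow> avg_over H F \<le> avg_over H G"
  by (simp add: avg_over_def divide_right_mono sum_mono)

lemma avg_over_cong: "(\<And>h. h \<in> H \<Longrightarrow> F h = G h) \<Longrightarrow> avg_over H F = avg_over H G"
  by (simp add: avg_over_def)

lemma norm_avg_over: "norm (avg_over H F) \<le> avg_over H (\<lambda>h. norm (F h))"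
  by (simp add: avg_over_def norm_divide divide_right_mono norm_sum)

lemma avg_over_diff: "avg_over H F - avg_over H G = avg_over H (\<lambda>h. F h - G h)"
  by (simp add: avg_over_def sum_subtractf diff_divide_distrib)

lemma perms_bits: "h \<in> perms n \<Longrightarrow> h \<in> bits n \<rightarrow> bits n"
  by (auto simp: perms_def)

lemma simon_fun_bits: "l \<in> injs n (shift_pairs n s) \<Longrightarrow> simon_fun n s l \<in> bits n \<rightarrow> bits n"
  by (auto simp: injs_def simon_fun_def shift_pairs_def)

lemma simon_fun_simon:
  assumes "l \<in> injs n (shift_pairs n s)" "s \<in> bits n"
  shows "simon_function n s (simon_fun n s l)"
proof -
  have "{x, x XOR s} = {y, y XOR s} \<longleftrightarrow> y \<in> {x, x XOR s}" for x y
    by (auto simp: doubleton_eq_iff xor_cancel)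
  moreover have "l {x, x XOR s} = l {y, y XOR s} \<longleftrightarrow> {x, x XOR s} = {y, y XOR s}" if "x \<in> bits n" "y \<in> bits n" for x y
    by (rule inj_on_eq_iff[of l "shift_pairs n s"]) (use assms that in \<open>auto simp: injs_def shift_pairs_def\<close>)
  ultimately show ?thesis
    unfolding simon_function_def using simon_fun_bits[OF assms(1)] by (auto simp: simon_fun_def)
qed

text \<open>Here \<open>g\<close> stands for the value of the form on a component and
  \<open>m\<close> for its weight. The weight \<open>ns A s\<close> depends on the shift, so the
  number of collision shifts does not bound its sum. It is traded for \<open>n0 A\<close>, which
  does not depend on the shift.\<close>

lemma simon_gap:
  fixes g :: "(nat \<Rightarrow> nat) \<Rightarrow> nat set \<Rightarrow> complex" and m :: "(nat \<Rightarrow> nat) \<Rightarrow> nat set \<Rightarrow> real"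
  assumes n: "n \<ge> 1"
    and g_dep: "\<And>A h h'. A \<subseteq> bits n \<Longrightarrow> (\<And>x. x \<in> A \<Longrightarrow> h x = h' x) \<Longrightarrow> g h A = g h' A"
    and m_dep: "\<And>A h h'. A \<subseteq> bits n \<Longrightarrow> (\<And>x. x \<in> A \<Longrightarrow> h x = h' x) \<Longrightarrow> m h A = m h' A"
    and gm: "\<And>h A. cmod (g h A) \<le> m h A"
    and m_sum: "\<And>h. h \<in> bits n \<rightarrow> bits n \<Longrightarrow> (\<Sum>A\<in>Pow (bits n). m h A) = q"
    and m_zero: "\<And>h A. card A > T \<Longrightarrow> m h A = 0"
  shows "cmod (avg_over (perms n) (\<lambda>h. \<Sum>A\<in>Pow (bits n). g h A) - simon_avg n (\<lambda>h. \<Sum>A\<in>Pow (bits n). g h A))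
       \<le> q * (real T * (real T - 1) / (2 ^ n - 1))"
proof -
  let ?P = "Pow (bits n)" and ?S = "bits n - {0}" and ?J = "\<lambda>s. injs n (shift_pairs n s)" and ?C = "collision_shifts n"
  define e0 where "e0 A = avg_over (perms n) (\<lambda>h. g h A)" for A
  define es where "es A s = avg_over (?J s) (\<lambda>l. g (simon_fun n s l) A)" for A s
  define n0 where "n0 A = avg_over (perms n) (\<lambda>h. m h A)" for A
  define ns where "ns A s = avg_over (?J s) (\<lambda>l. m (simon_fun n s l) A)" for A s
  have m0: "m h A \<ge> 0" for h A using gm[of h A] norm_ge_zero order_trans by blast
  have fS: "finite ?S" by simp
  have cS: "real (card ?S) = 2 ^ n - 1" by (simp add: bits_def)
  have Spos: "(2 :: real) ^ n - 1 > 0" using n by (cases n) (auto simp: less_le_trans[of 1 2])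
  have Sne: "?S \<noteq> {}" using cS Spos by (metis card.empty of_nat_0 less_irrefl)
  have J: "finite (?J s)" "?J s \<noteq> {}" for s
    by (simp_all add: shift_pairs_finite(1) injs_nonempty[OF shift_pairs_finite])
  have C: "?C A \<subseteq> ?S" "finite (?C A)" for A by (auto simp: collision_shifts_def)
  have eqe: "es A s = e0 A" and eqn: "ns A s = n0 A" if A: "A \<in> ?P" and s: "s \<in> ?S" "s \<notin> ?C A" for A s
  proof -
    from A have A': "A \<subseteq> bits n" by simp
    show "es A s = e0 A"
      unfolding es_def e0_def
      by (rule avg_simon_eq_avg_perms[where F = "\<lambda>h. g h A", OF A' s g_dep[OF A']])
    show "ns A s = n0 A"
      unfolding ns_def n0_def
      by (rule avg_simon_eq_avg_perms[where F = "\<lambda>h. m h A", OF A' s m_dep[OF A']])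
  qed
  have n0q: "(\<Sum>A\<in>?P. n0 A) = q"
  proof -
    have "(\<Sum>A\<in>?P. n0 A) = avg_over (perms n) (\<lambda>l. q)"
      unfolding n0_def avg_over_sum[symmetric]
      by (rule avg_over_cong) (simp add: m_sum perms_bits)
    then show ?thesis using perms_nonempty by (simp add: avg_over_const)
  qed
  have "avg_over (perms n) (\<lambda>h. \<Sum>A\<in>?P. g h A) - simon_avg n (\<lambda>h. \<Sum>A\<in>?P. g h A)
      = (\<Sum>A\<in>?P. avg_over ?S (\<lambda>s. e0 A - es A s))"
    unfolding simon_avg_def avg_over_sum avg_over_diff[symmetric] sum_subtractf
    using fS Sne by (simp add: avg_over_const e0_def es_def[abs_def])
  also have "cmod \<dots> \<le> (\<Sum>A\<in>?P. avg_over ?S (\<lambda>s. if s \<in> ?C A then n0 A + ns A s else 0))"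
  proof (rule sum_norm_le)
    fix A assume A: "A \<in> ?P"
    have "cmod (e0 A - es A s) \<le> (if s \<in> ?C A then n0 A + ns A s else 0)" if "s \<in> ?S" for s
    proof (cases "s \<in> ?C A")
      case True
      have "cmod (e0 A) \<le> n0 A" "cmod (es A s) \<le> ns A s"
        unfolding e0_def n0_def es_def ns_def
        by (rule order_trans[OF norm_avg_over]; rule avg_over_mono; rule gm)+
      then show ?thesis using True norm_triangle_ineq4[of "e0 A" "es A s"] by simp
    qed (use eqe[OF A that] in simp)
    then show "cmod (avg_over ?S (\<lambda>s. e0 A - es A s)) \<le> avg_over ?S (\<lambda>s. if s \<in> ?C A then n0 A + ns A s else 0)"
      by (intro order_trans[OF norm_avg_over] avg_over_mono) auto
  qed
  also have "\<dots> = (\<Sum>A\<in>?P. \<Sum>s\<in>?C A. n0 A + ns A s) / (2 ^ n - 1)"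
  proof -
    have "avg_over ?S (\<lambda>s. if s \<in> ?C A then n0 A + ns A s else 0) = (\<Sum>s\<in>?C A. n0 A + ns A s) / (2 ^ n - 1)" for A
    proof -
      have "{s \<in> ?S. s \<in> ?C A} = ?C A" by (auto simp: collision_shifts_def)
      then show ?thesis
        unfolding avg_over_def by (subst sum.inter_filter[OF fS, symmetric]) (simp add: cS[simplified])
    qed
    then show ?thesis by (simp only: sum_divide_distrib)
  qed
  also have "(\<Sum>A\<in>?P. \<Sum>s\<in>?C A. n0 A + ns A s) = (\<Sum>A\<in>?P. 2 * card (?C A) * n0 A)"
  proof -
    have "(\<Sum>A\<in>?P. ns A s) = q" for s
    proof -
      have "(\<Sum>A\<in>?P. ns A s) = avg_over (?J s) (\<lambda>l. q)"
        unfolding ns_def avg_over_sum[symmetric]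
        by (rule avg_over_cong) (simp add: m_sum simon_fun_bits)
      then show ?thesis using J by (simp add: avg_over_const)
    qed
    \<comment> \<open>For each shift both weights sum to \<open>q\<close>. They agree off the
      exceptional pairs, so their differences cancel over the exceptional pairs alone.\<close>
    then have "(\<Sum>s\<in>?S. \<Sum>A\<in>?P. ns A s - n0 A) = 0" by (simp add: sum_subtractf n0q)
    then have "(\<Sum>A\<in>?P. \<Sum>s\<in>?S. ns A s - n0 A) = 0" by (subst sum.swap)
    moreover have "(\<Sum>s\<in>?S. ns A s - n0 A) = (\<Sum>s\<in>?C A. ns A s - n0 A)" if "A \<in> ?P" for A
      by (rule sum.mono_neutral_right) (use C eqn[OF that] fS in auto)
    ultimately have "(\<Sum>A\<in>?P. \<Sum>s\<in>?C A. ns A s - n0 A) = 0" by simp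
    then have "(\<Sum>A\<in>?P. \<Sum>s\<in>?C A. ns A s) = (\<Sum>A\<in>?P. card (?C A) * n0 A)"
      by (simp add: sum_subtractf)
    then show ?thesis by (simp add: sum.distrib sum_distrib_left mult.assoc flip: mult_2)
  qed
  also have "\<dots> \<le> (\<Sum>A\<in>?P. (real T * (real T - 1)) * n0 A)"
  proof (rule sum_mono)
    fix A assume A: "A \<in> ?P"
    have n00: "n0 A \<ge> 0"
      using m0 by (auto simp: n0_def avg_over_def intro!: divide_nonneg_nonneg sum_nonneg)
    show "2 * card (?C A) * n0 A \<le> (real T * (real T - 1)) * n0 A"
    proof (cases "card A > T")
      case True
      then have "n0 A = 0" by (simp add: n0_def m_zero avg_over_def)
      then show ?thesis by simp
    next
      case False
      have "2 * card (?C A) \<le> card A * (card A - 1)" using A card_collision_shifts by auto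
      also have "\<dots> \<le> T * (T - 1)" using False by (intro mult_mono) auto
      finally have "real (2 * card (?C A)) \<le> real (T * (T - 1))" by (rule of_nat_mono)
      \<comment> \<open>Natural subtraction truncates at \<open>T = 0\<close>, where both sides
        vanish.\<close>
      also have "\<dots> = real T * (real T - 1)" by (cases T) (auto simp: algebra_simps)
      finally show ?thesis using n00 by (intro mult_right_mono) auto
    qed
  qed
  also have "\<dots> = real T * (real T - 1) * q" by (simp add: n0q flip: sum_distrib_left)
  finally show ?thesis using Spos by (simp add: divide_right_mono mult.commute)
qed

section \<open>Averaged states of a strategy\<close>

lemma avg_over_mult_left: "avg_over H (\<lambda>h. c * F h) = c * avg_over H F"
  by (simp add: avg_over_def sum_distrib_left)

lemma expectation_bind_finite:
  fixes H :: "'b \<Rightarrow> complex"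
  assumes "finite (set_pmf p)" "\<And>x. x \<in> set_pmf p \<Longrightarrow> finite (set_pmf (f x))"
  shows "measure_pmf.expectation (p \<bind> f) H = measure_pmf.expectation p (\<lambda>x. measure_pmf.expectation (f x) H)"
proof -
  have "measure_pmf.expectation p (\<lambda>x. measure_pmf.expectation (f x) H)
      = (\<Sum>a\<in>set_pmf p. pmf p a *\<^sub>R measure_pmf.expectation (f a) H)"
    by (rule integral_measure_pmf[OF assms(1)]) auto
  then show ?thesis using pmf_expectation_bind[of "set_pmf p" f p H] assms by simp
qed

lemma expectation_pmf_of_set:
  fixes F :: "'b \<Rightarrow> complex"
  assumes "finite A" "A \<noteq> {}"
  shows "measure_pmf.expectation (pmf_of_set A) F = avg_over A F"
proof -
  have "measure_pmf.expectation (pmf_of_set A) F = (\<Sum>a\<in>A. pmf (pmf_of_set A) a *\<^sub>R F a)"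
    using assms by (intro integral_measure_pmf) auto
  also have "\<dots> = (\<Sum>a\<in>A. F a / of_nat (card A))"
    using assms by (intro sum.cong) (auto simp: scaleR_conv_of_real)
  finally show ?thesis by (simp add: avg_over_def sum_divide_distrib)
qed

abbreviation tag_tables :: "nat \<Rightarrow> (nat \<Rightarrow> nat) set" where
  "tag_tables n \<equiv> bits n \<rightarrow>\<^sub>E bits n"

lemma finite_tag_tables [simp]: "finite (tag_tables n)"
  by (simp add: finite_PiE)

lemma bits_nonempty: "bits n \<noteq> {}"
  by (auto simp: bits_def lessThan_empty_iff)

lemma tag_tables_nonempty: "tag_tables n \<noteq> {}"
  using bits_nonempty[of n] by (auto simp: PiE_eq_empty_iff)

lemma expectation_tag_dist:
  fixes F :: "_ \<Rightarrow> complex"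
  shows "measure_pmf.expectation (tag_dist n) F = avg_over (tag_tables n) F"
  by (simp add: tag_dist_def expectation_pmf_of_set tag_tables_nonempty)

lemma expectation_pair_tag:
  fixes F :: "_ \<Rightarrow> complex"
  assumes "finite (set_pmf D)"
  shows "measure_pmf.expectation (pair_pmf D (tag_dist n)) F
       = measure_pmf.expectation D (\<lambda>h. avg_over (tag_tables n) (\<lambda>r. F (h, r)))"
proof -
  have "finite (set_pmf (tag_dist n))"
    by (simp add: tag_dist_def tag_tables_nonempty)
  then show ?thesis
    using assms by (simp add: pair_pmf_def expectation_bind_finite expectation_tag_dist)
qed

lemma expectation_perm_dist:
  fixes F :: "_ \<Rightarrow> complex"
  shows "measure_pmf.expectation (perm_dist n) F = avg_over (perms n) F" "finite (set_pmf (perm_dist n))"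
  using perms_nonempty[of n] finite_perms[of n]
  by (simp_all add: perm_dist_def perms_def[symmetric] expectation_pmf_of_set)

lemma nonzero_bits_nonempty: "n \<ge> 1 \<Longrightarrow> bits n - {0} \<noteq> {}"
proof -
  assume "n \<ge> 1"
  then have "(1 :: nat) < 2 ^ n" using one_less_power[of "2 :: nat" n] by simp
  then have "1 \<in> bits n - {0}" by (auto simp: bits_def)
  then show ?thesis by auto
qed

lemma expectation_simon_dist:
  fixes F :: "_ \<Rightarrow> complex"
  assumes "n \<ge> 1"
  shows "measure_pmf.expectation (simon_dist n) F = simon_avg n F" "finite (set_pmf (simon_dist n))"
proof -
  have J: "finite (injs n (shift_pairs n s))" "injs n (shift_pairs n s) \<noteq> {}" for s
    by (simp_all add: shift_pairs_finite(1) injs_nonempty[OF shift_pairs_finite])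
  note S = nonzero_bits_nonempty[OF assms]
  have D: "simon_dist n = pmf_of_set (bits n - {0}) \<bind>
      (\<lambda>s. pmf_of_set (injs n (shift_pairs n s)) \<bind> (\<lambda>l. return_pmf (simon_fun n s l)))"
    by (simp add: simon_dist_def injs_def simon_fun_def)
  show "finite (set_pmf (simon_dist n))" using S J by (simp add: D)
  show "measure_pmf.expectation (simon_dist n) F = simon_avg n F"
    using S J by (simp add: D expectation_bind_finite expectation_pmf_of_set simon_avg_def)
qed

lemma expectation_linear:
  fixes F :: "_ \<Rightarrow> _ \<Rightarrow> complex"
  assumes "finite (set_pmf D)"
  shows "measure_pmf.expectation D (\<lambda>h. \<Sum>a\<in>B. c a * F a h) = (\<Sum>a\<in>B. c a * measure_pmf.expectation D (F a))"
proof -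
  have *: "measure_pmf.expectation D G = (\<Sum>x\<in>set_pmf D. pmf D x *\<^sub>R G x)" for G :: "_ \<Rightarrow> complex"
    by (rule integral_measure_pmf[OF assms]) auto
  show ?thesis
    unfolding * scaleR_conv_of_real sum_distrib_left
    by (subst sum.swap) (simp add: mult.left_commute)
qed

section \<open>Traces against averaged final states\<close>

lemma pure_density_dim [simp]:
  "dim_row (pure_density v) = dim_vec v" "dim_col (pure_density v) = dim_vec v"
  by (simp_all add: pure_density_def)

lemma trace_pure_density:
  assumes "M \<in> carrier_mat m m" "v \<in> carrier_vec m"
  shows "mat_trace (M * pure_density v) = (M *\<^sub>v v) \<bullet>c v"
proof -
  have "mat_trace (M * pure_density v) = (\<Sum>i<m. \<Sum>k<m. M $$ (i, k) * (v $ k * cnj (v $ i)))"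
    using assms by (auto simp: mat_trace_def mat_mult_index pure_density_def intro!: sum.cong)
  also have "\<dots> = (M *\<^sub>v v) \<bullet>c v"
    using assms by (auto simp: cscalar_prod_sum mat_vec_index sum_distrib_right mult.assoc intro!: sum.cong)
  finally show ?thesis .
qed

text \<open>The averaged state is defined entrywise and the trace is linear in the entries; with
  finite support the exchange is one of finite sums.\<close>

lemma trace_average_state:
  assumes D: "finite (set_pmf D)" and M: "M \<in> carrier_mat (final_dim S) (final_dim S)"
    and dim: "\<And>h r. h \<in> set_pmf D \<Longrightarrow> r \<in> tag_tables n \<Longrightarrow> dim_vec (state_after (Q h r) S (queries S)) = final_dim S"
  shows "mat_trace (M * average_state n D Q S)
       = measure_pmf.expectation D (\<lambda>h. avg_over (tag_tables n) (\<lambda>r. mat_trace (M * final_state (Q h r) S)))"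
proof -
  let ?d = "final_dim S" and ?R = "tag_tables n"
  let ?a = "\<lambda>(i, k). M $$ (i, k)"
  have tr: "mat_trace (M * final_state (Q h r) S) = (\<Sum>p\<in>{..<?d} \<times> {..<?d}. ?a p * final_state (Q h r) S $$ (snd p, fst p))"
    if "h \<in> set_pmf D" "r \<in> ?R" for h r
    using M dim[OF that]
    by (simp add: mat_trace_def mat_mult_index final_state_def sum.cartesian_product split_def del: index_mat(1))
  have "mat_trace (M * average_state n D Q S) = (\<Sum>p\<in>{..<?d} \<times> {..<?d}. ?a p * average_state n D Q S $$ (snd p, fst p))"
    using M
    by (simp add: mat_trace_def mat_mult_index average_state_def sum.cartesian_product split_def del: index_mat(1))
  also have "\<dots> = (\<Sum>p\<in>{..<?d} \<times> {..<?d}. ?a p *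
      measure_pmf.expectation D (\<lambda>h. avg_over ?R (\<lambda>r. final_state (Q h r) S $$ (snd p, fst p))))"
    by (intro sum.cong) (auto simp: average_state_def expectation_pair_tag[OF D])
  also have "\<dots> = measure_pmf.expectation D (\<lambda>h. avg_over ?R (\<lambda>r. \<Sum>p\<in>{..<?d} \<times> {..<?d}. ?a p * final_state (Q h r) S $$ (snd p, fst p)))"
    by (simp only: expectation_linear[OF D, symmetric] avg_over_mult_left[symmetric] avg_over_sum[symmetric])
  also have "\<dots> = measure_pmf.expectation D (\<lambda>h. avg_over ?R (\<lambda>r. mat_trace (M * final_state (Q h r) S)))"
    by (intro integral_cong_AE AE_pmfI) (auto intro!: avg_over_cong simp: tr)
  finally show ?thesis .
qed

text \<open>The starting vector of the walk is the image of the initial state under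
  \<open>iso S 0\<close>, hence a unit vector.\<close>

lemma valid_strategy_walk:
  assumes "valid_strategy (2 ^ n) (2 ^ (3 * n)) S"
  shows "erasing_walk (2 ^ n) (queries S) (iso S) (work S) (target_dim (2 ^ n) S) (\<lambda>i. (iso S 0 *\<^sub>v init_state S) $ i)"
proof
  have init: "init_state S \<bullet>c init_state S = 1"
    and iso: "\<And>t. t \<le> queries S \<Longrightarrow> iso S t \<in> carrier_mat (target_dim (2 ^ n) S t) (source_dim (2 ^ (3 * n)) S t)"
    and isom: "\<And>t. t \<le> queries S \<Longrightarrow> isometry_mat (iso S t)"
    using assms by (auto simp: valid_strategy_def)
  show "0 < (2 :: nat) ^ n" by simp
  have N3: "(2 :: nat) ^ (3 * n) = 2 ^ n * 2 ^ n * 2 ^ n"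
    by (simp flip: power_add)
  fix t
  show "iso S (Suc t) \<in> carrier_mat (target_dim (2 ^ n) S (Suc t)) (2 ^ n * 2 ^ n * 2 ^ n * work S t)" if "t < queries S"
    using iso[of "Suc t"] that by (simp add: source_dim_def N3)
  show "isometry_mat (iso S (Suc t))" if "t < queries S"
    using isom[of "Suc t"] that by simp
  show "target_dim (2 ^ n) S t = 2 ^ n * work S t" if "t < queries S"
    using that by (simp add: target_dim_def)
  show "(\<Sum>i<target_dim (2 ^ n) S 0. (cmod ((iso S 0 *\<^sub>v init_state S) $ i))\<^sup>2) = 1"
  proof -
    have c: "iso S 0 \<in> carrier_mat (target_dim (2 ^ n) S 0) (dim_vec (init_state S))"
      using iso[of 0] by (simp add: source_dim_def)
    have "complex_of_real (\<Sum>i<target_dim (2 ^ n) S 0. (cmod ((iso S 0 *\<^sub>v init_state S) $ i))\<^sup>2)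
        = (iso S 0 *\<^sub>v init_state S) \<bullet>c (iso S 0 *\<^sub>v init_state S)"
      using c by (simp add: cscalar_prod_self)
    also have "\<dots> = 1"
      using isometry_cscalar_prod[OF isom[OF le0] c carrier_vecI[OF refl] carrier_vecI[OF refl]] init by simp
    finally show ?thesis using of_real_eq_1_iff by blast
  qed
qed

section \<open>The erasing oracle as a map on basis indices\<close>

lemma kron_dim [simp]:
  "dim_row (kron A B) = dim_row A * dim_row B" "dim_col (kron A B) = dim_col A * dim_col B"
  by (simp_all add: kron_def)

lemma garbage_erasing_oracle_dim [simp]:
  "dim_row (garbage_erasing_oracle n h r) = 2 ^ (3 * n)" "dim_col (garbage_erasing_oracle n h r) = 2 ^ n"
  by (simp_all add: garbage_erasing_oracle_def erasing_oracle_def)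

lemma concat3_garbage_fun:
  assumes "x < 2 ^ n" "h \<in> bits n \<rightarrow> bits n" "r \<in> bits n \<rightarrow> bits n"
  shows "concat3 n (garbage_fun h r x) < 2 ^ (3 * n)" "concat3 n (garbage_fun h r x) div 2 ^ n div 2 ^ n = h x"
proof -
  have hx: "h x < 2 ^ n" "r x < 2 ^ n" using assms by (auto simp: bits_def)
  have "(h x * 2 ^ n + x) * 2 ^ n + r x < 2 ^ n * 2 ^ n * 2 ^ n"
    using hx assms(1) by (intro less_mult_combine)
  also have "\<dots> = (2 :: nat) ^ (3 * n)" by (simp flip: power_add)
  finally show "concat3 n (garbage_fun h r x) < 2 ^ (3 * n)" by (simp add: concat3_def garbage_fun_def)
  show "concat3 n (garbage_fun h r x) div 2 ^ n div 2 ^ n = h x"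
    using hx assms(1) by (simp add: concat3_def garbage_fun_def)
qed

text \<open>A row has at most one nonzero entry: its middle digit names the argument, and the other
  two digits must be the image and the tag of that argument.\<close>

lemma kron_erasing_oracle_vec:
  fixes v :: "complex vec"
  assumes h: "\<And>x. x < 2 ^ n \<Longrightarrow> h x < 2 ^ n" and r: "\<And>x. x < 2 ^ n \<Longrightarrow> r x < 2 ^ n"
    and v: "v \<in> carrier_vec (2 ^ n * w)" and k: "k < 2 ^ (3 * n) * w"
  shows "(kron (garbage_erasing_oracle n h r) (1\<^sub>m w) *\<^sub>v v) $ k
    = (let x = k div w div 2 ^ n mod 2 ^ n in
       if k div w div 2 ^ n div 2 ^ n = h x \<and> k div w mod 2 ^ n = r x then v $ (x * w + k mod w) else 0)"
proof -
  let ?N = "(2 :: nat) ^ n" and ?Q = "garbage_erasing_oracle n h r"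
  define x0 where "x0 = k div w div ?N mod ?N"
  have w: "w > 0" using k by (cases w) auto
  have kw: "k div w < 2 ^ (3 * n)" using k by (simp add: less_mult_imp_div_less)
  have x0: "x0 < ?N" by (simp add: x0_def)
  have iff: "k div w = (h x * ?N + x) * ?N + r x \<longleftrightarrow> x = x0 \<and> k div w div ?N div ?N = h x0 \<and> k div w mod ?N = r x0"
    if x: "x < ?N" for x
  proof
    assume *: "k div w = (h x * ?N + x) * ?N + r x"
    have a: "k div w div ?N = h x * ?N + x" "k div w mod ?N = r x"
      using r[OF x] by (simp_all add: *)
    have "k div w div ?N div ?N = h x" "x0 = x" unfolding x0_def a(1) using x by simp_all
    with a show "x = x0 \<and> k div w div ?N div ?N = h x0 \<and> k div w mod ?N = r x0" by simp
  next
    assume *: "x = x0 \<and> k div w div ?N div ?N = h x0 \<and> k div w mod ?N = r x0"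
    have "(k div w div ?N div ?N * ?N + k div w div ?N mod ?N) * ?N + k div w mod ?N = k div w"
      by (simp only: div_mult_mod_eq)
    then show "k div w = (h x * ?N + x) * ?N + r x" using * by (simp only: x0_def[symmetric])
  qed
  have entry: "kron ?Q (1\<^sub>m w) $$ (k, x * w + j) = (if k div w = (h x * ?N + x) * ?N + r x \<and> j = k mod w then 1 else 0)"
    if "x < ?N" "j < w" for x j
  proof -
    have "x * w + j < ?N * w"
      using that by (rule less_mult_combine)
    then show ?thesis
      using that k kw w
      by (auto simp: kron_def garbage_erasing_oracle_def erasing_oracle_def concat3_def garbage_fun_def)
  qed
  have "(kron ?Q (1\<^sub>m w) *\<^sub>v v) $ k = (\<Sum>c<?N * w. kron ?Q (1\<^sub>m w) $$ (k, c) * v $ c)"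
    using k v by (simp add: mat_vec_index)
  also have "\<dots> = (\<Sum>x<?N. \<Sum>j<w. if j = k mod w then
      (if k div w = (h x * ?N + x) * ?N + r x then v $ (x * w + j) else 0) else 0)"
    unfolding sum_lessThan_mult by (intro sum.cong[OF refl]) (simp add: entry)
  also have "\<dots> = (\<Sum>x<?N. if k div w = (h x * ?N + x) * ?N + r x then v $ (x * w + k mod w) else 0)"
    using w by (intro sum.cong[OF refl]) (simp add: sum.delta)
  also have "\<dots> = (\<Sum>x<?N. if x = x0 then
      (if k div w div ?N div ?N = h x0 \<and> k div w mod ?N = r x0 then v $ (x0 * w + k mod w) else 0) else 0)"
    by (intro sum.cong[OF refl]) (simp add: iff)
  also have "\<dots> = (if k div w div ?N div ?N = h x0 \<and> k div w mod ?N = r x0 then v $ (x0 * w + k mod w) else 0)"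
    using x0 by (simp add: sum.delta)
  finally show ?thesis by (simp add: Let_def x0_def)
qed

section \<open>The lower bound\<close>

lemma norm_avg_over_le:
  assumes "finite H" "H \<noteq> {}" "\<And>h. h \<in> H \<Longrightarrow> norm (F h) \<le> c"
  shows "norm (avg_over H F) \<le> c"
proof -
  have "norm (avg_over H F) \<le> avg_over H (\<lambda>h. norm (F h))" by (rule norm_avg_over)
  also have "\<dots> \<le> avg_over H (\<lambda>h. c)" by (rule avg_over_mono) (rule assms(3))
  finally show ?thesis using assms(1,2) by (simp add: avg_over_const)
qed

lemma injs_shift_pairs [simp]: "finite (injs n (shift_pairs n s))" "injs n (shift_pairs n s) \<noteq> {}"
  by (simp_all add: shift_pairs_finite(1) injs_nonempty[OF shift_pairs_finite])

lemma simon_avg_diff: "simon_avg n F - simon_avg n G = simon_avg n (\<lambda>h. F h - G h)"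
  by (simp add: simon_avg_def avg_over_diff)

lemma norm_simon_avg_le:
  assumes "n \<ge> 1" "\<And>h. h \<in> bits n \<rightarrow> bits n \<Longrightarrow> norm (F h) \<le> c"
  shows "norm (simon_avg n F) \<le> c"
  unfolding simon_avg_def
  by (intro norm_avg_over_le nonzero_bits_nonempty assms simon_fun_bits) auto

lemma Re_avg_over: "Re (avg_over H F) = avg_over H (\<lambda>h. Re (F h))"
  by (simp add: avg_over_def)

lemma Re_simon_avg: "Re (simon_avg n F) = simon_avg n (\<lambda>h. Re (F h))"
  by (simp add: simon_avg_def Re_avg_over)

lemma set_perm_dist: "set_pmf (perm_dist n) = perms n"
  using perms_nonempty[of n] finite_perms[of n] by (simp add: perm_dist_def perms_def[symmetric])

lemma set_simon_dist:
  assumes "n \<ge> 1"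
  shows "set_pmf (simon_dist n) \<subseteq> bits n \<rightarrow> bits n"
proof -
  have eq: "set_pmf (simon_dist n) = (\<Union>s\<in>bits n - {0}. simon_fun n s ` injs n (shift_pairs n s))"
    using nonzero_bits_nonempty[OF assms] injs_shift_pairs[of n]
    by (simp add: simon_dist_def injs_def[symmetric] simon_fun_def[symmetric, abs_def]) (auto simp: simon_fun_def)
  show ?thesis
  proof
    fix h assume "h \<in> set_pmf (simon_dist n)"
    then obtain s l where "h = simon_fun n s l" "l \<in> injs n (shift_pairs n s)"
      using eq by blast
    then show "h \<in> bits n \<rightarrow> bits n" by (simp only: simon_fun_bits)
  qed
qed

lemma set_perm_dist_bits: "set_pmf (perm_dist n) \<subseteq> bits n \<rightarrow> bits n"
  using perms_bits by (auto simp: set_perm_dist)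

lemma average_state_carrier [simp]: "average_state n D Q S \<in> carrier_mat (final_dim S) (final_dim S)"
  by (simp add: average_state_def)

lemma mat_trace_mult_minus:
  assumes "M \<in> carrier_mat m m" "A \<in> carrier_mat m m" "B \<in> carrier_mat m m"
  shows "mat_trace (M * (A - B)) = mat_trace (M * A) - mat_trace (M * B)"
proof -
  have "M * (A - B) = M * A - M * B" using assms by (rule mult_minus_distrib_mat)
  then show ?thesis using assms by (simp add: mat_trace_def sum_subtractf)
qed

locale erasing_strategy =
  fixes n :: nat and S :: strategy
  assumes n: "n \<ge> 1" and S: "valid_strategy (2 ^ n) (2 ^ (3 * n)) S"
begin

abbreviation erase_map :: "(nat \<Rightarrow> nat) \<Rightarrow> (nat \<Rightarrow> nat) \<Rightarrow> complex mat" where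
  "erase_map \<equiv> garbage_erasing_oracle n"

sublocale erasing_walk "2 ^ n" "queries S" "iso S" "work S" "target_dim (2 ^ n) S" "\<lambda>i. (iso S 0 *\<^sub>v init_state S) $ i"
  by (rule valid_strategy_walk[OF S])

text \<open>Links the matrix semantics to the recursion \<open>run\<close>, in which the tag table
  is an explicit variable that can be averaged over.\<close>

lemma state_after_run:
  assumes h: "\<And>x. x < 2 ^ n \<Longrightarrow> h x < 2 ^ n" and r: "\<And>x. x < 2 ^ n \<Longrightarrow> r x < 2 ^ n"
  shows "t \<le> queries S \<Longrightarrow> state_after (erase_map h r) S t = vec (target_dim (2 ^ n) S t)
    (run h t r)"
proof (induction t)
  case 0
  have "dim_row (iso S 0) = target_dim (2 ^ n) S 0" using S by (auto simp: valid_strategy_def)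
  then show ?case by (intro eq_vecI) (simp_all)
next
  case (Suc t)
  let ?Q = "erase_map h r" and ?w = "work S t"
  let ?v = "state_after ?Q S t" and ?u = "kron ?Q (1\<^sub>m ?w) *\<^sub>v state_after ?Q S t"
  have t: "t < queries S" using Suc.prems by simp
  have N3: "(2 :: nat) ^ (3 * n) = 2 ^ n * 2 ^ n * 2 ^ n"
    by (simp flip: power_add)
  have v: "?v = vec (2 ^ n * ?w) (run h t r)" using Suc.IH t by (simp add: d[OF t])
  have u: "?u $ k = (if out_y t k = h (out_x t k) then tag_hit (out_x t k) (out_z t k) (\<lambda>r. run h t r (in_index t k)) r else 0)"
    if k: "k < 2 ^ n * 2 ^ n * 2 ^ n * ?w" for k
  proof -
    have w: "?w > 0" using k by (cases ?w) auto
    have "in_index t k < 2 ^ n * ?w"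
      using w unfolding in_index_def by (intro less_mult_combine) simp_all
    then have vi: "?v $ in_index t k = run h t r (in_index t k)" unfolding v by simp
    have "?v \<in> carrier_vec (2 ^ n * ?w)" unfolding v by simp
    from kron_erasing_oracle_vec[where h = h and r = r, OF h r this, of k] k
    have "?u $ k = (if out_y t k = h (out_x t k) \<and> out_z t k = r (out_x t k) then ?v $ in_index t k else 0)"
      by (simp only: Let_def out_x_def out_y_def out_z_def in_index_def N3)
    then show ?thesis by (auto simp: vi tag_hit_def)
  qed
  show ?case
  proof (rule eq_vecI)
    fix i assume "i < dim_vec (vec (target_dim (2 ^ n) S (Suc t)) (run h (Suc t) r))"
    then have i: "i < target_dim (2 ^ n) S (Suc t)" by simp
    have "state_after ?Q S (Suc t) $ i = (\<Sum>k<dim_col (iso S (Suc t)). iso S (Suc t) $$ (i, k) * ?u $ k)"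
      using i V[OF t] by (simp add: mat_vec_index N3)
    also have "\<dots> = run h (Suc t) r i"
      using V[OF t] by (auto simp: mat_apply_def u intro!: sum.cong)
    finally show "state_after ?Q S (Suc t) $ i = vec (target_dim (2 ^ n) S (Suc t)) (run h (Suc t) r) $ i"
      using i by simp
  qed (use V[OF t] in simp)
qed

lemma target_dim_final: "target_dim (2 ^ n) S (queries S) = final_dim S"
  by (simp add: target_dim_def)

lemma tags_eq: "tags = tag_tables n"
  by (simp add: tags_def bits_def)

lemma bits_Pi_less: "h \<in> bits n \<rightarrow> bits n \<Longrightarrow> x < 2 ^ n \<Longrightarrow> h x < 2 ^ n"
  by (auto simp: bits_def)

lemma state_after_final:
  assumes "h \<in> bits n \<rightarrow> bits n" "r \<in> tags"
  shows "state_after (erase_map h r) S (queries S) = vec (final_dim S) (run h (queries S) r)"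
  using state_after_run[of h r "queries S"] assms bits_Pi_less tags_less[OF assms(2)]
  by (simp add: target_dim_final)

lemma average_trace:
  assumes D: "finite (set_pmf D)" "set_pmf D \<subseteq> bits n \<rightarrow> bits n"
    and M: "M \<in> carrier_mat (final_dim S) (final_dim S)"
  shows "mat_trace (M * average_state n D erase_map S)
    = measure_pmf.expectation D (\<lambda>h. form M (run h (queries S)) (run h (queries S)))"
proof -
  let ?T = "queries S"
  have "mat_trace (M * final_state (erase_map h r) S)
      = (\<Sum>i<final_dim S. mat_apply M (run h ?T r) i * cnj (run h ?T r i))" if "h \<in> set_pmf D" "r \<in> tags" for h r
  proof -
    have "h \<in> bits n \<rightarrow> bits n" using D that by auto
    then show ?thesis
      using M by (simp add: final_state_def state_after_final[OF _ that(2)] trace_pure_density cscalar_prod_sum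
          mat_vec_index mat_apply_def)
  qed
  then have "avg_over (tag_tables n) (\<lambda>r. mat_trace (M * final_state (erase_map h r) S))
      = form M (run h ?T) (run h ?T)" if "h \<in> set_pmf D" for h
    using that by (simp add: form_def avg_over_def target_dim_final flip: tags_eq)
  moreover have "mat_trace (M * average_state n D erase_map S)
      = measure_pmf.expectation D (\<lambda>h. avg_over (tag_tables n) (\<lambda>r. mat_trace (M * final_state (erase_map h r) S)))"
    by (rule trace_average_state[OF D(1) M]) (use D state_after_final in \<open>auto simp: tags_eq\<close>)
  ultimately show ?thesis
    by (simp cong: integral_cong_AE add: AE_measure_pmf_iff) (intro integral_cong_AE AE_pmfI; simp)
qed

abbreviation difference :: "complex mat" where
  "difference \<equiv> average_state n (perm_dist n) erase_map S
              - average_state n (simon_dist n) erase_map S"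

text \<open>Replacing the run by its kept part costs \<open>2 * T / sqrt (2 ^ n)\<close> under each
  of the two distributions, hence the coefficient 4. The kept parts are compared by
  \<open>simon_gap\<close>, whose factor \<open>q\<close> is at most 1.\<close>

lemma distinguishing_bound:
  assumes W: "isometry_mat W" "W \<in> carrier_mat (final_dim S) (final_dim S)"
  defines "T \<equiv> real (queries S)"
  shows "cmod (mat_trace (W * difference))
    \<le> T * (T - 1) / (2 ^ n - 1) + 4 * T / sqrt (2 ^ n)"
proof -
  let ?T = "queries S"
  define R where "R h = form W (run h ?T) (run h ?T)" for h
  define G where "G h = form W (good h ?T) (good h ?T)" for h
  define g where "g h A = form W (comp h ?T A) (comp h ?T A)" for h A
  define m where "m h A = norm2 ?T (comp h ?T A)" for h A
  define q :: real where "q = (1 - 1 / 2 ^ n) ^ ?T"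
  have W': "W \<in> carrier_mat (target_dim (2 ^ n) S ?T) (target_dim (2 ^ n) S ?T)"
    using W by (simp add: target_dim_final)
  have GA: "G h = (\<Sum>A\<in>Pow (bits n). g h A)" for h
    using form_good_comp[of W h] by (simp add: G_def g_def bits_def)
  have RG: "cmod (R h - G h) \<le> 2 * T / sqrt (2 ^ n)" if "h \<in> bits n \<rightarrow> bits n" for h
    using form_run_good[OF W(1) W', of h] bits_Pi_less[OF that] by (simp add: R_def G_def T_def)
  have gap: "cmod (avg_over (perms n) G - simon_avg n G) \<le> q * (T * (T - 1) / (2 ^ n - 1))"
    unfolding GA[abs_def] T_def
  proof (rule simon_gap[OF n, where m = m])
    show "g h A = g h' A" "m h A = m h' A" if "\<And>x. x \<in> A \<Longrightarrow> h x = h' x" for A h h'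
      using comp_cong[of A h h' ?T] that by (simp_all add: g_def m_def)
    show "cmod (g h A) \<le> m h A" for h A
      unfolding g_def m_def by (rule form_comp_bound[OF W(1) W'])
    show "(\<Sum>A\<in>Pow (bits n). m h A) = q" if "h \<in> bits n \<rightarrow> bits n" for h
      using sum_norm2_comp[of h] bits_Pi_less[OF that] by (simp add: m_def q_def bits_def)
    show "m h A = 0" if "card A > ?T" for h A
      unfolding m_def by (rule norm2_comp_zero[OF that])
  qed
  have T0: "T * (T - 1) / (2 ^ n - 1) \<ge> 0"
  proof -
    have "T * (T - 1) \<ge> 0" unfolding T_def by (cases ?T) auto
    then show ?thesis by simp
  qed
  have "q \<le> 1" by (simp add: q_def power_le_one)
  then have gap': "cmod (avg_over (perms n) G - simon_avg n G) \<le> T * (T - 1) / (2 ^ n - 1)"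
    using gap T0 mult_right_mono[of q 1 "T * (T - 1) / (2 ^ n - 1)"] by linarith
  have p: "cmod (avg_over (perms n) (\<lambda>h. R h - G h)) \<le> 2 * T / sqrt (2 ^ n)"
    by (rule norm_avg_over_le) (use perms_nonempty RG perms_bits in auto)
  have s: "cmod (simon_avg n (\<lambda>h. R h - G h)) \<le> 2 * T / sqrt (2 ^ n)"
    by (rule norm_simon_avg_le[OF n RG])
  have "mat_trace (W * difference)
      = avg_over (perms n) R - simon_avg n R"
    using W(2)
    by (simp add: mat_trace_mult_minus[of _ "final_dim S"] average_trace expectation_perm_dist set_perm_dist_bits
        expectation_simon_dist[OF n] set_simon_dist[OF n] R_def[abs_def])
  also have "\<dots> = avg_over (perms n) (\<lambda>h. R h - G h) + (avg_over (perms n) G - simon_avg n G) - simon_avg n (\<lambda>h. R h - G h)"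
    by (simp flip: avg_over_diff simon_avg_diff)
  also have "cmod \<dots> \<le> cmod (avg_over (perms n) (\<lambda>h. R h - G h)) + cmod (avg_over (perms n) G - simon_avg n G)
      + cmod (simon_avg n (\<lambda>h. R h - G h))"
    by (intro order_trans[OF norm_triangle_ineq4] add_mono norm_triangle_ineq order_refl)
  finally show ?thesis using p s gap' by simp
qed

lemma average_state_hermitian_entry:
  assumes D: "set_pmf D \<subseteq> bits n \<rightarrow> bits n" and ij: "i < final_dim S" "j < final_dim S"
  shows "cnj (average_state n D erase_map S $$ (j, i)) = average_state n D erase_map S $$ (i, j)"
proof -
  have "cnj (final_state (erase_map h r) S $$ (j, i)) = final_state (erase_map h r) S $$ (i, j)"
    if "(h, r) \<in> set_pmf (pair_pmf D (tag_dist n))" for h r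
  proof -
    have "h \<in> bits n \<rightarrow> bits n" "r \<in> tags"
      using that D tag_tables_nonempty[of n] by (auto simp: tag_dist_def tags_eq)
    then show ?thesis using ij by (simp add: final_state_def pure_density_def state_after_final)
  qed
  then have "measure_pmf.expectation (pair_pmf D (tag_dist n)) (\<lambda>(h, r). cnj (final_state (erase_map h r) S $$ (j, i)))
      = measure_pmf.expectation (pair_pmf D (tag_dist n)) (\<lambda>(h, r). final_state (erase_map h r) S $$ (i, j))"
    by (intro integral_cong_AE AE_pmfI) auto
  then show ?thesis
    using ij Bochner_Integration.integral_cnj[of "measure_pmf (pair_pmf D (tag_dist n))" "\<lambda>(h, r). final_state (erase_map h r) S $$ (j, i)"]
    by (simp add: average_state_def split_def)
qed

lemma difference_hermitian: "hermitian_mat difference" "difference \<in> carrier_mat (final_dim S) (final_dim S)"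
proof -
  show c: "difference \<in> carrier_mat (final_dim S) (final_dim S)"
    by (rule minus_carrier_mat[OF average_state_carrier])
  have dim: "dim_row (average_state n D Q S) = final_dim S" "dim_col (average_state n D Q S) = final_dim S" for D Q
    by (simp_all add: average_state_def)
  show "hermitian_mat difference"
    by (rule hermitian_matI[OF c])
       (simp add: dim average_state_hermitian_entry set_perm_dist_bits set_simon_dist[OF n])
qed

lemma trace_norm_difference:
  defines "T \<equiv> real (queries S)"
  shows "trace_norm difference \<le> T * (T - 1) / (2 ^ n - 1) + 4 * T / sqrt (2 ^ n)"
proof -
  obtain W where W: "W \<in> carrier_mat (final_dim S) (final_dim S)" "isometry_mat W"
    and tn: "trace_norm difference = Re (mat_trace (W * difference))"
    using trace_norm_attained[OF difference_hermitian] .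
  have "Re (mat_trace (W * difference)) \<le> cmod (mat_trace (W * difference))" by (rule complex_Re_le_cmod)
  also have "\<dots> \<le> T * (T - 1) / (2 ^ n - 1) + 4 * T / sqrt (2 ^ n)"
    unfolding T_def by (rule distinguishing_bound[OF W(2,1)])
  finally show ?thesis by (simp add: tn)
qed

lemma form_one: "form (1\<^sub>m (final_dim S)) f f = of_real (norm2 (queries S) f)"
proof -
  have "mat_apply (1\<^sub>m (final_dim S)) f i = f i" if "i < final_dim S" for f i
    using that by (simp add: mat_apply_def if_distrib[of "\<lambda>x. x * _"] sum.delta cong: if_cong)
  then show ?thesis
    by (simp add: form_def norm2_def target_dim_final complex_norm_square del: of_real_power)
qed

end

text \<open>Consider the bias, the probability of YES minus that of NO, averaged over the tags. It
  is at most \<open>- 1 / 3\<close> on permutations and at least \<open>1 / 3\<close> on Simon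
  functions, so its averages are \<open>2 / 3\<close> apart, and the trace norm bounds this
  distance.\<close>

lemma erasing_lower_bound:
  assumes n: "n \<ge> 1" and A: "erasing_algorithm n A"
  shows "real (queries A) > sqrt (2 ^ n) / 16"
proof (rule ccontr)
  let ?S = "strategy.truncate A" and ?Q = "garbage_erasing_oracle n"
  assume "\<not> real (queries A) > sqrt (2 ^ n) / 16"
  then have small: "real (queries A) \<le> sqrt (2 ^ n) / 16" by simp
  have S: "valid_strategy (2 ^ n) (2 ^ (3 * n)) ?S"
    and psd: "\<And>c. psd (final_dim A) (effect A c)"
    and one: "effect A True + effect A False = 1\<^sub>m (final_dim A)"
    and err: "bounded_error n ?Q A"
    using A by (auto simp: erasing_algorithm_def valid_algorithm_def)
  interpret erasing_strategy n ?S using n S by unfold_locales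
  have fd: "final_dim ?S = final_dim A" and qS: "queries ?S = queries A"
    by (simp_all add: strategy.truncate_def)
  let ?E = "effect A"
  have E: "?E c \<in> carrier_mat (final_dim ?S) (final_dim ?S)" for c
    using psd[of c] by (simp add: psd_def fd)
  define a where "a c h = Re (form (?E c) (run h (queries ?S)) (run h (queries ?S)))" for c h
  have a_sum: "a True h + a False h = 1" if h: "h \<in> bits n \<rightarrow> bits n" for h
  proof -
    have "mat_apply (?E True) f i + mat_apply (?E False) f i = mat_apply (1\<^sub>m (final_dim ?S)) f i"
      if "i < final_dim ?S" for f i
      using that E[of True] E[of False] arg_cong[OF one, of "\<lambda>M. M $$ (i, _)"]
      by (simp add: mat_apply_def fd flip: sum.distrib distrib_right one)
    then have "form (?E True) f f + form (?E False) f f = form (1\<^sub>m (final_dim ?S)) f f" for f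
      by (simp add: form_def target_dim_final flip: add_divide_distrib sum.distrib distrib_right)
    then have "a True h + a False h = Re (form (1\<^sub>m (final_dim ?S)) (run h (queries ?S)) (run h (queries ?S)))"
      by (simp only: a_def plus_complex.simps(1)[symmetric])
    then show ?thesis
      using norm2_run[of h "queries ?S"] bits_Pi_less[OF h] by (simp add: form_one)
  qed
  have prob: "a c h = avg_over tags (\<lambda>r. outcome_prob (?Q h r) A c)" if h: "h \<in> bits n \<rightarrow> bits n" for c h
  proof -
    have "outcome_prob (?Q h r) A c = Re (\<Sum>i<final_dim ?S. mat_apply (?E c) (run h (queries ?S) r) i * cnj (run h (queries ?S) r i))"
      if "r \<in> tags" for r
      using E[of c] by (simp add: outcome_prob_def final_state_def state_after_final[OF h that] trace_pure_density cscalar_prod_sum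
          mat_vec_index mat_apply_def Re_sum)
    then show ?thesis
      by (simp add: a_def form_def avg_over_def target_dim_final del: Re_sum flip: Re_sum)
  qed
  have ge: "a c h \<ge> 2 / 3" if h: "h \<in> bits n \<rightarrow> bits n" and "\<And>r. r \<in> bits n \<rightarrow> bits n \<Longrightarrow> outcome_prob (?Q h r) A c \<ge> 2 / 3" for c h
  proof -
    have "avg_over tags (\<lambda>r. 2 / 3) \<le> avg_over tags (\<lambda>r. outcome_prob (?Q h r) A c)"
      by (rule avg_over_mono) (use that in \<open>auto simp: tags_eq\<close>)
    moreover have "avg_over tags (\<lambda>r. 2 / 3 :: real) = 2 / 3"
      by (rule avg_over_const) (use tag_tables_nonempty in \<open>auto simp: tags_eq\<close>)
    ultimately show ?thesis by (simp add: prob[OF h])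
  qed
  define f where "f h = a True h - a False h" for h
  have f0: "f h \<le> - 1 / 3" if "h \<in> perms n" for h
  proof -
    have h: "h \<in> bits n \<rightarrow> bits n" using that by (rule perms_bits)
    have "a False h \<ge> 2 / 3"
      by (rule ge[OF h]) (use err h that in \<open>auto simp: bounded_error_def perms_def\<close>)
    then show ?thesis using a_sum[OF h] by (simp add: f_def)
  qed
  have f1: "f (simon_fun n s l) \<ge> 1 / 3" if s: "s \<in> bits n - {0}" and l: "l \<in> injs n (shift_pairs n s)" for s l
  proof -
    let ?h = "simon_fun n s l"
    have h: "?h \<in> bits n \<rightarrow> bits n" using l by (rule simon_fun_bits)
    have "simon_function n s ?h" using simon_fun_simon[OF l] s by simp
    then have "a True ?h \<ge> 2 / 3"
      by (intro ge[OF h]) (use err h s in \<open>auto simp: bounded_error_def\<close>)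
    then show ?thesis using a_sum[OF h] by (simp add: f_def)
  qed
  have av0: "avg_over (perms n) f \<le> - 1 / 3"
  proof -
    have "avg_over (perms n) f \<le> avg_over (perms n) (\<lambda>h. - 1 / 3)" by (rule avg_over_mono) (rule f0)
    also have "\<dots> = - 1 / 3" by (rule avg_over_const) (use perms_nonempty in auto)
    finally show ?thesis .
  qed
  have av1: "simon_avg n f \<ge> 1 / 3"
  proof -
    have "1 / 3 = avg_over (bits n - {0}) (\<lambda>s. avg_over (injs n (shift_pairs n s)) (\<lambda>l. 1 / 3 :: real))"
      using nonzero_bits_nonempty[OF n] by (simp add: avg_over_const)
    also have "\<dots> \<le> simon_avg n f" unfolding simon_avg_def by (intro avg_over_mono f1)
    finally show ?thesis .
  qed
  have tr: "Re (mat_trace (?E c * difference)) = avg_over (perms n) (a c) - simon_avg n (a c)" for c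
    using E[of c]
    by (simp add: mat_trace_mult_minus[of _ "final_dim ?S"] average_trace expectation_perm_dist set_perm_dist_bits
        expectation_simon_dist[OF n] set_simon_dist[OF n] a_def[abs_def] Re_avg_over Re_simon_avg)
  have "Re (mat_trace (?E True * difference)) - Re (mat_trace (?E False * difference)) = avg_over (perms n) f - simon_avg n f"
    by (simp add: tr f_def[abs_def] flip: avg_over_diff simon_avg_diff)
  then have "2 / 3 \<le> \<bar>Re (mat_trace (?E True * difference)) - Re (mat_trace (?E False * difference))\<bar>"
    using av0 av1 by linarith
  also have "\<dots> \<le> trace_norm difference"
    by (rule effect_difference_le_trace_norm[OF difference_hermitian]) (use psd one in \<open>auto simp: fd\<close>)
  also have "\<dots> \<le> real (queries A) * (real (queries A) - 1) / (2 ^ n - 1) + 4 * real (queries A) / sqrt (2 ^ n)"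
    using trace_norm_difference by (simp add: qS)
  also have "\<dots> < 2 / 3"
  proof -
    define T where "T = real (queries A)"
    define N :: real where "N = 2 ^ n"
    have N: "N \<ge> 2" using n power_increasing[of 1 n "2 :: real"] by (simp add: N_def)
    have T: "0 \<le> T" "T \<le> sqrt N / 16" using small by (auto simp: T_def N_def)
    \<comment> \<open>The constant 16 makes the two terms at most \<open>1 / 128\<close>, where
      \<open>N \<ge> 2\<close> enters, and \<open>1 / 4\<close>.\<close>
    have "T * T \<le> (sqrt N / 16) * (sqrt N / 16)" using T N by (intro mult_mono) auto
    also have "\<dots> = N / 256" using N by simp
    finally have "T * (T - 1) \<le> N / 256" using T by (simp add: algebra_simps)
    also have "\<dots> \<le> (N - 1) * (1 / 128)" using N by simp
    finally have "T * (T - 1) / (N - 1) \<le> 1 / 128" using N by (simp add: divide_simps)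
    moreover have "4 * T / sqrt N \<le> 1 / 4"
    proof -
      have "0 < sqrt N" using N by simp
      then show ?thesis using T by (simp add: divide_le_eq)
    qed
    ultimately have "T * (T - 1) / (N - 1) + 4 * T / sqrt N < 2 / 3" by linarith
    then show ?thesis by (simp only: T_def N_def)
  qed
  finally show False by simp
qed

section \<open>Nonadaptive algorithms\<close>

definition kvec :: "complex vec \<Rightarrow> complex vec \<Rightarrow> complex vec" where
  "kvec u v = vec (dim_vec u * dim_vec v) (\<lambda>i. u $ (i div dim_vec v) * v $ (i mod dim_vec v))"

lemma kvec_dim [simp]: "dim_vec (kvec u v) = dim_vec u * dim_vec v"
  by (simp add: kvec_def)

lemma kvec_index: "i < dim_vec u \<Longrightarrow> j < dim_vec v \<Longrightarrow> kvec u v $ (i * dim_vec v + j) = u $ i * v $ j"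
  by (simp add: kvec_def less_mult_combine)

lemma kron_index:
  assumes "i < dim_row A * dim_row B" "j < dim_col A * dim_col B"
  shows "kron A B $$ (i, j) = A $$ (i div dim_row B, j div dim_col B) * B $$ (i mod dim_row B, j mod dim_col B)"
  using assms by (simp add: kron_def)

lemma kron_index_combine:
  assumes "i < dim_row A" "i' < dim_row B" "j < dim_col A" "j' < dim_col B"
  shows "kron A B $$ (i * dim_row B + i', j * dim_col B + j') = A $$ (i, j) * B $$ (i', j')"
  using assms by (simp add: kron_index less_mult_combine)

lemma kron_mult_kvec:
  assumes "dim_col A = dim_vec u" "dim_col B = dim_vec v"
  shows "kron A B *\<^sub>v kvec u v = kvec (A *\<^sub>v u) (B *\<^sub>v v)"
proof (rule eq_vecI)
  fix i assume "i < dim_vec (kvec (A *\<^sub>v u) (B *\<^sub>v v))"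
  then have i: "i < dim_row A * dim_row B" by simp
  note im = less_mult_divmod[OF i]
  have "(kron A B *\<^sub>v kvec u v) $ i
      = (\<Sum>k<dim_vec u. \<Sum>l<dim_vec v. kron A B $$ (i, k * dim_vec v + l) * kvec u v $ (k * dim_vec v + l))"
    using i assms by (simp add: mat_vec_index sum_lessThan_mult)
  also have "\<dots> = (\<Sum>k<dim_vec u. \<Sum>l<dim_vec v. (A $$ (i div dim_row B, k) * u $ k) * (B $$ (i mod dim_row B, l) * v $ l))"
    using i assms by (intro sum.cong[OF refl]) (simp add: kron_index kvec_index less_mult_combine)
  also have "\<dots> = (A *\<^sub>v u) $ (i div dim_row B) * (B *\<^sub>v v) $ (i mod dim_row B)"
    using im assms by (simp add: mat_vec_index sum_product)
  finally show "(kron A B *\<^sub>v kvec u v) $ i = kvec (A *\<^sub>v u) (B *\<^sub>v v) $ i"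
    using i by (simp add: kvec_def)
qed simp

lemma kvec_cscalar_prod:
  assumes "dim_vec u = dim_vec u'" "dim_vec v = dim_vec v'"
  shows "kvec u v \<bullet>c kvec u' v' = (u \<bullet>c u') * (v \<bullet>c v')"
proof -
  have "kvec u v \<bullet>c kvec u' v' = (\<Sum>k<dim_vec u'. \<Sum>l<dim_vec v'. (u $ k * cnj (u' $ k)) * (v $ l * cnj (v' $ l)))"
    using assms kvec_index[of _ u _ v] kvec_index[of _ u' _ v']
    by (simp add: cscalar_prod_sum sum_lessThan_mult mult.assoc mult.left_commute)
  then show ?thesis using assms by (simp add: cscalar_prod_sum sum_product)
qed

lemma kron_mult_kron:
  assumes "dim_col A = dim_row C" "dim_col B = dim_row D"
  shows "kron A B * kron C D = kron (A * C) (B * D)"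
proof (rule eq_matI)
  fix i j assume "i < dim_row (kron (A * C) (B * D))" "j < dim_col (kron (A * C) (B * D))"
  then have i: "i < dim_row A * dim_row B" and j: "j < dim_col C * dim_col D" by simp_all
  note im = less_mult_divmod[OF i] and jm = less_mult_divmod[OF j]
  have "(kron A B * kron C D) $$ (i, j)
      = (\<Sum>k<dim_col A. \<Sum>l<dim_col B. kron A B $$ (i, k * dim_col B + l) * kron C D $$ (k * dim_col B + l, j))"
    using i j assms by (simp add: mat_mult_index sum_lessThan_mult)
  also have "\<dots> = (\<Sum>k<dim_col A. \<Sum>l<dim_col B. (A $$ (i div dim_row B, k) * C $$ (k, j div dim_col D))
      * (B $$ (i mod dim_row B, l) * D $$ (l, j mod dim_col D)))"
    using i j assms less_mult_combine[of _ "dim_row C" _ "dim_row D"]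
    by (intro sum.cong[OF refl]) (simp add: kron_index)
  also have "\<dots> = (A * C) $$ (i div dim_row B, j div dim_col D) * (B * D) $$ (i mod dim_row B, j mod dim_col D)"
    using im jm assms by (simp add: mat_mult_index sum_product)
  finally show "(kron A B * kron C D) $$ (i, j) = kron (A * C) (B * D) $$ (i, j)"
    using i j by (simp add: kron_index)
qed simp_all

lemma kron_adjoint: "mat_adjoint (kron A B) = kron (mat_adjoint A) (mat_adjoint B)"
  by (rule eq_matI) (simp_all add: kron_index less_mult_divmod)

lemma kron_one: "kron (1\<^sub>m a) (1\<^sub>m b) = 1\<^sub>m (a * b)"
proof (rule eq_matI)
  fix i j assume "i < dim_row (1\<^sub>m (a * b) :: complex mat)" "j < dim_col (1\<^sub>m (a * b) :: complex mat)"
  then have "i < a * b" "j < a * b" by auto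
  then show "kron (1\<^sub>m a) (1\<^sub>m b) $$ (i, j) = 1\<^sub>m (a * b) $$ (i, j)"
    using less_mult_divmod[of i a b] less_mult_divmod[of j a b]
    by (auto simp: kron_index) (metis div_mult_mod_eq)
qed simp_all

text \<open>As a matrix with one column a state yields the isometry
  \<open>kron (col_mat u) (1\<^sub>m d)\<close>, which attaches a fresh register in state
  \<open>u\<close>.\<close>

definition col_mat :: "complex vec \<Rightarrow> complex mat" where
  "col_mat u = mat (dim_vec u) 1 (\<lambda>(i, _). u $ i)"

lemma col_mat_dim [simp]: "dim_row (col_mat u) = dim_vec u" "dim_col (col_mat u) = 1"
  by (simp_all add: col_mat_def)

lemma kron_col_mat_vec:
  assumes "dim_vec v = d"
  shows "kron (col_mat u) (1\<^sub>m d) *\<^sub>v v = kvec u v"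
proof -
  have v: "kvec (vec 1 (\<lambda>_. 1)) v = v"
    by (rule eq_vecI) (simp_all add: kvec_def)
  have "kron (col_mat u) (1\<^sub>m d) *\<^sub>v kvec (vec 1 (\<lambda>_. 1)) v = kvec (col_mat u *\<^sub>v vec 1 (\<lambda>_. 1)) (1\<^sub>m d *\<^sub>v v)"
    using assms by (intro kron_mult_kvec) simp_all
  also have "col_mat u *\<^sub>v vec 1 (\<lambda>_. 1) = u"
    by (rule eq_vecI) (simp_all add: mat_vec_index col_mat_def)
  also have "1\<^sub>m d *\<^sub>v v = v" using assms by (intro one_mult_mat_vec carrier_vecI)
  finally show ?thesis by (simp only: v)
qed

lemma kron_col_mat_isometry:
  assumes "u \<bullet>c u = 1"
  shows "isometry_mat (kron (col_mat u) (1\<^sub>m d))"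
proof -
  have "mat_adjoint (col_mat u) * col_mat u = 1\<^sub>m 1"
    using assms by (intro eq_matI) (auto simp: mat_mult_index cscalar_prod_sum col_mat_def mult.commute)
  then show ?thesis
    by (simp add: isometry_mat_def kron_adjoint kron_mult_kron kron_one)
qed

section \<open>Projections and product measurements\<close>

definition projection_mat :: "complex mat \<Rightarrow> bool" where
  "projection_mat P \<longleftrightarrow> mat_adjoint P = P \<and> P * P = P"

lemma projection_pure_density:
  assumes "v \<bullet>c v = 1"
  shows "projection_mat (pure_density v)"
  unfolding projection_mat_def
proof
  show "mat_adjoint (pure_density v) = pure_density v"
    by (rule eq_matI) (auto simp: pure_density_def)
  show "pure_density v * pure_density v = pure_density v"
  proof (rule eq_matI)
    fix i j assume "i < dim_row (pure_density v)" "j < dim_col (pure_density v)"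
    then have ij: "i < dim_vec v" "j < dim_vec v" by simp_all
    have "(pure_density v * pure_density v) $$ (i, j)
        = (\<Sum>k<dim_vec v. v $ i * cnj (v $ j) * (v $ k * cnj (v $ k)))"
      using ij by (subst mat_mult_index) (simp_all add: pure_density_def ac_simps)
    also have "\<dots> = v $ i * cnj (v $ j) * (v \<bullet>c v)"
      by (simp only: cscalar_prod_sum sum_distrib_left)
    finally show "(pure_density v * pure_density v) $$ (i, j) = pure_density v $$ (i, j)"
      using ij assms by (simp add: pure_density_def)
  qed simp_all
qed

lemma pure_density_form:
  assumes "dim_vec v = dim_vec u"
  shows "(pure_density u *\<^sub>v v) \<bullet>c v = (v \<bullet>c u) * cnj (v \<bullet>c u)"
proof -
  define c where "c = v \<bullet>c u"
  have "(pure_density u *\<^sub>v v) $ i = c * u $ i" if "i < dim_vec u" for i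
    using that assms by (simp add: c_def cscalar_prod_sum mat_vec_index pure_density_def sum_distrib_left ac_simps)
  then have "(pure_density u *\<^sub>v v) \<bullet>c v = c * (\<Sum>i<dim_vec u. u $ i * cnj (v $ i))"
    using assms by (simp add: cscalar_prod_sum sum_distrib_left mult.assoc)
  also have "(\<Sum>i<dim_vec u. u $ i * cnj (v $ i)) = cnj c"
    using assms by (simp add: c_def cscalar_prod_sum mult.commute)
  finally show ?thesis by (simp add: c_def)
qed

lemma projection_kron:
  assumes "projection_mat A" "projection_mat B"
  shows "projection_mat (kron A B)"
proof -
  have "dim_row A = dim_col A" "dim_row B = dim_col B"
    using assms mat_adjoint_dim unfolding projection_mat_def by metis+
  with assms show ?thesis by (simp add: projection_mat_def kron_adjoint kron_mult_kron)
qed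

lemma projection_form:
  assumes "projection_mat P" "P \<in> carrier_mat m m" "v \<in> carrier_vec m"
  shows "(P *\<^sub>v v) \<bullet>c v = (P *\<^sub>v v) \<bullet>c (P *\<^sub>v v)"
proof -
  have Pv: "P *\<^sub>v v \<in> carrier_vec m" using assms by (simp add: mult_mat_vec_carrier[of _ m m])
  have "(P *\<^sub>v v) \<bullet>c (P *\<^sub>v v) = (P *\<^sub>v (P *\<^sub>v v)) \<bullet>c v"
    using adjoint_swap[OF assms(2) Pv assms(3)] assms by (simp add: projection_mat_def)
  also have "P *\<^sub>v (P *\<^sub>v v) = P *\<^sub>v v"
    using assms by (simp add: projection_mat_def flip: assoc_mult_mat_vec[of P m m P m v])
  finally show ?thesis by simp
qed

fun tuple_projection :: "(nat \<Rightarrow> complex mat) \<Rightarrow> nat \<Rightarrow> (nat \<Rightarrow> nat) \<Rightarrow> complex mat" where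
  "tuple_projection e 0 ys = 1\<^sub>m 1"
| "tuple_projection e (Suc t) ys = kron (e (ys t)) (tuple_projection e t ys)"

fun product_state :: "complex mat \<Rightarrow> (nat \<Rightarrow> complex vec) \<Rightarrow> nat \<Rightarrow> complex vec" where
  "product_state Q \<xi> 0 = vec 1 (\<lambda>_. 1)"
| "product_state Q \<xi> (Suc t) = kvec (Q *\<^sub>v \<xi> t) (product_state Q \<xi> t)"

lemma sum_mat_form:
  fixes K :: "'b \<Rightarrow> complex mat"
  assumes v: "v \<in> carrier_vec m" and K: "\<And>a. a \<in> A \<Longrightarrow> K a \<in> carrier_mat m m"
  shows "(mat m m (\<lambda>ij. \<Sum>a\<in>A. K a $$ ij) *\<^sub>v v) \<bullet>c v = (\<Sum>a\<in>A. (K a *\<^sub>v v) \<bullet>c v)"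
proof -
  let ?f = "\<lambda>a i k. K a $$ (i, k) * v $ k * cnj (v $ i)"
  have "(mat m m (\<lambda>ij. \<Sum>a\<in>A. K a $$ ij) *\<^sub>v v) \<bullet>c v = (\<Sum>i<m. \<Sum>k<m. \<Sum>a\<in>A. ?f a i k)"
    using v by (simp add: cscalar_prod_sum mat_vec_index sum_distrib_right)
  also have "\<dots> = (\<Sum>i<m. \<Sum>a\<in>A. \<Sum>k<m. ?f a i k)" by (intro sum.cong[OF refl] sum.swap)
  also have "\<dots> = (\<Sum>a\<in>A. \<Sum>i<m. \<Sum>k<m. ?f a i k)" by (rule sum.swap)
  also have "\<dots> = (\<Sum>a\<in>A. (K a *\<^sub>v v) \<bullet>c v)"
  proof (rule sum.cong[OF refl])
    fix a assume "a \<in> A"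
    from K[OF this] v show "(\<Sum>i<m. \<Sum>k<m. ?f a i k) = (K a *\<^sub>v v) \<bullet>c v"
      by (simp add: cscalar_prod_sum mat_vec_index sum_distrib_right)
  qed
  finally show ?thesis .
qed

text \<open>The query inputs \<open>\<xi> t\<close> are fixed in advance, each answer register is
  measured by the complete family of projections \<open>e\<close>, and \<open>ans\<close> decides
  from the tuple of outcomes. Both upper bounds are instances.\<close>

locale nonadaptive =
  fixes a b T :: nat and \<xi> :: "nat \<Rightarrow> complex vec" and C :: "nat set" and e :: "nat \<Rightarrow> complex mat"
    and ans :: "(nat \<Rightarrow> nat) \<Rightarrow> bool"
  assumes T: "T \<ge> 1" and \<xi>: "t < T \<Longrightarrow> \<xi> t \<in> carrier_vec a" "t < T \<Longrightarrow> \<xi> t \<bullet>c \<xi> t = 1"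
    and C: "finite C" and e: "c \<in> C \<Longrightarrow> e c \<in> carrier_mat b b" "c \<in> C \<Longrightarrow> projection_mat (e c)"
    and e_sum: "i < b \<Longrightarrow> j < b \<Longrightarrow> (\<Sum>c\<in>C. e c $$ (i, j)) = (if i = j then 1 else 0)"
begin

abbreviation answers :: "(nat \<Rightarrow> nat) set" where
  "answers \<equiv> {..<T} \<rightarrow>\<^sub>E C"

definition alg :: algorithm where
  "alg = \<lparr>queries = T, init_state = vec 1 (\<lambda>_. 1), work = (\<lambda>t. b ^ t),
     iso = (\<lambda>t. if t < T then kron (col_mat (\<xi> t)) (1\<^sub>m (b ^ t)) else 1\<^sub>m (b ^ T)),
     final_dim = b ^ T,
     effect = (\<lambda>c. mat (b ^ T) (b ^ T) (\<lambda>ij. \<Sum>ys\<in>{ys \<in> answers. ans ys = c}. tuple_projection e T ys $$ ij))\<rparr>"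

lemma finite_answers [simp]: "finite answers"
  using C by (intro finite_PiE) auto

lemma queries_alg [simp]: "queries alg = T"
  by (simp add: alg_def)

lemma tuple_projection_carrier:
  "(\<And>s. s < t \<Longrightarrow> ys s \<in> C) \<Longrightarrow> tuple_projection e t ys \<in> carrier_mat (b ^ t) (b ^ t)"
proof (induction t)
  case (Suc t)
  then show ?case using e(1)[of "ys t"] by auto
qed simp

lemma tuple_projection_projection:
  "(\<And>s. s < t \<Longrightarrow> ys s \<in> C) \<Longrightarrow> projection_mat (tuple_projection e t ys)"
proof (induction t)
  case 0
  then show ?case by (simp add: projection_mat_def)
next
  case (Suc t)
  then show ?case by (auto intro!: projection_kron e)
qed

lemma tuple_projection_cong: "(\<And>s. s < t \<Longrightarrow> ys s = ys' s) \<Longrightarrow> tuple_projection e t ys = tuple_projection e t ys'"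
  by (induction t) auto

text \<open>Splitting off the last outcome factors the sum into two complete families, of dimensions
  \<open>b\<close> and \<open>b ^ t\<close>.\<close>

lemma tuple_projection_sum:
  "i < b ^ t \<Longrightarrow> j < b ^ t \<Longrightarrow>
   (\<Sum>ys\<in>{..<t} \<rightarrow>\<^sub>E C. tuple_projection e t ys $$ (i, j)) = (if i = j then 1 else 0)"
proof (induction t arbitrary: i j)
  case 0
  then show ?case by simp
next
  case (Suc t)
  let ?D = "{..<t} \<rightarrow>\<^sub>E C"
  have inj: "inj_on (\<lambda>(c, ys). ys(t := c)) (C \<times> ?D)"
    by (rule inj_combinator) simp
  have "({..<Suc t} \<rightarrow>\<^sub>E C) = (\<lambda>(c, ys). ys(t := c)) ` (C \<times> ?D)"
    using PiE_insert_eq[of t "{..<t}" "\<lambda>_. C"] by (simp add: lessThan_Suc)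
  then have "(\<Sum>ys\<in>{..<Suc t} \<rightarrow>\<^sub>E C. tuple_projection e (Suc t) ys $$ (i, j))
      = (\<Sum>ys\<in>(\<lambda>(c, ys). ys(t := c)) ` (C \<times> ?D). tuple_projection e (Suc t) ys $$ (i, j))"
    by (rule arg_cong)
  also have "\<dots>
      = (\<Sum>(c, ys)\<in>C \<times> ?D. tuple_projection e (Suc t) (ys(t := c)) $$ (i, j))"
    unfolding sum.reindex[OF inj] by (simp only: comp_def split_def)
  also have "\<dots> = (\<Sum>(c, ys)\<in>C \<times> ?D. e c $$ (i div b ^ t, j div b ^ t) * tuple_projection e t ys $$ (i mod b ^ t, j mod b ^ t))"
  proof (rule sum.cong[OF refl], clarify)
    fix c ys assume c: "c \<in> C" and ys: "ys \<in> ?D"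
    have "tuple_projection e t (ys(t := c)) = tuple_projection e t ys"
      by (rule tuple_projection_cong) simp
    moreover have "tuple_projection e t ys \<in> carrier_mat (b ^ t) (b ^ t)"
      using ys by (intro tuple_projection_carrier) auto
    ultimately show "tuple_projection e (Suc t) (ys(t := c)) $$ (i, j)
        = e c $$ (i div b ^ t, j div b ^ t) * tuple_projection e t ys $$ (i mod b ^ t, j mod b ^ t)"
      using Suc.prems e(1)[OF c] by (simp add: kron_index)
  qed
  also have "\<dots> = (\<Sum>c\<in>C. e c $$ (i div b ^ t, j div b ^ t)) * (\<Sum>ys\<in>?D. tuple_projection e t ys $$ (i mod b ^ t, j mod b ^ t))"
    by (simp add: sum_product sum.cartesian_product)
  also have "\<dots> = (if i div b ^ t = j div b ^ t then 1 else 0) * (if i mod b ^ t = j mod b ^ t then 1 else 0)"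
    using Suc.prems less_mult_divmod[of i b "b ^ t"] less_mult_divmod[of j b "b ^ t"]
    by (subst e_sum, simp_all add: Suc.IH)
  also have "\<dots> = (if i = j then 1 else 0)" by (auto) (metis div_mult_mod_eq)
  finally show ?case .
qed

lemma product_state_dim: "dim_row Q = b \<Longrightarrow> dim_vec (product_state Q \<xi> t) = b ^ t"
  by (induction t) simp_all

lemma tuple_projection_prob:
  assumes Q: "dim_row Q = b"
  shows "(\<And>s. s < t \<Longrightarrow> ys s \<in> C) \<Longrightarrow> (tuple_projection e t ys *\<^sub>v product_state Q \<xi> t) \<bullet>c product_state Q \<xi> t
    = (\<Prod>s<t. (e (ys s) *\<^sub>v (Q *\<^sub>v \<xi> s)) \<bullet>c (Q *\<^sub>v \<xi> s))"
proof (induction t)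
  case 0
  then show ?case by (simp add: cscalar_prod_sum)
next
  case (Suc t)
  have dims: "dim_col (e (ys t)) = b" "dim_row (e (ys t)) = b"
    using e(1)[of "ys t"] Suc.prems by auto
  have c: "tuple_projection e t ys \<in> carrier_mat (b ^ t) (b ^ t)"
    using Suc.prems by (intro tuple_projection_carrier) auto
  then show ?case using dims Q Suc product_state_dim[OF Q, of t]
    by (simp add: kron_mult_kvec kvec_cscalar_prod mult.commute del: mult_mat_vec_def)
qed

lemma truncate_alg:
  "queries (strategy.truncate alg) = T" "final_dim (strategy.truncate alg) = b ^ T"
  "work (strategy.truncate alg) = (\<lambda>t. b ^ t)" "init_state (strategy.truncate alg) = vec 1 (\<lambda>_. 1)"
  "iso (strategy.truncate alg) = (\<lambda>t. if t < T then kron (col_mat (\<xi> t)) (1\<^sub>m (b ^ t)) else 1\<^sub>m (b ^ T))"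
  by (simp_all add: alg_def strategy.truncate_def)

lemma effect_alg: "effect alg c = mat (b ^ T) (b ^ T) (\<lambda>ij. \<Sum>ys\<in>{ys \<in> answers. ans ys = c}. tuple_projection e T ys $$ ij)"
  by (simp add: alg_def)

lemma effect_form:
  assumes v: "v \<in> carrier_vec (b ^ T)"
  shows "(effect alg c *\<^sub>v v) \<bullet>c v = (\<Sum>ys\<in>{ys \<in> answers. ans ys = c}. (tuple_projection e T ys *\<^sub>v v) \<bullet>c v)"
  unfolding effect_alg by (rule sum_mat_form[OF v]) (auto intro!: tuple_projection_carrier)

lemma valid_alg: "valid_algorithm a b alg"
  unfolding valid_algorithm_def
proof (intro conjI allI)
  let ?S = "strategy.truncate alg"
  have src: "source_dim b ?S t = b ^ t" for t
    by (simp add: source_dim_def truncate_alg split: nat.splits)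
  show "valid_strategy a b ?S"
    unfolding valid_strategy_def
  proof (intro conjI allI impI)
    show "init_state ?S \<bullet>c init_state ?S = 1" by (simp add: truncate_alg cscalar_prod_sum)
    fix t assume "t \<le> queries ?S"
    then have t: "t \<le> T" by (simp add: truncate_alg)
    show "iso ?S t \<in> carrier_mat (target_dim a ?S t) (source_dim b ?S t)"
      using t \<xi>(1)[of t] by (auto simp: src target_dim_def truncate_alg)
    show "isometry_mat (iso ?S t)"
      using \<xi>(2)[of t] by (auto simp: truncate_alg kron_col_mat_isometry) (simp add: isometry_mat_def)
  qed
  note E = effect_alg
  have fd: "final_dim alg = b ^ T" by (simp add: alg_def)
  show "psd (final_dim alg) (effect alg c)" for c
    unfolding psd_def
  proof (intro conjI ballI)
    show "effect alg c \<in> carrier_mat (final_dim alg) (final_dim alg)" by (simp add: E fd)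
    fix v :: "complex vec" assume "v \<in> carrier_vec (final_dim alg)"
    then have v: "v \<in> carrier_vec (b ^ T)" by (simp add: fd)
    let ?Y = "{ys \<in> answers. ans ys = c}" and ?K = "tuple_projection e T"
    have K: "?K ys \<in> carrier_mat (b ^ T) (b ^ T)" "projection_mat (?K ys)" if "ys \<in> ?Y" for ys
      using that by (auto intro!: tuple_projection_carrier tuple_projection_projection)
    have "(effect alg c *\<^sub>v v) \<bullet>c v = (\<Sum>ys\<in>?Y. (?K ys *\<^sub>v v) \<bullet>c v)" by (rule effect_form[OF v])
    also have "\<dots> \<ge> 0"
    proof (rule sum_nonneg)
      fix ys assume ys: "ys \<in> ?Y"
      show "0 \<le> (?K ys *\<^sub>v v) \<bullet>c v"
        unfolding projection_form[OF K(2)[OF ys] K(1)[OF ys] v]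
        by (simp add: cscalar_prod_self less_eq_complex_def sum_nonneg del: of_real_sum)
    qed
    finally show "0 \<le> (effect alg c *\<^sub>v v) \<bullet>c v" .
  qed
  show "effect alg True + effect alg False = 1\<^sub>m (final_dim alg)"
  proof (rule eq_matI)
    fix i j assume "i < dim_row (1\<^sub>m (final_dim alg) :: complex mat)" "j < dim_col (1\<^sub>m (final_dim alg) :: complex mat)"
    then have ij: "i < b ^ T" "j < b ^ T" by (simp_all add: fd)
    have "(effect alg True + effect alg False) $$ (i, j)
        = (\<Sum>ys\<in>{ys \<in> answers. ans ys = True}. tuple_projection e T ys $$ (i, j))
        + (\<Sum>ys\<in>{ys \<in> answers. ans ys = False}. tuple_projection e T ys $$ (i, j))"
      using ij by (simp add: E)
    also have "\<dots> = (\<Sum>ys\<in>answers. tuple_projection e T ys $$ (i, j))"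
      by (subst sum.union_disjoint[symmetric]) (auto intro!: sum.cong)
    finally show "(effect alg True + effect alg False) $$ (i, j) = 1\<^sub>m (final_dim alg) $$ (i, j)"
      using ij by (simp add: tuple_projection_sum fd)
  qed (simp_all add: E fd)
qed

lemma state_after_alg:
  assumes Q: "Q \<in> carrier_mat b a"
  shows "t < T \<Longrightarrow> state_after Q (strategy.truncate alg) t = kvec (\<xi> t) (product_state Q \<xi> t)"
    "state_after Q (strategy.truncate alg) T = product_state Q \<xi> T"
proof -
  let ?S = "strategy.truncate alg"
  have dim: "dim_vec (product_state Q \<xi> t) = b ^ t" for t
    using Q by (intro product_state_dim) auto
  have step: "kron Q (1\<^sub>m (b ^ t)) *\<^sub>v kvec (\<xi> t) (product_state Q \<xi> t) = product_state Q \<xi> (Suc t)" if "t < T" for t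
  proof -
    have "1\<^sub>m (b ^ t) *\<^sub>v product_state Q \<xi> t = product_state Q \<xi> t"
      using dim by (intro one_mult_mat_vec carrier_vecI)
    then show ?thesis using Q \<xi>(1)[OF that] dim by (subst kron_mult_kvec) auto
  qed
  show *: "state_after Q ?S t = kvec (\<xi> t) (product_state Q \<xi> t)" if "t < T" for t
    using that
  proof (induction t)
    case 0
    have "kron (col_mat (\<xi> 0)) (1\<^sub>m 1) *\<^sub>v vec 1 (\<lambda>_. 1) = kvec (\<xi> 0) (vec 1 (\<lambda>_. 1))"
      by (rule kron_col_mat_vec) simp
    then show ?case using 0 by (simp add: truncate_alg)
  next
    case (Suc t)
    have "kron (col_mat (\<xi> (Suc t))) (1\<^sub>m (b ^ Suc t)) *\<^sub>v product_state Q \<xi> (Suc t) = kvec (\<xi> (Suc t)) (product_state Q \<xi> (Suc t))"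
      by (rule kron_col_mat_vec) (rule dim)
    then show ?case using Suc step[of t] by (simp add: truncate_alg del: product_state.simps power_Suc)
  qed
  obtain t where t: "T = Suc t" using T by (cases T) auto
  have "1\<^sub>m (b ^ T) *\<^sub>v product_state Q \<xi> (Suc t) = product_state Q \<xi> (Suc t)"
    unfolding t by (intro one_mult_mat_vec carrier_vecI dim)
  moreover have "t < T" "\<not> Suc t < T" using t by auto
  ultimately have "state_after Q ?S (Suc t) = product_state Q \<xi> (Suc t)"
    using *[of t] step[of t] by (simp add: truncate_alg del: product_state.simps power_Suc)
  then show "state_after Q ?S T = product_state Q \<xi> T" by (simp only: t[symmetric])
qed

definition prob :: "complex mat \<Rightarrow> nat \<Rightarrow> nat \<Rightarrow> real" where
  "prob Q t c = Re ((e c *\<^sub>v (Q *\<^sub>v \<xi> t)) \<bullet>c (Q *\<^sub>v \<xi> t))"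

text \<open>State and projections are products over the queries, so the outcomes are
  independent.\<close>

lemma outcome_prob_alg:
  assumes Q: "Q \<in> carrier_mat b a"
  shows "outcome_prob Q alg c = (\<Sum>ys\<in>{ys \<in> answers. ans ys = c}. \<Prod>t<T. prob Q t (ys t))"
proof -
  let ?Y = "{ys \<in> answers. ans ys = c}" and ?K = "tuple_projection e T" and ?v = "product_state Q \<xi> T"
  have v: "?v \<in> carrier_vec (b ^ T)" using Q by (intro carrier_vecI product_state_dim) auto
  have "mat_trace (effect alg c * final_state Q (strategy.truncate alg)) = (effect alg c *\<^sub>v ?v) \<bullet>c ?v"
    using v by (simp add: final_state_def truncate_alg state_after_alg[OF Q] trace_pure_density[of _ "b ^ T"] effect_alg)
  also have "\<dots> = (\<Sum>ys\<in>?Y. (?K ys *\<^sub>v ?v) \<bullet>c ?v)" by (rule effect_form[OF v])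
  also have "\<dots> = (\<Sum>ys\<in>?Y. complex_of_real (\<Prod>t<T. prob Q t (ys t)))"
  proof (rule sum.cong[OF refl])
    fix ys assume ys: "ys \<in> ?Y"
    have C': "ys t \<in> C" if "t < T" for t using ys that by auto
    have real: "(e (ys t) *\<^sub>v (Q *\<^sub>v \<xi> t)) \<bullet>c (Q *\<^sub>v \<xi> t) = complex_of_real (prob Q t (ys t))" if "t < T" for t
    proof -
      have "Q *\<^sub>v \<xi> t \<in> carrier_vec b" using Q \<xi>(1)[OF that] by (simp add: mult_mat_vec_carrier[of _ b a])
      from projection_form[OF e(2,1)[OF C'[OF that]] this] show ?thesis
        by (simp add: prob_def cscalar_prod_self del: of_real_sum)
    qed
    have "(?K ys *\<^sub>v ?v) \<bullet>c ?v = (\<Prod>t<T. (e (ys t) *\<^sub>v (Q *\<^sub>v \<xi> t)) \<bullet>c (Q *\<^sub>v \<xi> t))"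
      using Q C' by (intro tuple_projection_prob) auto
    also have "\<dots> = (\<Prod>t<T. complex_of_real (prob Q t (ys t)))"
      by (intro prod.cong) (auto simp: real)
    finally show "(?K ys *\<^sub>v ?v) \<bullet>c ?v = complex_of_real (\<Prod>t<T. prob Q t (ys t))" by simp
  qed
  finally show ?thesis by (simp add: outcome_prob_def del: of_real_prod)
qed

lemma prob_sum:
  assumes Q: "Q \<in> carrier_mat b a" and t: "t < T"
  shows "(\<Sum>c\<in>C. prob Q t c) = Re ((Q *\<^sub>v \<xi> t) \<bullet>c (Q *\<^sub>v \<xi> t))"
proof -
  let ?v = "Q *\<^sub>v \<xi> t"
  have v: "?v \<in> carrier_vec b" using Q \<xi>(1)[OF t] by (simp add: mult_mat_vec_carrier[of _ b a])
  have "(\<Sum>c\<in>C. (e c *\<^sub>v ?v) \<bullet>c ?v) = (mat b b (\<lambda>ij. \<Sum>c\<in>C. e c $$ ij) *\<^sub>v ?v) \<bullet>c ?v"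
    by (rule sum_mat_form[OF v e(1), symmetric])
  also have "mat b b (\<lambda>ij. \<Sum>c\<in>C. e c $$ ij) = 1\<^sub>m b"
    by (rule eq_matI) (simp_all add: e_sum)
  also have "1\<^sub>m b *\<^sub>v ?v = ?v" by (rule one_mult_mat_vec[OF v])
  finally show ?thesis by (simp add: prob_def flip: Re_sum)
qed

text \<open>The sum over all tuples factors into sums over single outcomes, each the squared norm of
  an answer state. It allows bounding only the wrong answer.\<close>

lemma outcome_prob_total:
  assumes Q: "Q \<in> carrier_mat b a" and norm: "\<And>t. t < T \<Longrightarrow> (Q *\<^sub>v \<xi> t) \<bullet>c (Q *\<^sub>v \<xi> t) = 1"
  shows "outcome_prob Q alg True + outcome_prob Q alg False = 1"
proof -
  have "outcome_prob Q alg True + outcome_prob Q alg False = (\<Sum>ys\<in>answers. \<Prod>t<T. prob Q t (ys t))"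
    unfolding outcome_prob_alg[OF Q] by (subst sum.union_disjoint[symmetric]) (auto intro!: sum.cong)
  also have "\<dots> = (\<Prod>t<T. \<Sum>c\<in>C. prob Q t c)"
    by (rule prod_sum_PiE[symmetric]) (use C in auto)
  also have "\<dots> = 1" by (simp add: prob_sum[OF Q] norm)
  finally show ?thesis .
qed

end

section \<open>Collision finding with the forward-erasing oracle\<close>

text \<open>The strings supported on the low positions, then those supported on the high positions.\<close>

definition probe :: "nat \<Rightarrow> nat \<Rightarrow> nat" where
  "probe m t = (if t < 2 ^ m then t else (t - 2 ^ m) * 2 ^ m)"

lemma unit_vec_cscalar_prod:
  assumes "k < b" "l < b"
  shows "unit_vec b k \<bullet>c unit_vec b l = (if k = l then 1 else 0 :: complex)"
  using assms by (simp add: cscalar_prod_sum unit_vec_def if_distrib[of "\<lambda>x. x * _"] sum.delta cong: if_cong)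

locale birthday =
  fixes n :: nat
  assumes n: "n \<ge> 1"
begin

text \<open>Half of the length, rounded up; this balances the two families of probes.\<close>

definition m :: nat where "m = n - n div 2"

definition T :: nat where "T = 2 ^ m + 2 ^ (n - m)"

lemma m_le: "m \<le> n" by (simp add: m_def)

lemma probe_less: "t < T \<Longrightarrow> probe m t < 2 ^ n"
proof (cases "t < 2 ^ m")
  case True
  then show ?thesis using m_le power_increasing[of m n "2 :: nat"] by (auto simp: probe_def intro: less_le_trans)
next
  case False
  assume "t < T"
  with False have "t - 2 ^ m < 2 ^ (n - m)" by (auto simp: T_def)
  then have "(t - 2 ^ m) * 2 ^ m < 2 ^ (n - m) * 2 ^ m" by simp
  also have "\<dots> = 2 ^ n" using m_le by (simp flip: power_add)
  finally show ?thesis using False by (simp add: probe_def)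
qed

definition output_image :: "nat \<Rightarrow> nat" where "output_image c = c div 2 ^ n div 2 ^ n"

text \<open>The zero string is probed twice, as the first low and as the first high string, so equal
  images count only for different probes.\<close>

definition collision :: "(nat \<Rightarrow> nat) \<Rightarrow> bool" where
  "collision ys \<longleftrightarrow> (\<exists>i<T. \<exists>j<T. probe m i \<noteq> probe m j \<and> output_image (ys i) = output_image (ys j))"

abbreviation proj :: "nat \<Rightarrow> complex mat" where
  "proj c \<equiv> pure_density (unit_vec (2 ^ (3 * n)) c)"

sublocale nonadaptive "2 ^ n" "2 ^ (3 * n)" T "\<lambda>t. unit_vec (2 ^ n) (probe m t)" "{..<2 ^ (3 * n)}"
    proj collision
proof
  show "T \<ge> 1" by (simp add: T_def Suc_le_eq)
  show "unit_vec (2 ^ n) (probe m t) \<in> carrier_vec (2 ^ n)" for t by simp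
  show "unit_vec (2 ^ n) (probe m t) \<bullet>c unit_vec (2 ^ n) (probe m t) = (1 :: complex)" if "t < T" for t
    using probe_less[OF that] by (simp add: unit_vec_cscalar_prod)
  show "finite {..<(2 :: nat) ^ (3 * n)}" by simp
  show "proj c \<in> carrier_mat (2 ^ (3 * n)) (2 ^ (3 * n))" for c by (intro carrier_matI) simp_all
  show "projection_mat (proj c)" if "c \<in> {..<2 ^ (3 * n)}" for c
    using that by (intro projection_pure_density) (simp add: unit_vec_cscalar_prod)
  show "(\<Sum>c<2 ^ (3 * n). proj c $$ (i, j)) = (if i = j then 1 else 0)"
    if "i < 2 ^ (3 * n)" "j < 2 ^ (3 * n)" for i j
  proof -
    have "(\<Sum>c<2 ^ (3 * n). proj c $$ (i, j)) = (\<Sum>c<2 ^ (3 * n). if c = i then (if i = j then 1 else 0) else 0)"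
      using that by (intro sum.cong) (auto simp: pure_density_def unit_vec_def)
    then show ?thesis using that by (simp add: sum.delta)
  qed
qed

context
  fixes h r :: "nat \<Rightarrow> nat"
  assumes h: "h \<in> bits n \<rightarrow> bits n" and r: "r \<in> bits n \<rightarrow> bits n"
begin

abbreviation "Q \<equiv> garbage_erasing_oracle n h r"
abbreviation "F \<equiv> (\<lambda>t. concat3 n (garbage_fun h r (probe m t)))"

lemma concat3_less:
  assumes "x < 2 ^ n"
  shows "concat3 n (garbage_fun h r x) < 2 ^ (3 * n)" "output_image (concat3 n (garbage_fun h r x)) = h x"
  using concat3_garbage_fun[OF assms h r] by (simp_all add: output_image_def)

lemma oracle_probe: "t < T \<Longrightarrow> Q *\<^sub>v unit_vec (2 ^ n) (probe m t) = unit_vec (2 ^ (3 * n)) (F t)"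
  unfolding garbage_erasing_oracle_def
  by (subst erasing_oracle_basis) (simp_all add: probe_less concat3_less)

text \<open>Inputs and answers are basis states, so exactly one tuple of outcomes occurs and the
  answer is deterministic.\<close>

lemma birthday_prob:
  "outcome_prob Q alg c = (if collision F = c then 1 else 0)"
proof -
  have Q: "Q \<in> carrier_mat (2 ^ (3 * n)) (2 ^ n)" by (simp add: carrier_matI)
  have p: "prob Q t k = (if k = F t then 1 else 0)" if "t < T" "k < 2 ^ (3 * n)" for t k
    using that concat3_less(1)[OF probe_less[OF that(1)]]
    unfolding prob_def oracle_probe[OF that(1)]
    by (subst pure_density_form) (auto simp: unit_vec_cscalar_prod)
  let ?y = "restrict F {..<T}"
  have y: "?y \<in> answers" using concat3_less(1)[OF probe_less] by auto
  have "(\<Prod>t<T. prob Q t (ys t)) = (if ys = ?y then 1 else 0)" if ys: "ys \<in> answers" for ys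
  proof (cases "ys = ?y")
    case True
    have "(\<Prod>t<T. prob Q t (ys t)) = (\<Prod>t<T. 1)"
      using True concat3_less(1)[OF probe_less] by (intro prod.cong) (auto simp: p)
    then show ?thesis using True by simp
  next
    case False
    then obtain t where t: "t < T" "ys t \<noteq> F t"
      using ys by (metis (no_types, lifting) PiE_restrict lessThan_iff restrict_ext)
    then have "prob Q t (ys t) = 0" using ys by (subst p) auto
    then show ?thesis using t False by (auto intro: prod_zero)
  qed
  then have "outcome_prob Q alg c = (\<Sum>ys\<in>{ys \<in> answers. collision ys = c}. if ys = ?y then 1 else 0)"
    unfolding outcome_prob_alg[OF Q] by (intro sum.cong) auto
  also have "\<dots> = (if ?y \<in> {ys \<in> answers. collision ys = c} then 1 else 0)"
    by (simp add: sum.delta)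
  also have "?y \<in> {ys \<in> answers. collision ys = c} \<longleftrightarrow> collision ?y = c" using y by blast
  also have "collision ?y = collision F"
    unfolding collision_def by (intro ex_cong1 conj_cong refl) simp
  finally show ?thesis by simp
qed

lemma collision_F: "collision F \<longleftrightarrow> (\<exists>i<T. \<exists>j<T. probe m i \<noteq> probe m j \<and> h (probe m i) = h (probe m j))"
  unfolding collision_def
  by (intro ex_cong1 conj_cong refl) (simp add: concat3_less(2)[OF probe_less])

text \<open>Removing the low bits \<open>u\<close> from \<open>s\<close> leaves a high string, so
  \<open>u\<close> and \<open>u XOR s\<close> are both probes; they differ because \<open>s\<close>
  is nonzero.\<close>

lemma collision_simon:
  assumes s: "s \<in> bits n - {0}" and simon: "simon_function n s h"
  shows "collision F"
proof -
  define u where "u = take_bit m s"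
  define v where "v = drop_bit m s"
  have s2: "s < 2 ^ n" using s by (simp add: bits_def)
  have u: "u < 2 ^ m" by (simp add: u_def)
  have v: "v < 2 ^ (n - m)"
  proof -
    have "s < 2 ^ (n - m) * 2 ^ m" using s2 m_le by (simp flip: power_add)
    then show ?thesis by (simp add: v_def drop_bit_eq_div less_mult_imp_div_less)
  qed
  \<comment> \<open>The high probes are numbered after the \<open>2 ^ m\<close> low ones.\<close>
  let ?i = u and ?j = "2 ^ m + v"
  have i: "?i < T" "probe m ?i = u" using u by (simp_all add: T_def probe_def)
  have j: "?j < T" "probe m ?j = push_bit m v" using v by (simp_all add: T_def probe_def push_bit_eq_mult)
  have x: "u XOR s = push_bit m v"
    by (rule bit_eqI) (auto simp: u_def v_def bit_simps)
  have "u \<noteq> push_bit m v" using x s xor_eq_self_iff[of u s] by auto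
  moreover have "h u = h (push_bit m v)"
  proof -
    have "u \<in> bits n" "push_bit m v \<in> bits n"
      using probe_less[OF i(1)] probe_less[OF j(1)] i(2) j(2) by (simp_all add: bits_def)
    then show ?thesis using simon x by (auto simp: simon_function_def)
  qed
  ultimately show ?thesis
    unfolding collision_F using i j by (intro exI[of _ ?i] exI[of _ ?j] conjI) simp_all
qed

lemma collision_perm:
  assumes "bij_betw h (bits n) (bits n)"
  shows "\<not> collision F"
proof
  assume "collision F"
  then obtain i j where ij: "i < T" "j < T" "probe m i \<noteq> probe m j" "h (probe m i) = h (probe m j)"
    by (auto simp: collision_F)
  then show False
    using bij_betw_imp_inj_on[OF assms] probe_less[of i] probe_less[of j] by (auto simp: inj_on_def bits_def)
qed

end

lemma birthday_algorithm: "erasing_algorithm n alg"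
  unfolding erasing_algorithm_def bounded_error_def
proof (intro conjI ballI impI valid_alg)
  fix h r assume hr: "h \<in> bits n \<rightarrow> bits n" "r \<in> bits n \<rightarrow> bits n"
  show "2 / 3 \<le> outcome_prob (garbage_erasing_oracle n h r) alg False" if "bij_betw h (bits n) (bits n)"
    using collision_perm[OF hr that] by (simp add: birthday_prob[OF hr])
  show "2 / 3 \<le> outcome_prob (garbage_erasing_oracle n h r) alg True" if ex: "\<exists>s\<in>bits n - {0}. simon_function n s h"
  proof -
    obtain s where "s \<in> bits n - {0}" "simon_function n s h" using ex by blast
    from collision_simon[OF hr this] show ?thesis by (simp add: birthday_prob[OF hr])
  qed
qed

lemma T_le: "real T \<le> 4 * 2 powr (real n / 2)"
proof -
  have "n - m \<le> m" by (auto simp: m_def)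
  then have "T \<le> 2 * 2 ^ m" by (simp add: T_def power_increasing)
  then have "real T \<le> real (2 * 2 ^ m)" by (rule of_nat_mono)
  also have "\<dots> = 2 * 2 powr real m" by (simp add: powr_realpow)
  \<comment> \<open>The added 1 in the exponent absorbs the rounding in \<open>m\<close>, at the
    price of a factor 2.\<close>
  also have "\<dots> \<le> 2 * 2 powr (real n / 2 + 1)"
    by (intro mult_left_mono powr_mono) (auto simp: m_def of_nat_diff field_simps)
  also have "\<dots> = 4 * 2 powr (real n / 2)" by (simp add: powr_add)
  finally show ?thesis .
qed

end

lemma Q_erase_le: "n \<ge> 1 \<Longrightarrow> ereal_of_enat (Q_erase n) \<le> ereal (4 * 2 powr (real n / 2))"
proof -
  assume "n \<ge> 1"
  then interpret birthday n by unfold_locales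
  have "Q_erase n \<le> enat T"
    unfolding Q_erase_def using birthday_algorithm by (intro Inf_lower) (auto intro!: exI[of _ alg])
  then have "ereal_of_enat (Q_erase n) \<le> ereal_of_enat (enat T)" by (simp only: ereal_of_enat_le_iff)
  also have "\<dots> \<le> ereal (4 * 2 powr (real n / 2))" using T_le by simp
  finally show ?thesis .
qed

lemma Q_erase_ge:
  assumes n: "n \<ge> 1"
  shows "ereal (1 / 16 * 2 powr (real n / 2)) \<le> ereal_of_enat (Q_erase n)"
proof -
  have sq: "sqrt (2 ^ n) = 2 powr (real n / 2)"
    by (simp add: powr_half_sqrt[symmetric] powr_powr flip: powr_realpow)
  \<comment> \<open>The infimum lies in \<open>enat\<close>, so the real bound is first rounded up
    to a natural number.\<close>
  define c where "c = nat \<lceil>1 / 16 * 2 powr (real n / 2)\<rceil>"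
  have "enat c \<le> Q_erase n"
    unfolding Q_erase_def
  proof (rule Inf_greatest, clarify)
    fix A assume "erasing_algorithm n A"
    from erasing_lower_bound[OF n this] have "1 / 16 * 2 powr (real n / 2) \<le> real (queries A)" by (simp add: sq)
    then show "enat c \<le> enat (queries A)" by (simp add: c_def)
  qed
  then have "ereal_of_enat (enat c) \<le> ereal_of_enat (Q_erase n)" by (simp only: ereal_of_enat_le_iff)
  moreover have "1 / 16 * 2 powr (real n / 2) \<le> real c" unfolding c_def by (rule real_nat_ceiling_ge)
  then have "ereal (1 / 16 * 2 powr (real n / 2)) \<le> ereal_of_enat (enat c)" by simp
  ultimately show ?thesis by (rule order_trans[rotated])
qed

section \<open>Simon's algorithm with the XOR oracle\<close>

definition chi :: "nat \<Rightarrow> nat \<Rightarrow> nat \<Rightarrow> real" where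
  "chi n y x = (\<Prod>i<n. if bit y i \<and> bit x i then -1 else 1)"

lemma chi_commute: "chi n y x = chi n x y"
  by (simp add: chi_def conj_commute)

lemma chi_xor: "chi n y (x XOR s) = chi n y x * chi n y s"
  unfolding chi_def prod.distrib[symmetric] by (intro prod.cong) (auto simp: bit_xor_iff)

lemma chi_square: "chi n y x * chi n y x = 1"
  unfolding chi_def prod.distrib[symmetric] by (intro prod.neutral) auto

lemma chi_zero [simp]: "chi n y 0 = 1"
  by (simp add: chi_def)

lemma chi_cases: "chi n y x = 1 \<or> chi n y x = -1"
  using chi_square[of n y x] by (simp add: square_eq_1_iff)

lemma bij_xor: "s \<in> bits n \<Longrightarrow> bij_betw (\<lambda>x. x XOR s) (bits n) (bits n)"
  by (rule bij_betw_byWitness[of _ "\<lambda>x. x XOR s"]) (auto simp: xor_cancel xor_bits)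

lemma sum_xor: "s \<in> bits n \<Longrightarrow> (\<Sum>x\<in>bits n. f (x XOR s)) = (\<Sum>x\<in>bits n. f x)"
  by (rule sum.reindex_bij_betw[OF bij_xor])

text \<open>For nonzero \<open>s\<close>, flipping a position of \<open>y\<close> at which
  \<open>s\<close> has a one negates the character, so the sum is its own negative.\<close>

lemma sum_chi:
  assumes "s \<in> bits n"
  shows "(\<Sum>y\<in>bits n. chi n y s) = (if s = 0 then 2 ^ n else 0)"
proof (cases "s = 0")
  case False
  have "\<exists>i<n. bit s i"
  proof (rule ccontr)
    assume no: "\<not> (\<exists>i<n. bit s i)"
    have "take_bit n s = s" using assms by (simp add: bits_def take_bit_nat_eq_self)
    moreover have "take_bit n s = 0" by (rule bit_eqI) (use no in \<open>auto simp: bit_take_bit_iff\<close>)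
    ultimately show False using False by simp
  qed
  then obtain i where i: "i < n" "bit s i" by blast
  have p: "(2 :: nat) ^ i \<in> bits n" using i by (simp add: bits_def)
  have "chi n (2 ^ i) s = (\<Prod>j<n. if j = i then -1 else 1)"
    unfolding chi_def using i by (intro prod.cong) (auto simp: bit_exp_iff)
  then have ch: "chi n (2 ^ i) s = -1" using i by (simp add: prod.delta)
  have "(\<Sum>y\<in>bits n. chi n y s) = (\<Sum>y\<in>bits n. chi n (y XOR 2 ^ i) s)" by (rule sum_xor[OF p, symmetric])
  also have "\<dots> = (\<Sum>y\<in>bits n. - chi n y s)"
  proof (rule sum.cong[OF refl])
    fix y
    show "chi n (y XOR 2 ^ i) s = - chi n y s"
      using chi_xor[of n s y "2 ^ i"] ch by (simp add: chi_commute[of n s])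
  qed
  finally show ?thesis using False by (simp add: sum_negf)
qed simp

lemma card_chi:
  assumes "s \<in> bits n - {0}"
  shows "real (card {y \<in> bits n. chi n y s = 1}) = 2 ^ n / 2"
proof -
  have "2 * real (card {y \<in> bits n. chi n y s = 1}) = (\<Sum>y\<in>bits n. if chi n y s = 1 then 2 else 0)"
    by (simp add: sum.inter_filter[symmetric])
  \<comment> \<open>Characters take the values 1 and -1, so \<open>1 + chi n y s\<close> is twice
    the indicator.\<close>
  also have "\<dots> = (\<Sum>y\<in>bits n. 1 + chi n y s)"
    by (intro sum.cong refl) (use chi_cases in force)
  also have "\<dots> = 2 ^ n" using assms by (simp add: sum.distrib sum_chi)
  finally show ?thesis by simp
qed

text \<open>The projection onto a vector of the Hadamard basis; measuring in this basis performs the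
  final transform of Simon's algorithm and the readout in one.\<close>

definition chi_proj :: "nat \<Rightarrow> nat \<Rightarrow> complex mat" where
  "chi_proj n y = pure_density (vec (2 ^ n) (\<lambda>x. complex_of_real (chi n y x / sqrt (2 ^ n))))"

lemma chi_proj_dim [simp]: "dim_row (chi_proj n y) = 2 ^ n" "dim_col (chi_proj n y) = 2 ^ n"
  by (simp_all add: chi_proj_def)

lemma chi_proj_index:
  assumes "i < 2 ^ n" "j < 2 ^ n"
  shows "chi_proj n y $$ (i, j) = complex_of_real (chi n y i * chi n y j / 2 ^ n)"
proof -
  have "complex_of_real (sqrt (2 ^ n)) * complex_of_real (sqrt (2 ^ n)) = 2 ^ n"
    by (simp flip: of_real_mult)
  then show ?thesis using assms by (simp add: chi_proj_def pure_density_def)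
qed

lemma chi_proj_projection: "projection_mat (chi_proj n y)"
  unfolding chi_proj_def
proof (rule projection_pure_density)
  have "(cmod (complex_of_real (chi n y x / sqrt (2 ^ n))))\<^sup>2 = 1 / 2 ^ n" for x
    using chi_square[of n y x] by (simp only: norm_of_real power2_abs) (simp add: power2_eq_square)
  then show "vec (2 ^ n) (\<lambda>x. complex_of_real (chi n y x / sqrt (2 ^ n))) \<bullet>c vec (2 ^ n) (\<lambda>x. complex_of_real (chi n y x / sqrt (2 ^ n))) = 1"
    by (simp only: cscalar_prod_self) simp
qed

lemma chi_proj_sum:
  assumes "i < 2 ^ n" "j < 2 ^ n"
  shows "(\<Sum>y\<in>bits n. chi_proj n y $$ (i, j)) = (if i = j then 1 else 0)"
proof -
  have ij: "i \<in> bits n" "j \<in> bits n" using assms by (simp_all add: bits_def)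
  have "(\<Sum>y\<in>bits n. chi_proj n y $$ (i, j)) = (\<Sum>y\<in>bits n. complex_of_real (chi n y (i XOR j) / 2 ^ n))"
    using assms by (simp add: chi_proj_index chi_xor)
  also have "\<dots> = complex_of_real ((\<Sum>y\<in>bits n. chi n y (i XOR j)) / 2 ^ n)"
    by (simp only: of_real_sum sum_divide_distrib)
  also have "\<dots> = (if i XOR j = 0 then 1 else 0)"
    by (simp add: sum_chi xor_bits ij)
  also have "i XOR j = 0 \<longleftrightarrow> i = j"
    using xor_cancel[of i j] by auto
  finally show ?thesis .
qed

text \<open>The leading \<open>n\<close> bits of the answer register, reserved for \<open>h\<close>,
  are zero; the remaining \<open>2 * n\<close> bits and the query register are uniform, which makes
  \<open>2 ^ (3 * n)\<close> equal amplitudes.\<close>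

definition simon_input :: "nat \<Rightarrow> complex vec" where
  "simon_input n = vec (2 ^ n * 2 ^ (3 * n))
     (\<lambda>i. if i mod 2 ^ (3 * n) div 2 ^ (2 * n) = 0 then complex_of_real (1 / sqrt (2 ^ (3 * n))) else 0)"

text \<open>The condition for answering YES: some nonzero string is orthogonal modulo 2 to all
  outcomes. For a Simon function the shift always is, so only permutations can cause errors.\<close>

definition consistent :: "nat \<Rightarrow> nat \<Rightarrow> (nat \<Rightarrow> nat) \<Rightarrow> bool" where
  "consistent n T ys \<longleftrightarrow> (\<exists>s\<in>bits n - {0}. \<forall>t<T. chi n (ys t) s = 1)"

lemma cube: "(2 :: 'a :: comm_semiring_1) ^ (3 * n) = 2 ^ n * 2 ^ (2 * n)"
  by (simp flip: power_add)

lemma sum_out_register: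
  fixes G :: "nat \<Rightarrow> real"
  shows "(\<Sum>z<2 ^ (3 * n). G (z div 2 ^ (2 * n))) = 2 ^ (2 * n) * (\<Sum>w<2 ^ n. G w)"
  by (simp add: cube sum_lessThan_mult sum_distrib_left)

lemma norm2_indicator: "(cmod (if P then complex_of_real a else 0))\<^sup>2 = (if P then a\<^sup>2 else 0)"
  by simp

text \<open>Exclusive or with \<open>f x\<close> is its own inverse, so an output entry is read from
  the input at the index shifted the same way.\<close>

lemma xor_oracle_vec:
  assumes f: "\<And>x. x < 2 ^ k \<Longrightarrow> f x < 2 ^ l" and v: "v \<in> carrier_vec (2 ^ k * 2 ^ l)"
    and x: "x < 2 ^ k" and z: "z < 2 ^ l"
  shows "(xor_oracle k l f *\<^sub>v v) $ (x * 2 ^ l + z) = v $ (x * 2 ^ l + (z XOR f x))"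
proof -
  let ?i = "x * 2 ^ l + z" and ?j = "x * 2 ^ l + (z XOR f x)"
  have zf: "z XOR f x < 2 ^ l" using xor_lt_two_power[OF z f[OF x]] .
  have i: "?i < 2 ^ k * 2 ^ l" "?j < 2 ^ k * 2 ^ l" using x z zf by (simp_all add: less_mult_combine)
  have entry: "xor_oracle k l f $$ (?i, x' * 2 ^ l + z') = (if x' = x \<and> z' = z XOR f x then 1 else 0)"
    if x': "x' < 2 ^ k" and z': "z' < 2 ^ l" for x' z'
  proof -
    have zf': "z' XOR f x' < 2 ^ l" using xor_lt_two_power[OF z' f[OF x']] .
    have "?i = x' * 2 ^ l + (z' XOR f x') \<longleftrightarrow> x = x' \<and> z = z' XOR f x'"
      using z zf' combine_divmod by metis
    moreover have "z = z' XOR f x \<longleftrightarrow> z' = z XOR f x"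
      using xor_cancel[of z "f x"] xor_cancel[of z' "f x"] by auto
    ultimately show ?thesis
      using i x' z' by (auto simp: xor_oracle_def Let_def less_mult_combine)
  qed
  have d: "dim_row (xor_oracle k l f) = 2 ^ k * 2 ^ l" "dim_col (xor_oracle k l f) = 2 ^ k * 2 ^ l"
    by (simp_all add: xor_oracle_def)
  have "(xor_oracle k l f *\<^sub>v v) $ ?i = (\<Sum>x'<2 ^ k. \<Sum>z'<2 ^ l. xor_oracle k l f $$ (?i, x' * 2 ^ l + z') * v $ (x' * 2 ^ l + z'))"
    using i v d by (simp add: mat_vec_index sum_lessThan_mult)
  also have "\<dots> = (\<Sum>x'<2 ^ k. \<Sum>z'<2 ^ l. if z' = z XOR f x then (if x' = x then v $ (x' * 2 ^ l + z') else 0) else 0)"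
    by (intro sum.cong[OF refl]) (simp add: entry)
  also have "\<dots> = v $ ?j" using x zf by (simp add: sum.delta)
  finally show ?thesis .
qed

locale simon =
  fixes n :: nat
  assumes n: "n \<ge> 1"
begin

abbreviation "M \<equiv> (2 :: nat) ^ (3 * n)"
abbreviation "proj y \<equiv> kron (chi_proj n y) (1\<^sub>m M)"

lemma simon_input_norm: "simon_input n \<bullet>c simon_input n = 1"
proof -
  have "(\<Sum>i<2 ^ n * M. (cmod (simon_input n $ i))\<^sup>2)
      = (\<Sum>x<(2 :: nat) ^ n. \<Sum>z<M. if z div 2 ^ (2 * n) = 0 then (1 / sqrt (2 ^ (3 * n)))\<^sup>2 else 0)"
    unfolding sum_lessThan_mult
    by (intro sum.cong[OF refl]) (simp add: simon_input_def less_mult_combine norm2_indicator power_divide norm_divide del: div_eq_0_iff)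
  also have "\<dots> = (\<Sum>x<(2 :: nat) ^ n. 2 ^ (2 * n) * (\<Sum>w<(2::nat) ^ n. if w = 0 then (1 / sqrt (2 ^ (3 * n)))\<^sup>2 else 0))"
    by (intro sum.cong[OF refl] sum_out_register)
  also have "\<dots> = 1"
    by (simp add: sum.delta power_divide cube)
  finally show ?thesis by (simp add: cscalar_prod_self simon_input_def del: of_real_sum)
qed

sublocale nonadaptive "2 ^ n * M" "2 ^ n * M" "n + 2" "\<lambda>t. simon_input n" "bits n"
    proj "consistent n (n + 2)"
proof
  show "simon_input n \<in> carrier_vec (2 ^ n * M)" by (simp add: simon_input_def)
  show "simon_input n \<bullet>c simon_input n = 1" by (rule simon_input_norm)
  show "proj y \<in> carrier_mat (2 ^ n * M) (2 ^ n * M)" for y by (intro carrier_matI) simp_all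
  show "projection_mat (proj y)" for y
    by (intro projection_kron chi_proj_projection) (simp add: projection_mat_def)
  show "(\<Sum>y\<in>bits n. proj y $$ (i, j)) = (if i = j then 1 else 0)"
    if ij: "i < 2 ^ n * M" "j < 2 ^ n * M" for i j
  proof -
    note im = less_mult_divmod[OF ij(1)] and jm = less_mult_divmod[OF ij(2)]
    have "(\<Sum>y\<in>bits n. proj y $$ (i, j))
        = (\<Sum>y\<in>bits n. chi_proj n y $$ (i div M, j div M)) * 1\<^sub>m M $$ (i mod M, j mod M)"
      using ij by (simp add: kron_index sum_distrib_right)
    also have "\<dots> = (if i div M = j div M then 1 else 0) * (if i mod M = j mod M then 1 else 0)"
      using im jm by (simp add: chi_proj_sum)
    also have "\<dots> = (if i = j then 1 else 0)" by auto (metis div_mult_mod_eq)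
    finally show ?thesis .
  qed
qed simp_all

context
  fixes h r :: "nat \<Rightarrow> nat"
  assumes h: "h \<in> bits n \<rightarrow> bits n" and r: "r \<in> bits n \<rightarrow> bits n"
begin

abbreviation "Q \<equiv> garbage_xor_oracle n h r"

lemma Q_carrier: "Q \<in> carrier_mat (2 ^ n * M) (2 ^ n * M)"
  by (simp add: garbage_xor_oracle_def xor_oracle_def)

definition amp :: real where "amp = 1 / sqrt (2 ^ (3 * n))"

lemma amp_square: "amp\<^sup>2 = 1 / (2 ^ n * 2 ^ (2 * n))"
  by (simp add: amp_def power_divide cube)

text \<open>Exclusive or acts on leading and trailing bits separately: the leading bits receive
  \<open>h x\<close>, and the shift of the uniform trailing bits by argument and tag is
  invisible.\<close>

lemma query_output:
  assumes x: "x < 2 ^ n" and z: "z < M"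
  shows "(Q *\<^sub>v simon_input n) $ (x * M + z) = (if h x = z div 2 ^ (2 * n) then complex_of_real amp else 0)"
proof -
  let ?f = "concat3 n \<circ> garbage_fun h r"
  have f: "?f x < M" "?f x div 2 ^ (2 * n) = h x" if x: "x < 2 ^ n" for x
    using concat3_garbage_fun[OF x h r] by (simp_all add: div_mult2_eq[symmetric] flip: power_add mult_2)
  have zf: "z XOR ?f x < M" using xor_lt_two_power[OF z f(1)[OF x]] .
  have "(Q *\<^sub>v simon_input n) $ (x * M + z) = simon_input n $ (x * M + (z XOR ?f x))"
    unfolding garbage_xor_oracle_def by (rule xor_oracle_vec) (use f x z in \<open>auto simp: simon_input_def\<close>)
  also have "\<dots> = (if (z XOR ?f x) div 2 ^ (2 * n) = 0 then complex_of_real amp else 0)"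
    using x zf by (simp add: simon_input_def amp_def less_mult_combine del: div_eq_0_iff)
  also have "(z XOR ?f x) div 2 ^ (2 * n) = (z div 2 ^ (2 * n)) XOR h x"
    using f(2)[OF x] by (simp only: drop_bit_eq_div[symmetric] drop_bit_xor)
  also have "(z div 2 ^ (2 * n)) XOR h x = 0 \<longleftrightarrow> h x = z div 2 ^ (2 * n)"
    using xor_cancel[of "z div 2 ^ (2 * n)" "h x"] by auto
  finally show ?thesis .
qed

text \<open>Arguments with a common image \<open>w\<close> interfere, while different images are
  kept apart by the leading answer bits. The trailing bits all contribute alike and cancel against
  \<open>amp\<close>.\<close>

lemma prob_eq: "prob Q t y = (\<Sum>w<2 ^ n. (\<Sum>x\<in>{x \<in> bits n. h x = w}. chi n y x)\<^sup>2) / (2 ^ n)\<^sup>2"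
proof -
  let ?v = "Q *\<^sub>v simon_input n"
  define S where "S w = (\<Sum>x\<in>{x \<in> bits n. h x = w}. chi n y x)" for w
  have v: "dim_vec ?v = 2 ^ n * M" using Q_carrier by simp
  have ev: "(proj y *\<^sub>v ?v) $ (x * M + z) = complex_of_real (chi n y x * (amp * S (z div 2 ^ (2 * n))) / 2 ^ n)"
    if x: "x < 2 ^ n" and z: "z < M" for x z
  proof -
    have "(proj y *\<^sub>v ?v) $ (x * M + z)
        = (\<Sum>x'<2 ^ n. \<Sum>z'<M. proj y $$ (x * M + z, x' * M + z') * ?v $ (x' * M + z'))"
      using x z v by (simp add: mat_vec_index sum_lessThan_mult less_mult_combine)
    also have "\<dots> = (\<Sum>x'<2 ^ n. \<Sum>z'<M. if z' = z then chi_proj n y $$ (x, x') * ?v $ (x' * M + z) else 0)"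
      using x z kron_index_combine[of x "chi_proj n y" z "1\<^sub>m M"]
      by (intro sum.cong[OF refl]) (auto)
    also have "\<dots> = (\<Sum>x'<2 ^ n. chi_proj n y $$ (x, x') * ?v $ (x' * M + z))"
      using z by (simp add: sum.delta)
    also have "\<dots> = (\<Sum>x'\<in>bits n. complex_of_real (if h x' = z div 2 ^ (2 * n) then chi n y x * amp / 2 ^ n * chi n y x' else 0))"
      using x z by (intro sum.cong) (auto simp: bits_def query_output chi_proj_index)
    also have "\<dots> = complex_of_real (\<Sum>x'\<in>{x' \<in> bits n. h x' = z div 2 ^ (2 * n)}. chi n y x * amp / 2 ^ n * chi n y x')"
      by (simp only: of_real_sum[symmetric] sum.inter_filter[OF finite_bits, symmetric])
    also have "(\<Sum>x'\<in>{x' \<in> bits n. h x' = z div 2 ^ (2 * n)}. chi n y x * amp / 2 ^ n * chi n y x')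
        = chi n y x * (amp * S (z div 2 ^ (2 * n))) / 2 ^ n"
      unfolding S_def sum_distrib_left[symmetric] by simp
    finally show ?thesis .
  qed
  have "(\<Sum>i<2 ^ n * M. (cmod ((proj y *\<^sub>v ?v) $ i))\<^sup>2)
      = (\<Sum>x<(2 :: nat) ^ n. \<Sum>z<M. (amp * S (z div 2 ^ (2 * n)) / 2 ^ n)\<^sup>2)"
    unfolding sum_lessThan_mult
  proof (intro sum.cong[OF refl])
    fix x z assume xz: "x \<in> {..<(2 :: nat) ^ n}" "z \<in> {..<M}"
    have "(chi n y x)\<^sup>2 = 1" using chi_square[of n y x] by (simp add: power2_eq_square)
    then show "(cmod ((proj y *\<^sub>v ?v) $ (x * M + z)))\<^sup>2 = (amp * S (z div 2 ^ (2 * n)) / 2 ^ n)\<^sup>2"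
      using xz by (simp only: ev lessThan_iff norm_of_real power2_abs) (simp add: power_mult_distrib power_divide)
  qed
  also have "\<dots> = 2 ^ n * (2 ^ (2 * n) * (\<Sum>w<2 ^ n. (amp * S w / 2 ^ n)\<^sup>2))"
    by (simp add: sum_out_register[of "\<lambda>w. (amp * S w / 2 ^ n)\<^sup>2"])
  also have "\<dots> = (\<Sum>w<2 ^ n. (S w)\<^sup>2) / (2 ^ n)\<^sup>2"
    by (simp add: power_divide power_mult_distrib amp_square flip: sum_divide_distrib)
  finally have norm: "(\<Sum>i<2 ^ n * M. (cmod ((proj y *\<^sub>v ?v) $ i))\<^sup>2) = (\<Sum>w<2 ^ n. (S w)\<^sup>2) / (2 ^ n)\<^sup>2" .
  have "projection_mat (proj y)"
    by (intro projection_kron chi_proj_projection) (simp add: projection_mat_def)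
  moreover have "proj y \<in> carrier_mat (2 ^ n * M) (2 ^ n * M)"
    by (intro carrier_matI) simp_all
  ultimately have "prob Q t y = Re ((proj y *\<^sub>v ?v) \<bullet>c (proj y *\<^sub>v ?v))"
    unfolding prob_def using carrier_vecI[OF v] by (subst projection_form) auto
  then show ?thesis using norm v by (simp add: cscalar_prod_self S_def del: of_real_sum)
qed

lemma query_norm: "(Q *\<^sub>v simon_input n) \<bullet>c (Q *\<^sub>v simon_input n) = 1"
proof -
  have v: "dim_vec (Q *\<^sub>v simon_input n) = 2 ^ n * M" using Q_carrier by simp
  have "(\<Sum>i<2 ^ n * M. (cmod ((Q *\<^sub>v simon_input n) $ i))\<^sup>2)
      = (\<Sum>x<(2 :: nat) ^ n. \<Sum>z<M. if z div 2 ^ (2 * n) = h x then amp\<^sup>2 else 0)"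
    unfolding sum_lessThan_mult
    by (intro sum.cong[OF refl]) (auto simp: query_output)
  also have "\<dots> = (\<Sum>x<(2 :: nat) ^ n. 2 ^ (2 * n) * (\<Sum>w<(2::nat) ^ n. if w = h x then amp\<^sup>2 else 0))"
    by (intro sum.cong[OF refl] sum_out_register)
  also have "\<dots> = (\<Sum>x<(2 :: nat) ^ n. 2 ^ (2 * n) * amp\<^sup>2)"
    using h by (intro sum.cong[OF refl]) (auto simp: sum.delta bits_def)
  also have "\<dots> = 1" by (simp add: amp_square)
  finally show ?thesis using v by (simp add: cscalar_prod_self del: of_real_sum)
qed

text \<open>The arguments \<open>x\<close> and \<open>x XOR s\<close> share their image and have
  characters of opposite sign, so every inner sum vanishes.\<close>

lemma prob_simon:
  assumes s: "s \<in> bits n" and simon: "simon_function n s h" and y: "chi n y s \<noteq> 1"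
  shows "prob Q t y = 0"
proof -
  have ys: "chi n y s = -1" using chi_cases[of n y s] y by simp
  have "(\<Sum>x\<in>{x \<in> bits n. h x = w}. chi n y x) = 0" for w
  proof -
    have hs: "h (x XOR s) = h x" if "x \<in> bits n" for x
    proof -
      have "h x = h (x XOR s) \<longleftrightarrow> x XOR s \<in> {x, x XOR s}"
        using simon that xor_bits[OF that s] unfolding simon_function_def by blast
      then show ?thesis by simp
    qed
    have "(\<Sum>x\<in>bits n. if h x = w then chi n y x else 0) = (\<Sum>x\<in>bits n. if h (x XOR s) = w then chi n y (x XOR s) else 0)"
      by (rule sum_xor[OF s, symmetric])
    also have "\<dots> = (\<Sum>x\<in>bits n. - (if h x = w then chi n y x else 0))"
      by (intro sum.cong[OF refl]) (simp add: hs chi_xor ys)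
    finally show ?thesis by (simp add: sum_negf sum.inter_filter)
  qed
  then show ?thesis by (simp add: prob_eq)
qed

text \<open>Every fibre is a single point and contributes 1, so nothing interferes and the outcome
  is uniform.\<close>

lemma prob_perm:
  assumes "bij_betw h (bits n) (bits n)"
  shows "prob Q t y = 1 / 2 ^ n"
proof -
  have "(\<Sum>x\<in>{x \<in> bits n. h x = w}. chi n y x)\<^sup>2 = 1" if "w < 2 ^ n" for w
  proof -
    have "w \<in> h ` bits n" using that bij_betw_imp_surj_on[OF assms] by (simp add: bits_def)
    then obtain x where x: "x \<in> bits n" "h x = w" by auto
    then have "{x \<in> bits n. h x = w} = {x}"
      using bij_betw_imp_inj_on[OF assms] by (auto dest: inj_onD)
    then show ?thesis using chi_square[of n y x] by (simp add: power2_eq_square)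
  qed
  then show ?thesis by (simp add: prob_eq power2_eq_square)
qed

lemma simon_yes:
  assumes s: "s \<in> bits n - {0}" and simon: "simon_function n s h"
  shows "outcome_prob Q alg True \<ge> 2 / 3"
proof -
  have "outcome_prob Q alg False = 0"
    unfolding outcome_prob_alg[OF Q_carrier]
  proof (rule sum.neutral, rule ballI)
    fix ys assume "ys \<in> {ys \<in> answers. consistent n (n + 2) ys = False}"
    then obtain t where t: "t < n + 2" "chi n (ys t) s \<noteq> 1" using s by (auto simp: consistent_def)
    then show "(\<Prod>t<n + 2. prob Q t (ys t)) = 0"
      using prob_simon[OF _ simon, of "ys t" t] s by (intro prod_zero) auto
  qed
  then show ?thesis using outcome_prob_total[OF Q_carrier query_norm] by simp
qed

text \<open>A uniform outcome is orthogonal to a fixed nonzero string with probability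
  \<open>1 / 2\<close>, so the string survives all rounds with probability
  \<open>1 / 2 ^ (n + 2)\<close>. The union bound over fewer than \<open>2 ^ n\<close> strings gives
  error at most \<open>1 / 4\<close>, which explains the two rounds beyond \<open>n\<close>.\<close>

lemma simon_no:
  assumes "bij_betw h (bits n) (bits n)"
  shows "outcome_prob Q alg False \<ge> 2 / 3"
proof -
  let ?T = "n + 2" and ?B = "\<lambda>s. {y \<in> bits n. chi n y s = 1}"
  have "{ys \<in> answers. consistent n ?T ys = True} \<subseteq> (\<Union>s\<in>bits n - {0}. {..<?T} \<rightarrow>\<^sub>E ?B s)"
  proof
    fix ys assume "ys \<in> {ys \<in> answers. consistent n ?T ys = True}"
    then have ys: "ys \<in> answers" "consistent n ?T ys" by auto
    then obtain s where s: "s \<in> bits n - {0}" "\<And>t. t < ?T \<Longrightarrow> chi n (ys t) s = 1"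
      by (auto simp only: consistent_def)
    then have "ys \<in> {..<?T} \<rightarrow>\<^sub>E ?B s" using ys by (simp add: PiE_iff)
    then show "ys \<in> (\<Union>s\<in>bits n - {0}. {..<?T} \<rightarrow>\<^sub>E ?B s)" using s(1) by (rule UN_I[rotated])
  qed
  then have "card {ys \<in> answers. consistent n ?T ys = True} \<le> card (\<Union>s\<in>bits n - {0}. {..<?T} \<rightarrow>\<^sub>E ?B s)"
    by (intro card_mono) (auto intro!: finite_PiE)
  also have "\<dots> \<le> (\<Sum>s\<in>bits n - {0}. card ({..<?T} \<rightarrow>\<^sub>E ?B s))"
    by (rule card_UN_le) simp
  finally have "real (card {ys \<in> answers. consistent n ?T ys = True}) \<le> (\<Sum>s\<in>bits n - {0}. real (card ({..<?T} \<rightarrow>\<^sub>E ?B s)))"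
    by (simp flip: of_nat_sum)
  also have "\<dots> = (\<Sum>s\<in>bits n - {0}. (2 ^ n / 2) ^ ?T)"
    by (intro sum.cong[OF refl]) (simp only: card_PiE finite_lessThan prod_constant card_lessThan of_nat_power card_chi)
  also have "\<dots> = (2 ^ n - 1) * (2 ^ n / 2) ^ ?T" by (simp add: bits_def)
  also have "\<dots> \<le> 2 ^ n * (2 ^ n / 2) ^ ?T" by (intro mult_right_mono) auto
  finally have card: "real (card {ys \<in> answers. consistent n ?T ys = True}) \<le> 2 ^ n * (2 ^ n / 2) ^ ?T" .
  have "outcome_prob Q alg True = card {ys \<in> answers. consistent n ?T ys = True} * (1 / 2 ^ n) ^ ?T"
    unfolding outcome_prob_alg[OF Q_carrier] by (simp add: prob_perm[OF assms])
  also have "\<dots> \<le> 2 ^ n * (2 ^ n / 2) ^ ?T * (1 / 2 ^ n) ^ ?T"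
    by (intro mult_right_mono card) simp
  also have "\<dots> = 1 / 4" by (simp add: power_divide power_add)
  finally show ?thesis using outcome_prob_total[OF Q_carrier query_norm] by simp
qed

end

lemma simon_algorithm: "xor_algorithm n alg"
  unfolding xor_algorithm_def bounded_error_def
proof (intro conjI ballI impI valid_alg)
  fix h r assume hr: "h \<in> bits n \<rightarrow> bits n" "r \<in> bits n \<rightarrow> bits n"
  show "2 / 3 \<le> outcome_prob (garbage_xor_oracle n h r) alg False" if "bij_betw h (bits n) (bits n)"
    by (rule simon_no[OF hr that])
  show "2 / 3 \<le> outcome_prob (garbage_xor_oracle n h r) alg True" if ex: "\<exists>s\<in>bits n - {0}. simon_function n s h"
  proof -
    obtain s where "s \<in> bits n - {0}" "simon_function n s h" using ex by blast
    then show ?thesis by (rule simon_yes[OF hr])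
  qed
qed

end

lemma Q_xor_le:
  assumes "n \<ge> 1"
  shows "Q_xor n \<le> enat (n + 2)"
proof -
  interpret simon n using assms by unfold_locales
  have "Q_xor n \<le> enat (queries alg)"
    unfolding Q_xor_def by (rule Inf_lower) (use simon_algorithm in blast)
  then show ?thesis by (simp only: queries_alg)
qed

section \<open>The theorem\<close>

theorem corollary6p1:
  shows "(\<forall>n\<ge>1.
            (\<forall>S T. valid_strategy (2 ^ n) (2 ^ (3 * n)) S \<and> queries S = T \<and>
                   real T \<le> sqrt (2 ^ n) \<longrightarrow>
               trace_norm (average_state n (perm_dist n) (garbage_erasing_oracle n) S
                         - average_state n (simon_dist n) (garbage_erasing_oracle n) S)
               \<le> real T * (real T - 1) / (2 ^ n - 1) + 6 * real T / sqrt (2 ^ n)) \<and>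
            (\<forall>A. erasing_algorithm n A \<longrightarrow> real (queries A) > sqrt (2 ^ n) / 16)) \<and>
         (\<forall>n\<ge>1. Q_xor n \<le> enat (n + 2)) \<and>
         (\<exists>c C :: real. c > 0 \<and> C > 0 \<and> (\<forall>n\<ge>1.
            ereal (c * 2 powr (real n / 2)) \<le> ereal_of_enat (Q_erase n) \<and>
            ereal_of_enat (Q_erase n) \<le> ereal (C * 2 powr (real n / 2))))"
proof (intro conjI allI impI)
  fix n :: nat assume n: "n \<ge> 1"
  show "trace_norm (average_state n (perm_dist n) (garbage_erasing_oracle n) S
                  - average_state n (simon_dist n) (garbage_erasing_oracle n) S)
      \<le> real T * (real T - 1) / (2 ^ n - 1) + 6 * real T / sqrt (2 ^ n)"
    if "valid_strategy (2 ^ n) (2 ^ (3 * n)) S \<and> queries S = T \<and> real T \<le> sqrt (2 ^ n)" for S T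
  proof -
    interpret erasing_strategy n S using n that by unfold_locales auto
    have "4 * real T / sqrt (2 ^ n) \<le> 6 * real T / sqrt (2 ^ n)" by (intro divide_right_mono) auto
    then show ?thesis using trace_norm_difference that by auto
  qed
  show "real (queries A) > sqrt (2 ^ n) / 16" if "erasing_algorithm n A" for A
    using erasing_lower_bound[OF n that] .
  show "Q_xor n \<le> enat (n + 2)" using Q_xor_le[OF n] .
next
  show "\<exists>c C :: real. c > 0 \<and> C > 0 \<and> (\<forall>n\<ge>1.
            ereal (c * 2 powr (real n / 2)) \<le> ereal_of_enat (Q_erase n) \<and>
            ereal_of_enat (Q_erase n) \<le> ereal (C * 2 powr (real n / 2)))"
    \<comment> \<open>The witness \<open>1 / 16\<close> is the constant of the query lower bound,
      and 4 is that of \<open>T_le\<close>.\<close>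
    using Q_erase_ge Q_erase_le by (intro exI[of _ "1 / 16"] exI[of _ 4]) auto
qed

end
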